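(* Let $N\ge1$, $\mathcal A\in\mathcal P_b(N+1)$ and $\lambda\ge1$. Then the problem $\inf_{\mathcal B\in\mathcal P_b(N+1)}F(\mathcal B,\mathcal A;\lambda)$ has a solution. Moreover, every minimizer $\mathcal A(\lambda)=(A_1(\lambda),\dots,A_{N+1}(\lambda))$ satisfies $\bigcup_{i=1}^NA_i(\lambda)\subseteq\mathrm{hull}(\mathcal A)$.
   Context: An $(N+1)$-partition of $\mathbb R^n$ is $(A_1,\dots,A_{N+1})$, sets of locally finite perimeter with $\sum_i|A_i\cap Q|=|Q|$ for compact $Q$, each identified with its density-one points (so the measure-theoretic boundary equals the topological one); $\mathcal P_b(N+1)$: those with $A_1,\dots,A_N$ bounded. $\mathrm{hull}(\mathcal A)$: closed convex hull of $\bigcup_{j\le N}A_j$. $F(\mathcal B,\mathcal A;\lambda)=\frac12\sum_{j=1}^{N+1}P(B_j)+\frac\lambda2\sum_{j=1}^{N+1}\bar\sigma(B_j,A_j)$, where $\bar\sigma(E,G)=\int_{E\Delta G}d(x,\partial G)dx$ (equal to $0$ if $|E\Delta G|=0$ and $+\infty$ if $\partial G=\emptyset$ and $|E\Delta G|>0$). *)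

theory Defs
  imports "HOL-Analysis.Analysis"
begin

definition divergence :: "('a::euclidean_space \<Rightarrow> 'a) \<Rightarrow> 'a \<Rightarrow> real" where
  "divergence \<phi> x = (\<Sum>b\<in>Basis. (frechet_derivative \<phi> (at x) b) \<bullet> b)"

definition test_fields :: "'a::euclidean_space set \<Rightarrow> ('a \<Rightarrow> 'a) set" where
  "test_fields U = {\<phi>. (\<forall>x. \<phi> differentiable (at x))
      \<and> (\<forall>b\<in>Basis. continuous_on UNIV (\<lambda>x. frechet_derivative \<phi> (at x) b))
      \<and> compact (closure {x. \<phi> x \<noteq> 0}) \<and> closure {x. \<phi> x \<noteq> 0} \<subseteq> U
      \<and> (\<forall>x. norm (\<phi> x) \<le> 1)}"

definition rel_perimeter :: "'a::euclidean_space set \<Rightarrow> 'a set \<Rightarrow> ennreal" where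
  "rel_perimeter U E = (SUP \<phi>\<in>test_fields U. ennreal (integral E (divergence \<phi>)))"

definition perimeter :: "'a::euclidean_space set \<Rightarrow> ennreal" where
  "perimeter E = rel_perimeter UNIV E"

definition locally_finite_perimeter :: "'a::euclidean_space set \<Rightarrow> bool" where
  "locally_finite_perimeter E \<longleftrightarrow> E \<in> sets lebesgue \<and>
     (\<forall>U. open U \<and> bounded U \<longrightarrow> rel_perimeter U E < \<infinity>)"

definition density_one_points :: "'a::euclidean_space set \<Rightarrow> 'a set" where
  "density_one_points E = {x. ((\<lambda>r. measure lebesgue (E \<inter> ball x r) / measure lebesgue (ball x r))
        \<longlongrightarrow> 1) (at_right 0)}"

definition partition_Np1 :: "nat \<Rightarrow> (nat \<Rightarrow> 'a::euclidean_space set) \<Rightarrow> bool" where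
  "partition_Np1 N A \<longleftrightarrow>
     (\<forall>i\<in>{1..N+1}. locally_finite_perimeter (A i) \<and> A i = density_one_points (A i)) \<and>
     (\<forall>Q. compact Q \<longrightarrow> (\<Sum>i=1..N+1. measure lebesgue (A i \<inter> Q)) = measure lebesgue Q)"

definition partition_b :: "nat \<Rightarrow> (nat \<Rightarrow> 'a::euclidean_space set) \<Rightarrow> bool" where
  "partition_b N A \<longleftrightarrow> partition_Np1 N A \<and> (\<forall>i\<in>{1..N}. bounded (A i))"

definition partition_hull :: "nat \<Rightarrow> (nat \<Rightarrow> 'a::euclidean_space set) \<Rightarrow> 'a set" where
  "partition_hull N A = closure (convex hull (\<Union>j\<in>{1..N}. A j))"

definition sigma_bar :: "'a::euclidean_space set \<Rightarrow> 'a set \<Rightarrow> ennreal" where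
  "sigma_bar E G =
     (if emeasure lebesgue ((E - G) \<union> (G - E)) = 0 then 0
      else if frontier G = {} then \<infinity>
      else (\<integral>\<^sup>+ x. indicator ((E - G) \<union> (G - E)) x * ennreal (infdist x (frontier G)) \<partial>lebesgue))"

definition F_energy :: "nat \<Rightarrow> (nat \<Rightarrow> 'a::euclidean_space set) \<Rightarrow> (nat \<Rightarrow> 'a set) \<Rightarrow> real \<Rightarrow> ennreal" where
  "F_energy N B A lam = ennreal (1/2) * (\<Sum>j=1..N+1. perimeter (B j))
      + ennreal (lam/2) * (\<Sum>j=1..N+1. sigma_bar (B j) (A j))"

end

theory Submission
  imports Defs
begin

text \<open>
  Existence is the direct method. Truncating a competitor to the closed convex hull \<open>K\<close> of the bounded
  phases does not raise the energy: \<open>K\<close> is a countable intersection of half-spaces, and cutting a bounded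
  set by a half-space lowers its perimeter, while the outer phase has the perimeter of the union of the
  bounded ones. So a minimizing sequence may be taken inside \<open>K\<close>. The translation estimate
  \<open>|E - (E - h)| \<le> |h| P(E)\<close> shows that sets of bounded perimeter are close to unions of cells of a fine
  grid, hence totally bounded; a subsequence converges almost everywhere, and perimeter and distance
  terms are lower semicontinuous. By the Lebesgue density theorem the limit has a representative made of
  density-one points. Every minimizer lies in \<open>K\<close> because truncation gains
  \<open>\<integral> d(x, \<partial>A\<^sub>i) dx\<close> over \<open>B\<^sub>i - K\<close>, where the distance is positive.
\<close>

section \<open>Continuously differentiable functions and test fields\<close>


text \<open>The normalisation by density-one points survives neither truncation nor passage to a
  limit. Hence the work is done in the class \<open>ae_partition\<close>, which keeps only
  measurability, boundedness and the covering property up to null sets. Perimeter, and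
  \<open>sigma_bar\<close> in its first argument, ignore null sets, so the normalisation is restored
  at the end at no cost; in its second argument \<open>sigma_bar\<close> sees the topological
  frontier, but \<open>A\<close> never changes. The outer phase is unbounded and a priori has only
  locally finite perimeter. It is controlled through the bounded phases: up to a null set it is the
  complement of their union, and complements have equal perimeter because a compactly supported
  field has total divergence 0. Test fields are only C^1, so every cutoff can be built from the
  square of \<open>max 0 t\<close>. A bounded phase \<open>A i\<close> with empty frontier offers no
  distance to integrate. There \<open>sigma_bar\<close> takes only the values 0 and infinity, and
  finite energy forces agreement with \<open>A i\<close> almost everywhere.\<close>

definition cont_diff :: "('a::euclidean_space \<Rightarrow> 'b::real_normed_vector) \<Rightarrow> bool" where
  "cont_diff f \<longleftrightarrow> (\<forall>x. f differentiable (at x)) \<and>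
     (\<forall>v. continuous_on UNIV (\<lambda>x. frechet_derivative f (at x) v))"

lemma frechet_derivative_eqI:
  "(f has_derivative f') (at x) \<Longrightarrow> frechet_derivative f (at x) = f'"
  by (metis frechet_derivative_at)

lemma cont_diffI:
  assumes "\<And>x. (f has_derivative f' x) (at x)" "\<And>v. continuous_on UNIV (\<lambda>x. f' x v)"
  shows "cont_diff f"
  unfolding cont_diff_def differentiable_def frechet_derivative_eqI[OF assms(1)] using assms by blast

lemma cont_diffD:
  assumes "cont_diff f"
  shows "(f has_derivative frechet_derivative f (at x)) (at x)"
    "continuous_on UNIV (\<lambda>x. frechet_derivative f (at x) v)"
  using assms unfolding cont_diff_def by (auto simp: frechet_derivative_works[symmetric])

lemma cont_diff_continuous: "cont_diff f \<Longrightarrow> continuous_on UNIV f"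
  by (meson cont_diffD(1) has_derivative_continuous continuous_at_imp_continuous_on)

lemma cont_diff_const: "cont_diff (\<lambda>x. c)"
  by (rule cont_diffI[where f' = "\<lambda>x v. 0"]) auto

lemma cont_diff_add:
  assumes "cont_diff f" "cont_diff g"
  shows "cont_diff (\<lambda>x. f x + g x)"
  by (rule cont_diffI[where f' = "\<lambda>x v. frechet_derivative f (at x) v + frechet_derivative g (at x) v"])
     (auto intro!: has_derivative_add continuous_intros cont_diffD[OF assms(1)] cont_diffD[OF assms(2)])

lemma cont_diff_sum:
  assumes "\<And>i. i \<in> I \<Longrightarrow> cont_diff (f i)"
  shows "cont_diff (\<lambda>x. \<Sum>i\<in>I. f i x)"
  using assms by (induction I rule: infinite_finite_induct) (auto intro!: cont_diff_const cont_diff_add)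

lemma has_derivative_scaleR_fields:
  assumes "cont_diff f" "cont_diff g"
  shows "((\<lambda>x. f x *\<^sub>R g x) has_derivative
    (\<lambda>v. f x *\<^sub>R frechet_derivative g (at x) v + frechet_derivative f (at x) v *\<^sub>R g x)) (at x)"
  by (rule has_derivative_scaleR[OF cont_diffD(1)[OF assms(1)] cont_diffD(1)[OF assms(2)]])

lemma cont_diff_scaleR:
  assumes "cont_diff f" "cont_diff g"
  shows "cont_diff (\<lambda>x. f x *\<^sub>R g x)"
  by (rule cont_diffI[OF has_derivative_scaleR_fields[OF assms]])
     (intro continuous_intros cont_diffD[OF assms(1)] cont_diffD[OF assms(2)]
       cont_diff_continuous assms)

lemma has_derivative_compose_real:
  assumes f: "cont_diff f" and g: "\<And>t. (g has_real_derivative g' t) (at t)"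
  shows "((\<lambda>x. g (f x)) has_derivative (\<lambda>v. g' (f x) * frechet_derivative f (at x) v)) (at x)"
  using has_derivative_compose[OF cont_diffD(1)[OF f], of g "(*) (g' (f x))" x]
    g[of "f x"] by (simp add: has_field_derivative_def)

lemma cont_diff_compose_real:
  assumes f: "cont_diff f" and g: "\<And>t. (g has_real_derivative g' t) (at t)"
    and g': "continuous_on UNIV g'"
  shows "cont_diff (\<lambda>x. g (f x))"
proof (rule cont_diffI[OF has_derivative_compose_real[OF f g]])
  show "continuous_on UNIV (\<lambda>x. g' (f x) * frechet_derivative f (at x) v)" for v
    by (intro continuous_intros cont_diffD[OF f] continuous_on_compose2[OF g'] cont_diff_continuous f) auto
qed

lemma has_derivative_translate:
  assumes "cont_diff f"
  shows "((\<lambda>x. f (x + a)) has_derivative frechet_derivative f (at (x + a))) (at x)"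
proof -
  have "((\<lambda>x. x + a) has_derivative (\<lambda>v. v)) (at x)"
    by (auto intro!: derivative_eq_intros)
  from has_derivative_compose[OF this cont_diffD(1)[OF assms]] show ?thesis by simp
qed

lemma cont_diff_translate:
  assumes "cont_diff f"
  shows "cont_diff (\<lambda>x. f (x + a))"
proof (rule cont_diffI[OF has_derivative_translate[OF assms]])
  show "continuous_on UNIV (\<lambda>x. frechet_derivative f (at (x + a)) v)" for v
    by (rule continuous_on_compose2[OF cont_diffD(2)[OF assms, of v]]) (auto intro!: continuous_intros)
qed

lemma cont_diff_dist_sq: "cont_diff (\<lambda>x. (x - c) \<bullet> (x - c))"
  by (rule cont_diffI[where f' = "\<lambda>x v. 2 * ((x - c) \<bullet> v)"])
     (auto intro!: derivative_eq_intros continuous_intros simp: inner_commute)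

lemma cont_diff_affine: "cont_diff (\<lambda>x. (a \<bullet> x - t) / s)"
  and frechet_derivative_affine: "frechet_derivative (\<lambda>x. (a \<bullet> x - t) / s) (at x) v = (a \<bullet> v) / s"
proof -
  have d: "((\<lambda>x. (a \<bullet> x - t) / s) has_derivative (\<lambda>v. (a \<bullet> v) / s)) (at x)" for x
    unfolding divide_inverse by (auto intro!: derivative_eq_intros)
  show "cont_diff (\<lambda>x. (a \<bullet> x - t) / s)"
    by (rule cont_diffI[OF d]) (auto intro!: continuous_intros)
  show "frechet_derivative (\<lambda>x. (a \<bullet> x - t) / s) (at x) v = (a \<bullet> v) / s"
    by (simp add: frechet_derivative_eqI[OF d])
qed

section \<open>A continuously differentiable step function and cutoffs\<close>

definition pos_sq :: "real \<Rightarrow> real" where "pos_sq t = (max 0 t)\<^sup>2"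

lemma DERIV_pos_sq: "(pos_sq has_real_derivative 2 * max 0 t) (at t)"
proof (cases "t = 0")
  case True
  have "((\<lambda>h. (pos_sq (0 + h) - pos_sq 0) / h) \<longlongrightarrow> 0) (at 0)"
  proof (rule Lim_null_comparison)
    show "\<forall>\<^sub>F h in at 0. norm ((pos_sq (0 + h) - pos_sq 0) / h) \<le> \<bar>h\<bar>"
      by (intro always_eventually) (auto simp: pos_sq_def max_def power2_eq_square)
    show "((\<lambda>h::real. \<bar>h\<bar>) \<longlongrightarrow> 0) (at 0)" by (auto intro!: tendsto_eq_intros)
  qed
  then show ?thesis using True by (simp add: DERIV_def)
next
  case False
  consider "t > 0" | "t < 0" using False by linarith
  then show ?thesis
  proof cases
    case 1
    have "((\<lambda>t. t\<^sup>2) has_real_derivative 2 * max 0 t) (at t)"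
      using 1 by (auto intro!: derivative_eq_intros)
    then show ?thesis
      by (rule DERIV_cong_ev[THEN iffD1, rotated -1, OF _ refl _ refl])
         (use 1 in \<open>auto simp: pos_sq_def eventually_nhds intro!: exI[of _ "{0<..}"]\<close>)
  next
    case 2
    have "((\<lambda>t. 0) has_real_derivative 2 * max 0 t) (at t)"
      using 2 by (auto intro!: derivative_eq_intros)
    then show ?thesis
      by (rule DERIV_cong_ev[THEN iffD1, rotated -1, OF _ refl _ refl])
         (use 2 in \<open>auto simp: pos_sq_def eventually_nhds intro!: exI[of _ "{..<0}"]\<close>)
  qed
qed

text \<open>On [0,1] this is 1 - (1 - t^2)^2: two nested copies of \<open>pos_sq\<close> glue the
  constants 0 and 1 with matching first derivatives, which is all the smoothness that test fields
  require.\<close>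

definition smooth_step :: "real \<Rightarrow> real" where "smooth_step t = 1 - pos_sq (1 - pos_sq t)"
definition smooth_step' :: "real \<Rightarrow> real" where
  "smooth_step' t = 4 * max 0 (1 - pos_sq t) * max 0 t"

lemma DERIV_smooth_step: "(smooth_step has_real_derivative smooth_step' t) (at t)"
  unfolding smooth_step_def[abs_def] smooth_step'_def
  by (rule derivative_eq_intros DERIV_chain2[OF DERIV_pos_sq] DERIV_pos_sq refl)+ simp

lemma continuous_smooth_step': "continuous_on UNIV smooth_step'"
  unfolding smooth_step'_def[abs_def] pos_sq_def[abs_def] by (intro continuous_intros)

lemma smooth_step'_nonneg: "smooth_step' t \<ge> 0"
  by (auto simp: smooth_step'_def)

lemma pos_sq_nonneg: "pos_sq t \<ge> 0" by (simp add: pos_sq_def)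

lemma smooth_step_bounds: "0 \<le> smooth_step t" "smooth_step t \<le> 1"
proof -
  have "pos_sq (1 - pos_sq t) \<le> 1"
    using pos_sq_nonneg[of t] by (auto simp: pos_sq_def max_def power_le_one)
  then show "0 \<le> smooth_step t" "smooth_step t \<le> 1"
    using pos_sq_nonneg by (auto simp: smooth_step_def)
qed

lemma smooth_step_eq: "t \<le> 0 \<Longrightarrow> smooth_step t = 0" "t \<ge> 1 \<Longrightarrow> smooth_step t = 1"
  by (auto simp: smooth_step_def pos_sq_def)

text \<open>A finite sum of ball bumps is positive on the compact set; a smooth step flattens it to 1 there.\<close>
lemma cont_diff_Urysohn:
  fixes C U :: "'a::euclidean_space set"
  assumes C: "compact C" and U: "open U" and CU: "C \<subseteq> U"
  obtains f :: "'a \<Rightarrow> real" where "cont_diff f" "\<And>x. 0 \<le> f x" "\<And>x. f x \<le> 1"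
    "\<And>x. x \<in> C \<Longrightarrow> f x = 1" "compact (closure {x. f x \<noteq> 0})" "closure {x. f x \<noteq> 0} \<subseteq> U"
proof -
  have "\<exists>r>0. cball x r \<subseteq> U" if "x \<in> C" for x
    using open_contains_cball U CU that by blast
  then obtain r where r: "\<And>x. x \<in> C \<Longrightarrow> r x > 0 \<and> cball x (r x) \<subseteq> U" by metis
  obtain D where D: "D \<subseteq> C" "finite D" "C \<subseteq> (\<Union>x\<in>D. ball x (r x))"
    by (rule compactE_image[OF C, of C "\<lambda>x. ball x (r x)"]) (use r in auto)
  \<comment> \<open>With this factor \<open>1 + |x - c|^2 * q c\<close> is positive exactly on the
    open ball of radius \<open>r c\<close>.\<close>
  define q where "q = (\<lambda>c. - 1 / (r c)\<^sup>2)"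
  define b where "b = (\<lambda>c x. pos_sq (1 + (((x - c) \<bullet> (x - c)) * q c)))"
  define s where "s = (\<lambda>x. \<Sum>c\<in>D. b c x)"
  have cb: "cont_diff (b c)" for c
    unfolding b_def
    by (rule cont_diff_compose_real[where g' = "\<lambda>t. 2 * max 0 (1 + t * q c) * q c", OF cont_diff_dist_sq])
       (auto intro!: derivative_eq_intros DERIV_chain2[OF DERIV_pos_sq] continuous_intros)
  have cs: "cont_diff s" unfolding s_def by (intro cont_diff_sum cb)
  have bpos: "b c x > 0 \<longleftrightarrow> x \<in> ball c (r c)" and b0: "b c x \<ge> 0" if "c \<in> D" for c x
  proof -
    have "r c > 0" using r D that by auto
    have "b c x > 0 \<longleftrightarrow> (x - c) \<bullet> (x - c) < (r c)\<^sup>2"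
      using \<open>r c > 0\<close> by (auto simp: b_def q_def pos_sq_def max_def field_simps)
    also have "\<dots> \<longleftrightarrow> norm (x - c) < r c"
      using \<open>r c > 0\<close> by (simp add: norm_lt_square)
    finally show "b c x > 0 \<longleftrightarrow> x \<in> ball c (r c)" by (simp add: dist_norm norm_minus_commute)
    show "b c x \<ge> 0" by (simp add: b_def pos_sq_nonneg)
  qed
  have spos: "s x > 0" if x: "x \<in> C" for x
  proof -
    obtain c where "c \<in> D" "x \<in> ball c (r c)" using D x by auto
    then show ?thesis unfolding s_def using bpos b0 by (intro sum_pos2[OF D(2)]) auto
  qed
  obtain m where m: "m > 0" "\<And>x. x \<in> C \<Longrightarrow> s x \<ge> m"
  proof (cases "C = {}")
    case True then show ?thesis using that[of 1] by auto
  next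
    case False
    obtain z where "z \<in> C" "\<And>x. x \<in> C \<Longrightarrow> s z \<le> s x"
      using continuous_attains_inf[OF C False continuous_on_subset[OF cont_diff_continuous[OF cs]]] by auto
    then show ?thesis using that[of "s z"] spos by auto
  qed
  \<comment> \<open>Dividing by the lower bound \<open>m\<close> of \<open>s\<close> on
    \<open>C\<close> makes the argument at least 1 there, where \<open>smooth_step\<close> is
    constantly 1; the zero set of \<open>s\<close> is kept.\<close>
  define f where "f = (\<lambda>x. smooth_step (s x * (1 / m)))"
  have "cont_diff f" unfolding f_def
    by (rule cont_diff_compose_real[where g' = "\<lambda>t. smooth_step' (t * (1 / m)) * (1 / m)", OF cs])
       (use m(1) in \<open>auto intro!: continuous_intros derivative_eq_intros continuous_on_compose2[OF continuous_smooth_step']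
          DERIV_chain2[OF DERIV_smooth_step] simp del: times_divide_eq_right mult_1_right\<close>)
  have sub: "closure {x. f x \<noteq> 0} \<subseteq> (\<Union>c\<in>D. cball c (r c))"
  proof (rule closure_minimal)
    show "closed (\<Union>c\<in>D. cball c (r c))" using D by auto
    show "{x. f x \<noteq> 0} \<subseteq> (\<Union>c\<in>D. cball c (r c))"
    proof clarify
      fix x assume "f x \<noteq> 0"
      then have "s x \<noteq> 0" by (auto simp: f_def smooth_step_eq)
      then obtain c where "c \<in> D" "b c x \<noteq> 0" unfolding s_def by (meson sum.neutral)
      then show "x \<in> (\<Union>c\<in>D. cball c (r c))" using bpos[of c x] b0[of c x] by force
    qed
  qed
  show ?thesis
  proof
    show "cont_diff f" by fact
    show "0 \<le> f x" "f x \<le> 1" for x using smooth_step_bounds by (auto simp: f_def)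
    show "f x = 1" if "x \<in> C" for x
      using m(1) m(2)[OF that] by (auto simp: f_def intro!: smooth_step_eq)
    have "compact (\<Union>c\<in>D. cball c (r c))" using D by (intro compact_UN) auto
    then have "bounded (closure {x. f x \<noteq> 0})" using sub compact_imp_bounded bounded_subset by blast
    then show "compact (closure {x. f x \<noteq> 0})" by (simp add: compact_eq_bounded_closed)
    show "closure {x. f x \<noteq> 0} \<subseteq> U" using sub D r by fastforce
  qed
qed

section \<open>Divergence and test fields\<close>

lemma frechet_derivative_eq_0:
  assumes "open V" "x \<in> V" "\<And>y. y \<in> V \<Longrightarrow> f y = c"
  shows "frechet_derivative f (at x) = (\<lambda>v. 0)"
proof (rule frechet_derivative_eqI)
  show "(f has_derivative (\<lambda>v. 0)) (at x)"
    by (rule has_derivative_transform_within_open[OF has_derivative_const[of c] assms(1,2)]) (use assms(3) in auto)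
qed

lemma frechet_derivative_outside_support:
  assumes "x \<notin> closure {x. f x \<noteq> 0}"
  shows "frechet_derivative f (at x) = (\<lambda>v. 0)"
  by (rule frechet_derivative_eq_0[of "- closure {x. f x \<noteq> 0}" _ _ 0])
     (use assms closure_subset[of "{x. f x \<noteq> 0}"] in auto)

lemma divergence_outside_support:
  assumes "x \<notin> closure {x. \<phi> x \<noteq> 0}"
  shows "divergence \<phi> x = 0"
  by (simp add: divergence_def frechet_derivative_outside_support[OF assms])

lemma continuous_divergence: "cont_diff \<phi> \<Longrightarrow> continuous_on UNIV (divergence \<phi>)"
  unfolding divergence_def[abs_def] by (intro continuous_intros cont_diffD(2))

lemma divergence_add:
  assumes "cont_diff \<phi>" "cont_diff \<psi>"
  shows "divergence (\<lambda>x. \<phi> x + \<psi> x) x = divergence \<phi> x + divergence \<psi> x"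
  using frechet_derivative_eqI[OF has_derivative_add[OF cont_diffD(1)[OF assms(1)] cont_diffD(1)[OF assms(2)]]]
  by (simp add: divergence_def inner_add_left sum.distrib)

lemma divergence_scaleR:
  assumes "cont_diff f" "cont_diff \<phi>"
  shows "divergence (\<lambda>x. f x *\<^sub>R \<phi> x) x = f x * divergence \<phi> x + frechet_derivative f (at x) (\<phi> x)"
proof -
  have lin: "linear (frechet_derivative f (at x))"
    using cont_diffD(1)[OF assms(1)] has_derivative_linear by blast
  have "frechet_derivative f (at x) (\<phi> x) = frechet_derivative f (at x) (\<Sum>b\<in>Basis. (\<phi> x \<bullet> b) *\<^sub>R b)"
    by (simp add: euclidean_representation)
  also have "\<dots> = (\<Sum>b\<in>Basis. (\<phi> x \<bullet> b) * frechet_derivative f (at x) b)"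
    by (simp add: linear_sum[OF lin] linear_scale[OF lin])
  finally show ?thesis
    by (simp add: divergence_def frechet_derivative_eqI[OF has_derivative_scaleR_fields[OF assms]]
        inner_add_left sum.distrib sum_distrib_left mult_ac)
qed

lemma divergence_const: "divergence (\<lambda>x. c) x = 0"
  by (simp add: divergence_def)

lemma divergence_scaleR_const:
  assumes "cont_diff f"
  shows "divergence (\<lambda>x. f x *\<^sub>R v) x = frechet_derivative f (at x) v"
  using divergence_scaleR[OF assms cont_diff_const[of v]] by (simp add: divergence_const)

text \<open>\<open>test_fields\<close> asks for continuity of the derivative in basis directions
  only, \<open>cont_diff\<close> in all directions. Linearity of the derivative makes the two agree,
  and the second form is the one that is closed under products and compositions by direct
  calculation.\<close>

lemma test_fields_iff:
  "\<phi> \<in> test_fields U \<longleftrightarrow> cont_diff \<phi> \<and> compact (closure {x. \<phi> x \<noteq> 0}) \<and>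
     closure {x. \<phi> x \<noteq> 0} \<subseteq> U \<and> (\<forall>x. norm (\<phi> x) \<le> 1)"
proof -
  have "cont_diff \<phi>" if d: "\<forall>x. \<phi> differentiable (at x)"
    and c: "\<forall>b\<in>Basis. continuous_on UNIV (\<lambda>x. frechet_derivative \<phi> (at x) b)"
  proof -
    have eq: "frechet_derivative \<phi> (at x) v = (\<Sum>b\<in>Basis. (v \<bullet> b) *\<^sub>R frechet_derivative \<phi> (at x) b)" for x v
    proof -
      have lin: "linear (frechet_derivative \<phi> (at x))"
        using d frechet_derivative_works has_derivative_linear by blast
      have "frechet_derivative \<phi> (at x) v = frechet_derivative \<phi> (at x) (\<Sum>b\<in>Basis. (v \<bullet> b) *\<^sub>R b)"
        by (simp add: euclidean_representation)
      then show ?thesis by (simp add: linear_sum[OF lin] linear_scale[OF lin])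
    qed
    have "continuous_on UNIV (\<lambda>x. frechet_derivative \<phi> (at x) v)" for v
      by (subst eq) (use c in \<open>auto intro!: continuous_intros\<close>)
    then show ?thesis using d unfolding cont_diff_def by blast
  qed
  moreover have "\<phi> differentiable (at x)" "continuous_on UNIV (\<lambda>x. frechet_derivative \<phi> (at x) b)"
    if "cont_diff \<phi>" for x b
    using that unfolding cont_diff_def by blast+
  ultimately show ?thesis unfolding test_fields_def by blast
qed

lemma compact_support_bounded:
  fixes f :: "'a::euclidean_space \<Rightarrow> 'b::zero"
  assumes "bounded S" "{x. f x \<noteq> 0} \<subseteq> S"
  shows "compact (closure {x. f x \<noteq> 0})"
  using bounded_subset[OF assms] by simp

lemma integrable_compact_support:
  fixes g :: "'a::euclidean_space \<Rightarrow> real"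
  assumes "continuous_on UNIV g" "compact K" "\<And>x. x \<notin> K \<Longrightarrow> g x = 0"
  shows "integrable lborel g"
proof -
  have "set_integrable lborel K g"
    unfolding set_integrable_def
    by (rule borel_integrable_compact[OF assms(2)]) (use assms(1) continuous_on_subset in blast)
  moreover have "(\<lambda>x. indicator K x *\<^sub>R g x) = g" using assms(3) by (auto simp: indicator_def fun_eq_iff)
  ultimately show ?thesis by (simp add: set_integrable_def)
qed

text \<open>Rescaling by \<open>1 / M\<close> produces an admissible field; this frees later
  constructions from the bound 1.\<close>

lemma perimeter_field_le:
  assumes \<phi>: "cont_diff \<phi>" "compact (closure {x. \<phi> x \<noteq> 0})" "\<And>x. norm (\<phi> x) \<le> M"
    and M: "M > 0"
  shows "ennreal (integral E (divergence \<phi>)) \<le> ennreal M * perimeter E"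
proof -
  let ?\<psi> = "\<lambda>x. (1 / M) *\<^sub>R \<phi> x"
  have "{x. ?\<psi> x \<noteq> 0} = {x. \<phi> x \<noteq> 0}" using M by auto
  then have t: "?\<psi> \<in> test_fields UNIV"
    using \<phi> M by (auto simp: test_fields_iff intro!: cont_diff_scaleR cont_diff_const)
  have div: "divergence ?\<psi> = (\<lambda>x. (1 / M) * divergence \<phi> x)"
    using divergence_scaleR[OF cont_diff_const \<phi>(1)] by (auto simp: fun_eq_iff)
  have "ennreal (integral E (divergence ?\<psi>)) \<le> perimeter E"
    unfolding perimeter_def rel_perimeter_def by (rule SUP_upper[OF t])
  then have "ennreal M * ennreal (integral E (divergence ?\<psi>)) \<le> ennreal M * perimeter E"
    by (rule mult_left_mono) simp
  moreover have "ennreal M * ennreal (integral E (divergence ?\<psi>)) = ennreal (integral E (divergence \<phi>))"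
    using M by (simp add: div ennreal_mult'[symmetric])
  ultimately show ?thesis by simp
qed

section \<open>Perimeter under limits, complements and convex truncation\<close>


abbreviation ae_eq :: "'a::euclidean_space set \<Rightarrow> 'a set \<Rightarrow> bool" where
  "ae_eq E G \<equiv> AE x in lebesgue. x \<in> E \<longleftrightarrow> x \<in> G"

text \<open>Almost everywhere convergence of indicator functions: since they take two values,
  convergence means that membership is eventually constant. The notion passes to subsequences and
  feeds both dominated convergence and Fatou's lemma.\<close>

abbreviation ae_tendsto :: "(nat \<Rightarrow> 'a::euclidean_space set) \<Rightarrow> 'a set \<Rightarrow> bool" where
  "ae_tendsto E G \<equiv> AE x in lebesgue. \<forall>\<^sub>F k in sequentially. x \<in> E k \<longleftrightarrow> x \<in> G"

lemma AE_lebesgue_iff_negligible: "(AE x in lebesgue. P x) \<longleftrightarrow> negligible {x. \<not> P x}"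
proof
  assume "AE x in lebesgue. P x"
  then obtain N where "N \<in> null_sets lebesgue" "{x. \<not> P x} \<subseteq> N"
    by (auto simp: eventually_ae_filter)
  then show "negligible {x. \<not> P x}" using negligible_iff_null_sets negligible_subset by blast
next
  assume "negligible {x. \<not> P x}"
  then show "AE x in lebesgue. P x"
    by (auto simp: negligible_iff_null_sets eventually_ae_filter)
qed

lemma ae_eq_integral:
  fixes f :: "'a::euclidean_space \<Rightarrow> real"
  assumes "ae_eq E G"
  shows "integral E f = integral G f"
proof -
  have "negligible {x. \<not> (x \<in> E \<longleftrightarrow> x \<in> G)}" using assms by (simp add: AE_lebesgue_iff_negligible)
  then show ?thesis by (intro integral_spike_set) (auto elim: negligible_subset)
qed

lemma ae_eq_perimeter: "ae_eq E G \<Longrightarrow> perimeter E = perimeter G"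
  by (simp add: perimeter_def rel_perimeter_def ae_eq_integral[of E G])

text \<open>Completeness of Lebesgue measure: any part of the exceptional null set is itself
  measurable.\<close>

lemma ae_eq_sets_lebesgue:
  assumes "ae_eq E G" "E \<in> sets lebesgue"
  shows "G \<in> sets lebesgue"
proof -
  let ?N = "{x. \<not> (x \<in> E \<longleftrightarrow> x \<in> G)}"
  have n: "negligible ?N" using assms by (simp add: AE_lebesgue_iff_negligible)
  have eq: "G = (E - ?N) \<union> (?N \<inter> G)" by auto
  have N: "?N \<in> sets lebesgue" "?N \<inter> G \<in> sets lebesgue"
    using n negligible_subset[OF n] by (auto intro!: negligible_imp_sets)
  show ?thesis by (subst eq) (intro sets.Un sets.Diff N assms(2))
qed

text \<open>\<open>integral\<close> in the definition of the perimeter is the gauge integral; this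
  is the bridge to the Lebesgue integral and its limit theorems.\<close>

lemma integral_eq_lebesgue:
  fixes g :: "'a::euclidean_space \<Rightarrow> real"
  assumes "integrable lebesgue g" "E \<in> sets lebesgue"
  shows "integral E g = (LINT x|lebesgue. indicator E x * g x)"
proof -
  have "set_integrable lebesgue E g"
    unfolding set_integrable_def by (rule integrable_mult_indicator[OF assms(2,1)])
  then show ?thesis
    by (simp add: set_lebesgue_integral_eq_integral(2)[symmetric] set_lebesgue_integral_def)
qed

lemma integrable_compact_support_lebesgue:
  fixes g :: "'a::euclidean_space \<Rightarrow> real"
  assumes "continuous_on UNIV g" "compact K" "\<And>x. x \<notin> K \<Longrightarrow> g x = 0"
  shows "integrable lebesgue g"
  using integrable_compact_support[OF assms] by (simp add: integrable_completion)

lemma integrable_divergence: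
  assumes "cont_diff \<phi>" "compact (closure {x. \<phi> x \<noteq> 0})"
  shows "integrable lebesgue (divergence \<phi>)"
  by (rule integrable_compact_support_lebesgue[OF continuous_divergence[OF assms(1)] assms(2)])
     (rule divergence_outside_support)

lemma integrable_indicator_times:
  fixes g :: "'a::euclidean_space \<Rightarrow> real"
  assumes "integrable lebesgue g" "E \<in> sets lebesgue"
  shows "integrable lebesgue (\<lambda>x. indicator E x * g x)"
  using integrable_mult_indicator[OF assms(2,1)] by simp

lemma integral_tendsto_ae:
  fixes g :: "'a::euclidean_space \<Rightarrow> real"
  assumes g: "integrable lebesgue g" and E: "\<And>k. E k \<in> sets lebesgue" "G \<in> sets lebesgue"
    and lim: "ae_tendsto E G"
  shows "(\<lambda>k. integral (E k) g) \<longlonglongrightarrow> integral G g"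
proof -
  have "(\<lambda>k. LINT x|lebesgue. indicator (E k) x * g x) \<longlonglongrightarrow> (LINT x|lebesgue. indicator G x * g x)"
  proof (rule integral_dominated_convergence[where w = "\<lambda>x. norm (g x)"])
    show "AE x in lebesgue. (\<lambda>k. indicator (E k) x * g x) \<longlonglongrightarrow> indicator G x * g x"
      using lim
    proof eventually_elim
      case (elim x)
      then have "\<forall>\<^sub>F k in sequentially. indicator (E k) x * g x = indicator G x * g x"
        by eventually_elim (simp add: indicator_def)
      then show ?case by (simp add: tendsto_eventually)
    qed
    show "AE x in lebesgue. norm (indicator (E k) x * g x) \<le> norm (g x)" for k
      by (auto simp: indicator_def)
    show "integrable lebesgue (\<lambda>x. norm (g x))" using g by simp
    show "(\<lambda>x. indicator G x * g x) \<in> borel_measurable lebesgue"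
         "(\<lambda>x. indicator (E k) x * g x) \<in> borel_measurable lebesgue" for k
      using integrable_indicator_times[OF g] E by (auto intro!: borel_measurable_integrable)
  qed
  then show ?thesis by (simp add: integral_eq_lebesgue[OF g] E)
qed

text \<open>For each fixed test field the integral of its divergence passes to the limit, and a
  supremum of continuous functionals is lower semicontinuous.\<close>

lemma perimeter_lsc:
  assumes E: "\<And>k. E k \<in> sets lebesgue" "G \<in> sets lebesgue" and lim: "ae_tendsto E G"
  shows "perimeter G \<le> liminf (\<lambda>k. perimeter (E k))"
  unfolding perimeter_def[of G] rel_perimeter_def
proof (rule SUP_least)
  fix \<phi> :: "'a \<Rightarrow> 'a" assume \<phi>: "\<phi> \<in> test_fields UNIV"
  then have "integrable lebesgue (divergence \<phi>)" by (auto simp: test_fields_iff intro!: integrable_divergence)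
  from tendsto_ennrealI[OF integral_tendsto_ae[OF this E lim]]
  have "ennreal (integral G (divergence \<phi>)) = liminf (\<lambda>k. ennreal (integral (E k) (divergence \<phi>)))"
    by (rule lim_imp_Liminf[OF sequentially_bot, symmetric])
  also have "\<dots> \<le> liminf (\<lambda>k. perimeter (E k))"
    unfolding perimeter_def rel_perimeter_def
    by (intro Liminf_mono always_eventually allI SUP_upper \<phi>)
  finally show "ennreal (integral G (divergence \<phi>)) \<le> liminf (\<lambda>k. perimeter (E k))" .
qed

lemma compact_support_bound:
  fixes g :: "'a::euclidean_space \<Rightarrow> real"
  assumes "continuous_on UNIV g" "compact K" "\<And>x. x \<notin> K \<Longrightarrow> g x = 0"
  obtains M where "M > 0" "\<And>x. \<bar>g x\<bar> \<le> M"
proof -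
  have "compact (g ` K)" using assms by (meson compact_continuous_image continuous_on_subset subset_UNIV)
  then obtain M where "M > 0" "\<And>y. y \<in> g ` K \<Longrightarrow> norm y \<le> M"
    using compact_imp_bounded bounded_pos by metis
  then show ?thesis using that[of M] assms(3)
    by (metis abs_zero imageI less_imp_le real_norm_def)
qed

section \<open>Differentiation under translations and the divergence theorem for compact
  support\<close>

lemma DERIV_along_line:
  fixes f :: "'a::euclidean_space \<Rightarrow> real"
  assumes "cont_diff f"
  shows "((\<lambda>s. f (x + s *\<^sub>R v)) has_real_derivative frechet_derivative f (at (x + s *\<^sub>R v)) v) (at s)"
proof -
  have "((\<lambda>s. x + s *\<^sub>R v) has_derivative (\<lambda>h. h *\<^sub>R v)) (at s)"
    by (auto intro!: derivative_eq_intros)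
  from has_derivative_compose[OF this cont_diffD(1)[OF assms]]
  have "((\<lambda>s. f (x + s *\<^sub>R v)) has_derivative (\<lambda>h. frechet_derivative f (at (x + s *\<^sub>R v)) (h *\<^sub>R v))) (at s)" .
  moreover have "linear (frechet_derivative f (at (x + s *\<^sub>R v)))"
    using cont_diffD(1)[OF assms] has_derivative_linear by blast
  ultimately show ?thesis
    by (simp add: has_field_derivative_def linear_scale mult_commute_abs)
qed

text \<open>Differentiation under the integral sign: the mean value theorem bounds the difference
  quotients by a constant, and compact support confines them to one ball. With
  \<open>E = UNIV\<close> it yields the divergence theorem, with general \<open>E\<close> the
  translation estimate.\<close>

lemma DERIV_integral_translate:
  fixes f :: "'a::euclidean_space \<Rightarrow> real"
  assumes f: "cont_diff f" and K: "compact (closure {x. f x \<noteq> 0})" and E: "E \<in> sets lebesgue"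
  shows "((\<lambda>t. LINT x|lebesgue. indicator E x * f (x + t *\<^sub>R v)) has_real_derivative
     (LINT x|lebesgue. indicator E x * frechet_derivative f (at (x + t *\<^sub>R v)) v)) (at t)"
proof -
  let ?K = "closure {x. f x \<noteq> 0}"
  let ?D = "\<lambda>x. frechet_derivative f (at x) v"
  obtain R where R: "\<And>x. x \<in> ?K \<Longrightarrow> norm x \<le> R"
    using compact_imp_bounded[OF K] by (meson bounded_iff)
  have f0: "f x = 0" if "norm x > R" for x using R[of x] that closure_subset[of "{x. f x \<noteq> 0}"] by force
  have D0: "?D x = 0" if "norm x > R" for x
    using frechet_derivative_outside_support[of x f] R[of x] that by force
  obtain M where M: "M > 0" "\<And>x. \<bar>?D x\<bar> \<le> M"
    by (rule compact_support_bound[OF cont_diffD(2)[OF f, of v] compact_cball[of 0 R]]) (auto intro: D0)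
  have lip: "\<bar>f (x + a *\<^sub>R v) - f (x + b *\<^sub>R v)\<bar> \<le> M * \<bar>a - b\<bar>" for x a b
    using field_differentiable_bound[of UNIV "\<lambda>s. f (x + s *\<^sub>R v)" "\<lambda>s. ?D (x + s *\<^sub>R v)" M a b]
      DERIV_along_line[OF f, of x v] M(2) by auto
  have meas: "(\<lambda>x. indicator E x * f (x + t *\<^sub>R v)) \<in> borel_measurable lebesgue" for t
  proof -
    have "continuous_on UNIV (\<lambda>x. f (x + t *\<^sub>R v))"
      using cont_diff_continuous[OF cont_diff_translate[OF f]] .
    then have "(\<lambda>x. f (x + t *\<^sub>R v)) \<in> borel_measurable lebesgue"
      by (simp add: borel_measurable_continuous_onI measurable_completion)
    then show ?thesis using E by measurable
  qed
  have int: "integrable lebesgue (\<lambda>x. indicator E x * f (x + t *\<^sub>R v))" for t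
  proof -
    have "integrable lebesgue (\<lambda>x. f (x + t *\<^sub>R v))"
    proof (rule integrable_compact_support_lebesgue[of _ "cball 0 (R + norm (t *\<^sub>R v))"])
      show "continuous_on UNIV (\<lambda>x. f (x + t *\<^sub>R v))"
        using cont_diff_continuous[OF cont_diff_translate[OF f]] .
      fix x :: 'a assume "x \<notin> cball 0 (R + norm (t *\<^sub>R v))"
      then have "norm (x + t *\<^sub>R v) > R" using norm_diff_ineq[of x "t *\<^sub>R v"] by auto
      then show "f (x + t *\<^sub>R v) = 0" by (rule f0)
    qed auto
    then show ?thesis using E by (rule integrable_indicator_times)
  qed
  show ?thesis
    unfolding DERIV_def tendsto_at_iff_sequentially
  proof (intro allI impI)
    fix X :: "nat \<Rightarrow> real" assume X0: "\<forall>i. X i \<in> UNIV - {0}" and X: "X \<longlonglongrightarrow> 0"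
    then obtain c where c: "\<And>i. \<bar>X i\<bar> \<le> c"
      by (metis BseqE convergentI convergent_imp_Bseq real_norm_def)
    \<comment> \<open>The radius is chosen so that for \<open>x\<close> outside \<open>B\<close>
      every point \<open>x + s *\<^sub>R v\<close> with \<open>|s| \<le> |t| + c\<close> still has
      norm above \<open>R\<close>; both values in the quotient are then 0.\<close>
    define B where "B = cball (0::'a) (R + (\<bar>t\<bar> + c) * norm v)"
    let ?q = "\<lambda>i x. (indicator E x * f (x + (t + X i) *\<^sub>R v) - indicator E x * f (x + t *\<^sub>R v)) / X i"
    have lim: "(\<lambda>i. LINT x|lebesgue. ?q i x)
      \<longlonglongrightarrow> (LINT x|lebesgue. indicator E x * ?D (x + t *\<^sub>R v))"
    proof (rule integral_dominated_convergence[where w = "\<lambda>x. M * indicator B x"])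
      show m: "?q i \<in> borel_measurable lebesgue" for i
        using meas by measurable
      show "integrable lebesgue (\<lambda>x. M * indicator B x)"
        unfolding B_def by (intro integrable_mult_right) (simp add: lmeasurable_iff_integrable[symmetric])
      have pt: "(\<lambda>i. ?q i x) \<longlonglongrightarrow> indicator E x * ?D (x + t *\<^sub>R v)" for x
      proof -
        have "(\<lambda>i. (f (x + (t + X i) *\<^sub>R v) - f (x + t *\<^sub>R v)) / X i) \<longlonglongrightarrow> ?D (x + t *\<^sub>R v)"
          using DERIV_along_line[OF f, of x v t, unfolded DERIV_def tendsto_at_iff_sequentially] X X0
          by (auto simp: o_def)
        from tendsto_mult_left[OF this, of "indicator E x"] show ?thesis
          by (simp add: right_diff_distrib)
      qed
      show "AE x in lebesgue. (\<lambda>i. ?q i x) \<longlonglongrightarrow> indicator E x * ?D (x + t *\<^sub>R v)"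
        using pt by simp
      show "(\<lambda>x. indicator E x * ?D (x + t *\<^sub>R v)) \<in> borel_measurable lebesgue"
        by (rule borel_measurable_LIMSEQ_real[OF pt m])
      show "AE x in lebesgue. norm (?q i x) \<le> M * indicator B x" for i
      proof (intro AE_I2)
        fix x :: 'a
        show "norm (?q i x) \<le> M * indicator B x"
        proof (cases "x \<in> B")
          case True
          have "X i \<noteq> 0" using X0 by auto
          then show ?thesis using lip[of x "t + X i" t] True M
            by (auto simp: indicator_def field_simps)
        next
          case False
          have "norm (s *\<^sub>R v) \<le> (\<bar>t\<bar> + c) * norm v" if "\<bar>s\<bar> \<le> \<bar>t\<bar> + c" for s
            using that by (simp add: mult_right_mono)
          then have "f (x + s *\<^sub>R v) = 0" if "\<bar>s\<bar> \<le> \<bar>t\<bar> + c" for s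
            using False that norm_diff_ineq[of x "s *\<^sub>R v"]
            by (intro f0) (fastforce simp: B_def)
          from this[of t] this[of "t + X i"] c[of i] M(1) show ?thesis by (auto simp: indicator_def)
        qed
      qed
    qed
    have eq: "(LINT x|lebesgue. ?q i x) =
      ((LINT x|lebesgue. indicator E x * f (x + (t + X i) *\<^sub>R v)) - (LINT x|lebesgue. indicator E x * f (x + t *\<^sub>R v))) / X i" for i
      using int by simp
    show "((\<lambda>h. ((LINT x|lebesgue. indicator E x * f (x + (t + h) *\<^sub>R v)) - (LINT x|lebesgue. indicator E x * f (x + t *\<^sub>R v))) / h) \<circ> X)
      \<longlonglongrightarrow> (LINT x|lebesgue. indicator E x * ?D (x + t *\<^sub>R v))"
      using lim unfolding eq o_def .
  qed
qed

lemma lborel_integral_translate: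
  fixes f :: "'a::euclidean_space \<Rightarrow> real"
  assumes "f \<in> borel_measurable borel"
  shows "(LINT x|lborel. f (x + a)) = (LINT x|lborel. f x)"
proof -
  have "(LINT x|lborel. f x) = (LINT x|distr lborel borel ((+) a). f x)"
    by (simp add: lborel_distr_plus)
  also have "\<dots> = (LINT x|lborel. f (a + x))"
    using assms by (subst integral_distr) auto
  finally show ?thesis by (simp add: add.commute)
qed

text \<open>The integral of a translate does not depend on the translation, so its derivative, which
  is the integral of the directional derivative, is 0.\<close>

lemma integral_partial_eq_0:
  fixes f :: "'a::euclidean_space \<Rightarrow> real"
  assumes f: "cont_diff f" and K: "compact (closure {x. f x \<noteq> 0})"
  shows "(LINT x|lebesgue. frechet_derivative f (at x) v) = 0"
proof -
  have "(LINT x|lebesgue. f (x + t *\<^sub>R v)) = (LINT x|lebesgue. f x)" for t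
  proof -
    have fb: "f \<in> borel_measurable borel"
      using cont_diff_continuous[OF f] by (rule borel_measurable_continuous_onI)
    then have "(\<lambda>x. f (x + t *\<^sub>R v)) \<in> borel_measurable borel" by measurable
    then show ?thesis using lborel_integral_translate[OF fb, of "t *\<^sub>R v"] fb
      by (simp add: integral_completion)
  qed
  then have "((\<lambda>t. LINT x|lebesgue. f x) has_real_derivative (LINT x|lebesgue. frechet_derivative f (at x) v)) (at 0)"
    using DERIV_integral_translate[OF f K, of UNIV v 0] by simp
  then show ?thesis using DERIV_unique DERIV_const by blast
qed

lemma cont_diff_inner:
  assumes "cont_diff \<phi>"
  shows "cont_diff (\<lambda>x. \<phi> x \<bullet> b)"
    "frechet_derivative (\<lambda>x. \<phi> x \<bullet> b) (at x) v = frechet_derivative \<phi> (at x) v \<bullet> b"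
proof -
  have d: "((\<lambda>x. \<phi> x \<bullet> b) has_derivative (\<lambda>v. frechet_derivative \<phi> (at x) v \<bullet> b)) (at x)" for x
    by (rule has_derivative_inner_left[OF cont_diffD(1)[OF assms]])
  show "cont_diff (\<lambda>x. \<phi> x \<bullet> b)"
    by (rule cont_diffI[OF d]) (intro continuous_intros cont_diffD(2)[OF assms])
  show "frechet_derivative (\<lambda>x. \<phi> x \<bullet> b) (at x) v = frechet_derivative \<phi> (at x) v \<bullet> b"
    by (simp add: frechet_derivative_eqI[OF d])
qed

lemma integral_divergence_eq_0:
  fixes \<phi> :: "'a::euclidean_space \<Rightarrow> 'a"
  assumes \<phi>: "cont_diff \<phi>" and K: "compact (closure {x. \<phi> x \<noteq> 0})"
  shows "(LINT x|lebesgue. divergence \<phi> x) = 0"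
proof -
  have Kb: "compact (closure {x. \<phi> x \<bullet> b \<noteq> 0})" for b
    by (rule compact_support_bounded[OF compact_imp_bounded[OF K]])
       (use closure_subset[of "{x. \<phi> x \<noteq> 0}"] in auto)
  have int: "integrable lebesgue (\<lambda>x. frechet_derivative \<phi> (at x) b \<bullet> b)" for b
    using cont_diffD(2)[OF cont_diff_inner(1)[OF \<phi>, of b], of b]
    by (intro integrable_compact_support_lebesgue[OF _ K])
       (auto simp: cont_diff_inner(2)[OF \<phi>] frechet_derivative_outside_support)
  have "(LINT x|lebesgue. divergence \<phi> x) = (\<Sum>b\<in>Basis. LINT x|lebesgue. frechet_derivative \<phi> (at x) b \<bullet> b)"
    unfolding divergence_def using int by (simp add: Bochner_Integration.integral_sum)
  also have "\<dots> = 0"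
    using integral_partial_eq_0[OF cont_diff_inner(1)[OF \<phi>] Kb]
    by (intro sum.neutral) (auto simp: cont_diff_inner(2)[OF \<phi>])
  finally show ?thesis .
qed

text \<open>Since the divergence has total integral 0, testing \<open>- E\<close> with a field gives
  the same number as testing \<open>E\<close> with its negative.\<close>

lemma perimeter_Compl_le:
  assumes E: "E \<in> sets lebesgue"
  shows "perimeter (- E) \<le> perimeter E"
  unfolding perimeter_def[of "- E"] rel_perimeter_def
proof (rule SUP_least)
  fix \<phi> :: "'a \<Rightarrow> 'a" assume "\<phi> \<in> test_fields UNIV"
  then have \<phi>: "cont_diff \<phi>" "compact (closure {x. \<phi> x \<noteq> 0})" "\<And>x. norm (\<phi> x) \<le> 1"
    by (auto simp: test_fields_iff)
  let ?\<psi> = "\<lambda>x. (-1) *\<^sub>R \<phi> x"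
  have \<psi>: "cont_diff ?\<psi>" by (intro cont_diff_scaleR cont_diff_const \<phi>)
  have div: "divergence ?\<psi> = (\<lambda>x. - divergence \<phi> x)"
    using divergence_scaleR[OF cont_diff_const \<phi>(1), of "-1"] by (auto simp: fun_eq_iff)
  have g: "integrable lebesgue (divergence \<phi>)" by (rule integrable_divergence[OF \<phi>(1,2)])
  have Ec: "- E \<in> sets lebesgue" using E by (simp add: Compl_in_sets_lebesgue)
  have "integral (- E) (divergence \<phi>) + integral E (divergence \<phi>) =
      (LINT x|lebesgue. indicator (- E) x * divergence \<phi> x + indicator E x * divergence \<phi> x)"
    by (simp add: integral_eq_lebesgue[OF g] E Ec integrable_indicator_times[OF g])
  also have "\<dots> = (LINT x|lebesgue. divergence \<phi> x)"
    by (intro Bochner_Integration.integral_cong) (auto simp: indicator_def)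
  finally have "integral (- E) (divergence \<phi>) = integral E (divergence ?\<psi>)"
    unfolding div using integral_divergence_eq_0[OF \<phi>(1,2)] by simp
  then show "ennreal (integral (- E) (divergence \<phi>)) \<le> perimeter E"
    using perimeter_field_le[OF \<psi>, of 1 E] \<phi> by simp
qed

lemma perimeter_Compl: "E \<in> sets lebesgue \<Longrightarrow> perimeter (- E) = perimeter E"
  using perimeter_Compl_le[of E] perimeter_Compl_le[of "- E"]
  by (simp add: Compl_in_sets_lebesgue antisym)

text \<open>Multiplication by such an \<open>\<eta>\<close> gives a field compact support without
  changing its divergence on \<open>E\<close>. In this way a constant vector can be tested against
  \<open>E\<close>, and a global field becomes a local one.\<close>

lemma bounded_cutoff:
  fixes E :: "'a::euclidean_space set"
  assumes "bounded E"
  obtains \<eta> :: "'a \<Rightarrow> real" and U :: "'a set" where "cont_diff \<eta>" "\<And>x. 0 \<le> \<eta> x" "\<And>x. \<eta> x \<le> 1" "open U" "bounded U"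
    "compact (closure {x. \<eta> x \<noteq> 0})" "closure {x. \<eta> x \<noteq> 0} \<subseteq> U"
    "\<And>x. x \<in> E \<Longrightarrow> \<eta> x = 1" "\<And>x. x \<in> E \<Longrightarrow> frechet_derivative \<eta> (at x) = (\<lambda>v. 0)"
proof -
  obtain r where r: "E \<subseteq> ball 0 r" using bounded_subset_ballD[OF assms] by blast
  obtain \<eta> :: "'a \<Rightarrow> real" where \<eta>: "cont_diff \<eta>" "\<And>x. 0 \<le> \<eta> x" "\<And>x. \<eta> x \<le> 1"
    "\<And>x. x \<in> cball 0 r \<Longrightarrow> \<eta> x = 1" "compact (closure {x. \<eta> x \<noteq> 0})" "closure {x. \<eta> x \<noteq> 0} \<subseteq> ball 0 (r+1)"
    using cont_diff_Urysohn[of "cball (0::'a) r" "ball 0 (r+1)"] by (auto simp: subset_iff)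
  show ?thesis
  proof (rule that[of \<eta> "ball 0 (r+1)"])
    \<comment> \<open>\<open>\<eta>\<close> is 1 on a whole open ball that contains
      \<open>E\<close>, not merely on \<open>E\<close>.\<close>
    show "frechet_derivative \<eta> (at x) = (\<lambda>v. 0)" if "x \<in> E" for x
      by (rule frechet_derivative_eq_0[of "ball 0 r" _ _ 1]) (use that r \<eta>(4) in auto)
    show "\<eta> x = 1" if "x \<in> E" for x using that r \<eta>(4)[of x] by force
  qed (use \<eta> in auto)
qed

text \<open>Beyond the hyperplane the test field is bent towards the normal \<open>\<nu>\<close>; since \<open>\<phi> \<bullet> \<nu> \<le> 1\<close>,
  the transition layer contributes a nonnegative divergence.\<close>
lemma perimeter_Int_halfspace:
  fixes E :: "'a::euclidean_space set"
  assumes E: "E \<in> sets lebesgue" "bounded E" and \<nu>: "norm \<nu> = 1"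
  shows "perimeter (E \<inter> {x. \<nu> \<bullet> x \<le> t}) \<le> perimeter E"
  unfolding perimeter_def[of "E \<inter> _"] rel_perimeter_def
proof (rule SUP_least)
  fix \<phi> :: "'a \<Rightarrow> 'a" assume "\<phi> \<in> test_fields UNIV"
  then have \<phi>: "cont_diff \<phi>" "compact (closure {x. \<phi> x \<noteq> 0})" "\<And>x. norm (\<phi> x) \<le> 1"
    by (auto simp: test_fields_iff)
  have g: "integrable lebesgue (divergence \<phi>)" by (rule integrable_divergence[OF \<phi>(1,2)])
  obtain \<eta> :: "'a \<Rightarrow> real" and U :: "'a set" where cut: "cont_diff \<eta>" "\<And>x. 0 \<le> \<eta> x" "\<And>x. \<eta> x \<le> 1"
    "open U" "bounded U" "compact (closure {x. \<eta> x \<noteq> 0})" "closure {x. \<eta> x \<noteq> 0} \<subseteq> U"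
    "\<And>x. x \<in> E \<Longrightarrow> \<eta> x = 1" "\<And>x. x \<in> E \<Longrightarrow> frechet_derivative \<eta> (at x) = (\<lambda>v. 0)"
    by (rule bounded_cutoff[OF E(2)]) (rule that)
  note \<eta> = cut(1-3,6,8,9)
  \<comment> \<open>The step from 0 to 1 takes place in the slab of width \<open>1 / Suc n\<close>
    just beyond the hyperplane.\<close>
  define u where "u = (\<lambda>(n::nat) x. (\<nu> \<bullet> x - t) / (1 / Suc n))"
  define \<theta> where "\<theta> = (\<lambda>n x. 1 - smooth_step (u n x))"
  \<comment> \<open>A convex combination of \<open>\<phi>\<close> and the cut-off normal, so the
    bound 1 on the norm is kept.\<close>
  define \<psi> where "\<psi> = (\<lambda>n x. \<theta> n x *\<^sub>R \<phi> x + (smooth_step (u n x) *\<^sub>R \<eta> x) *\<^sub>R \<nu>)"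
  have cu: "cont_diff (u n)" for n unfolding u_def by (rule cont_diff_affine)
  have Du: "frechet_derivative (u n) (at x) v = (\<nu> \<bullet> v) * Suc n" for n x v
    unfolding u_def frechet_derivative_affine by simp
  have dg: "((\<lambda>t. 1 - smooth_step t) has_real_derivative - smooth_step' t) (at t)" for t
    by (rule derivative_eq_intros DERIV_smooth_step refl)+ simp
  have c\<theta>: "cont_diff (\<theta> n)" for n unfolding \<theta>_def
    by (rule cont_diff_compose_real[OF cu dg]) (intro continuous_intros continuous_smooth_step')
  have cS: "cont_diff (\<lambda>x. smooth_step (u n x))" for n
    by (rule cont_diff_compose_real[OF cu DERIV_smooth_step continuous_smooth_step'])
  have c1: "cont_diff (\<lambda>x. \<theta> n x *\<^sub>R \<phi> x)" for n by (rule cont_diff_scaleR[OF c\<theta> \<phi>(1)])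
  have c2: "cont_diff (\<lambda>x. smooth_step (u n x) *\<^sub>R \<eta> x)" for n by (rule cont_diff_scaleR[OF cS \<eta>(1)])
  have c3: "cont_diff (\<lambda>x. (smooth_step (u n x) *\<^sub>R \<eta> x) *\<^sub>R \<nu>)" for n by (rule cont_diff_scaleR[OF c2 cont_diff_const])
  have c\<psi>: "cont_diff (\<psi> n)" for n unfolding \<psi>_def by (rule cont_diff_add[OF c1 c3])
  have "bounded (closure {x. \<phi> x \<noteq> 0} \<union> closure {x. \<eta> x \<noteq> 0})"
    using \<phi>(2) \<eta>(4) by (simp add: compact_imp_bounded)
  then have s\<psi>: "compact (closure {x. \<psi> n x \<noteq> 0})" for n
  proof (rule compact_support_bounded)
    have "\<psi> n x = 0" if "\<phi> x = 0" "\<eta> x = 0" for x using that by (simp add: \<psi>_def)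
    then show "{x. \<psi> n x \<noteq> 0} \<subseteq> closure {x. \<phi> x \<noteq> 0} \<union> closure {x. \<eta> x \<noteq> 0}"
      using closure_subset[of "{x. \<phi> x \<noteq> 0}"] closure_subset[of "{x. \<eta> x \<noteq> 0}"] by blast
  qed
  have n\<psi>: "norm (\<psi> n x) \<le> 1" for n x
  proof -
    have s: "0 \<le> smooth_step (u n x)" "smooth_step (u n x) \<le> 1" using smooth_step_bounds by auto
    have "norm (\<psi> n x) \<le> norm (\<theta> n x *\<^sub>R \<phi> x) + norm ((smooth_step (u n x) *\<^sub>R \<eta> x) *\<^sub>R \<nu>)"
      unfolding \<psi>_def by (rule norm_triangle_ineq)
    also have "\<dots> = (1 - smooth_step (u n x)) * norm (\<phi> x) + smooth_step (u n x) * \<eta> x"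
      using s \<eta>(2)[of x] \<nu> by (simp add: \<theta>_def abs_mult)
    also have "\<dots> \<le> (1 - smooth_step (u n x)) * 1 + smooth_step (u n x) * 1"
      using s \<phi>(3)[of x] \<eta>(3)[of x] by (intro add_mono mult_left_mono) auto
    finally show ?thesis by simp
  qed
  have div: "\<theta> n x * divergence \<phi> x \<le> divergence (\<psi> n) x" if x: "x \<in> E" for n x
  proof -
    have d1: "frechet_derivative (\<theta> n) (at x) v = - smooth_step' (u n x) * ((\<nu> \<bullet> v) * Suc n)" for v
      using frechet_derivative_eqI[OF has_derivative_compose_real[OF cu dg]] by (simp add: \<theta>_def Du)
    have d2: "frechet_derivative (\<lambda>x. smooth_step (u n x)) (at x) v = smooth_step' (u n x) * ((\<nu> \<bullet> v) * Suc n)" for v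
      using frechet_derivative_eqI[OF has_derivative_compose_real[OF cu DERIV_smooth_step]] by (simp add: Du)
    have d3: "frechet_derivative (\<lambda>x. smooth_step (u n x) *\<^sub>R \<eta> x) (at x) v = smooth_step' (u n x) * ((\<nu> \<bullet> v) * Suc n)" for v
      using frechet_derivative_eqI[OF has_derivative_scaleR_fields[OF cS \<eta>(1)], of n x] \<eta>(5,6)[OF x]
      by (simp add: d2)
    have "divergence (\<psi> n) x = divergence (\<lambda>x. \<theta> n x *\<^sub>R \<phi> x) x
        + divergence (\<lambda>x. (smooth_step (u n x) *\<^sub>R \<eta> x) *\<^sub>R \<nu>) x"
      unfolding \<psi>_def by (rule divergence_add[OF c1 c3])
    also have "\<dots> = \<theta> n x * divergence \<phi> x - smooth_step' (u n x) * ((\<nu> \<bullet> \<phi> x) * Suc n)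
        + smooth_step' (u n x) * ((\<nu> \<bullet> \<nu>) * Suc n)"
      by (simp add: divergence_scaleR[OF c\<theta> \<phi>(1)] divergence_scaleR_const[OF c2, unfolded real_scaleR_def]
           d1 d3[unfolded real_scaleR_def])
    also have "\<dots> = \<theta> n x * divergence \<phi> x + smooth_step' (u n x) * (Suc n * (1 - \<nu> \<bullet> \<phi> x))"
      using \<nu> by (simp add: dot_square_norm algebra_simps)
    finally have "divergence (\<psi> n) x = \<theta> n x * divergence \<phi> x + smooth_step' (u n x) * (Suc n * (1 - \<nu> \<bullet> \<phi> x))" .
    moreover have "\<nu> \<bullet> \<phi> x \<le> 1"
      using norm_cauchy_schwarz[of \<nu> "\<phi> x"] \<nu> \<phi>(3)[of x] by simp
    ultimately show ?thesis using smooth_step'_nonneg[of "u n x"] by simp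
  qed
  define a where "a = (\<lambda>n. LINT x|lebesgue. indicator E x * (\<theta> n x * divergence \<phi> x))"
  have gn: "integrable lebesgue (\<lambda>x. \<theta> n x * divergence \<phi> x)" for n
    by (rule integrable_compact_support_lebesgue[OF continuous_on_mult[OF cont_diff_continuous[OF c\<theta>]
          continuous_divergence[OF \<phi>(1)]] \<phi>(2)]) (simp add: divergence_outside_support)
  have le: "ennreal (a n) \<le> perimeter E" for n
  proof -
    have "a n \<le> (LINT x|lebesgue. indicator E x * divergence (\<psi> n) x)"
      unfolding a_def
    proof (rule integral_mono)
      show "integrable lebesgue (\<lambda>x. indicator E x * (\<theta> n x * divergence \<phi> x))"
        by (rule integrable_indicator_times[OF gn E(1)])
      show "integrable lebesgue (\<lambda>x. indicator E x * divergence (\<psi> n) x)"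
        by (rule integrable_indicator_times[OF integrable_divergence[OF c\<psi> s\<psi>] E(1)])
    qed (use div in \<open>auto simp: indicator_def\<close>)
    also have "\<dots> = integral E (divergence (\<psi> n))"
      by (rule integral_eq_lebesgue[OF integrable_divergence[OF c\<psi> s\<psi>] E(1), symmetric])
    finally have "ennreal (a n) \<le> ennreal (integral E (divergence (\<psi> n)))" by (rule ennreal_leI)
    also have "\<dots> \<le> perimeter E" using perimeter_field_le[OF c\<psi>[of n] s\<psi>[of n] n\<psi>[of n], of E] by simp
    finally show ?thesis .
  qed
  let ?H = "{x. \<nu> \<bullet> x \<le> t}"
  have H: "?H \<in> sets lebesgue" by (simp add: closed_halfspace_le borel_closed)
  \<comment> \<open>At every point \<open>\<theta> n\<close> eventually equals the indicator of the
    closed half-space: it is 1 on the half-space for all \<open>n\<close>, and the shrinking slab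
    leaves each point beyond it.\<close>
  have "a \<longlonglongrightarrow> (LINT x|lebesgue. indicator (E \<inter> ?H) x * divergence \<phi> x)"
    unfolding a_def
  proof (rule integral_dominated_convergence[where w = "\<lambda>x. norm (divergence \<phi> x)"])
    show "integrable lebesgue (\<lambda>x. norm (divergence \<phi> x))" using g by simp
    show "(\<lambda>x. indicator E x * (\<theta> n x * divergence \<phi> x)) \<in> borel_measurable lebesgue" for n
      by (rule borel_measurable_integrable[OF integrable_indicator_times[OF gn E(1)]])
    show "(\<lambda>x. indicator (E \<inter> ?H) x * divergence \<phi> x) \<in> borel_measurable lebesgue"
      by (rule borel_measurable_integrable[OF integrable_indicator_times[OF g]]) (use E H in auto)
    show "AE x in lebesgue. norm (indicator E x * (\<theta> n x * divergence \<phi> x)) \<le> norm (divergence \<phi> x)" for n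
    proof (rule AE_I2)
      fix x
      have "\<bar>\<theta> n x\<bar> \<le> 1" using smooth_step_bounds[of "u n x"] by (simp add: \<theta>_def)
      then show "norm (indicator E x * (\<theta> n x * divergence \<phi> x)) \<le> norm (divergence \<phi> x)"
        by (auto simp: indicator_def abs_mult mult_left_le_one_le)
    qed
    show "AE x in lebesgue. (\<lambda>n. indicator E x * (\<theta> n x * divergence \<phi> x)) \<longlonglongrightarrow> indicator (E \<inter> ?H) x * divergence \<phi> x"
    proof (rule AE_I2)
      fix x
      have "\<forall>\<^sub>F n in sequentially. \<theta> n x = indicator ?H x"
      proof (cases "\<nu> \<bullet> x \<le> t")
        case True
        then show ?thesis by (auto simp: \<theta>_def u_def smooth_step_eq mult_nonpos_nonneg)
      next
        case False
        obtain m :: nat where m: "real m > 1 / (\<nu> \<bullet> x - t)" using reals_Archimedean2 by blast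
        show ?thesis unfolding eventually_sequentially
        proof (intro exI allI impI)
          fix n assume "m \<le> n"
          then have "1 / (\<nu> \<bullet> x - t) \<le> real (Suc n)" using m by simp
          then have "u n x \<ge> 1" using False by (simp add: u_def field_simps)
          then show "\<theta> n x = indicator ?H x" using False by (simp add: \<theta>_def smooth_step_eq)
        qed
      qed
      then have "\<forall>\<^sub>F n in sequentially. indicator E x * (\<theta> n x * divergence \<phi> x) = indicator (E \<inter> ?H) x * divergence \<phi> x"
        by eventually_elim (simp add: indicator_def)
      then show "(\<lambda>n. indicator E x * (\<theta> n x * divergence \<phi> x)) \<longlonglongrightarrow> indicator (E \<inter> ?H) x * divergence \<phi> x"
        by (simp add: tendsto_eventually)
    qed
  qed
  then have "a \<longlonglongrightarrow> integral (E \<inter> ?H) (divergence \<phi>)"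
    using integral_eq_lebesgue[OF g, of "E \<inter> ?H"] E H by auto
  then have "(\<lambda>n. ennreal (a n)) \<longlonglongrightarrow> ennreal (integral (E \<inter> ?H) (divergence \<phi>))"
    by (rule tendsto_ennrealI)
  then show "ennreal (integral (E \<inter> ?H) (divergence \<phi>)) \<le> perimeter E"
    using le by (intro LIMSEQ_le_const2) auto
qed

lemma perimeter_empty: "perimeter {} = 0"
  unfolding perimeter_def rel_perimeter_def by (simp add: bot_ennreal[symmetric])

text \<open>Separation covers the complement of \<open>K\<close> by open half-spaces, and the
  Lindelof property leaves countably many. Cutting with the first \<open>n\<close> of them lowers
  the perimeter step by step; the cut sets converge pointwise to \<open>E \<inter> K\<close>, so
  lower semicontinuity concludes.\<close>

lemma perimeter_Int_closed_convex:
  fixes E K :: "'a::euclidean_space set"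
  assumes E: "E \<in> sets lebesgue" "bounded E" and K: "closed K" "convex K"
  shows "perimeter (E \<inter> K) \<le> perimeter E"
\<comment> \<open>For \<open>K = {}\<close> the separating vector could be 0, and for
  \<open>K = UNIV\<close> there would be no half-space to enumerate.\<close>
proof (cases "K = {} \<or> K = UNIV")
  case True then show ?thesis by (auto simp: perimeter_empty)
next
  case False
  define F where "F = {{x. a \<bullet> x > b} |a b. norm a = 1 \<and> K \<subseteq> {x::'a. a \<bullet> x \<le> b}}"
  have UF: "\<Union>F = - K"
  proof
    show "\<Union>F \<subseteq> - K" by (fastforce simp: F_def)
    show "- K \<subseteq> \<Union>F"
    proof
      fix z assume "z \<in> - K"
      then obtain a b where ab: "a \<bullet> z < b" "\<forall>x\<in>K. a \<bullet> x > b"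
        using separating_hyperplane_closed_point[OF K(2,1), of z] by blast
      have "a \<noteq> 0" using ab False by auto
      define a' b' where "a' = - (a /\<^sub>R norm a)" and "b' = - (b / norm a)"
      have "norm a' = 1" "a' \<bullet> z > b'" "\<forall>x\<in>K. a' \<bullet> x \<le> b'"
        using \<open>a \<noteq> 0\<close> ab by (auto simp: a'_def b'_def field_simps less_imp_le)
      then have "{x. a' \<bullet> x > b'} \<in> F" "z \<in> {x. a' \<bullet> x > b'}" by (auto simp: F_def)
      then show "z \<in> \<Union>F" by blast
    qed
  qed
  have "open S" if "S \<in> F" for S using that by (auto simp: F_def open_halfspace_gt)
  then obtain F' where F': "F' \<subseteq> F" "countable F'" "\<Union>F' = \<Union>F" by (rule Lindelof)
  have "F' \<noteq> {}" using F'(3) UF False by auto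
  define S where "S = from_nat_into F'"
  have S: "S i \<in> F" "(\<Union>i. S i) = - K" for i
  proof -
    show "S i \<in> F" using from_nat_into[OF \<open>F' \<noteq> {}\<close>, of i] F'(1) by (auto simp: S_def)
    show "(\<Union>i. S i) = - K" using range_from_nat_into[OF \<open>F' \<noteq> {}\<close> F'(2)] F'(3) UF by (simp add: S_def)
  qed
  define X where "X = (\<lambda>n::nat. E \<inter> (\<Inter>i<n. - S i))"
  have X: "X n \<in> sets lebesgue \<and> bounded (X n) \<and> perimeter (X n) \<le> perimeter E" for n
  proof (induction n)
    case 0 then show ?case using E by (simp add: X_def)
  next
    case (Suc n)
    obtain a b where ab: "norm a = 1" "S n = {x. a \<bullet> x > b}" using S(1)[of n] by (auto simp: F_def)
    have eq: "X (Suc n) = X n \<inter> {x. a \<bullet> x \<le> b}" by (auto simp: X_def ab(2) lessThan_Suc not_less)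
    have "perimeter (X (Suc n)) \<le> perimeter (X n)"
      unfolding eq by (rule perimeter_Int_halfspace) (use Suc ab in auto)
    moreover have "{x. a \<bullet> x \<le> b} \<in> sets lebesgue" by (simp add: closed_halfspace_le borel_closed)
    ultimately show ?case using Suc unfolding eq by (auto intro: bounded_subset order_trans)
  qed
  have Km: "K \<in> sets lebesgue" using K by (simp add: borel_closed)
  have "ae_tendsto X (E \<inter> K)"
  proof (rule AE_I2)
    fix x
    show "\<forall>\<^sub>F k in sequentially. x \<in> X k \<longleftrightarrow> x \<in> E \<inter> K"
    proof (cases "x \<in> K")
      case True
      then have "x \<notin> S i" for i using S(2) by blast
      then show ?thesis using True by (auto simp: X_def)
    next
      case False
      then obtain i where "x \<in> S i" using S(2) by blast
      then show ?thesis using False unfolding eventually_sequentially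
        by (intro exI[of _ "Suc i"]) (auto simp: X_def)
    qed
  qed
  then have "perimeter (E \<inter> K) \<le> liminf (\<lambda>k. perimeter (X k))"
    using X E Km by (intro perimeter_lsc) auto
  also have "\<dots> \<le> liminf (\<lambda>k. perimeter E)" using X by (intro Liminf_mono) auto
  finally show ?thesis by (simp add: Liminf_const)
qed

section \<open>Translates of sets of finite perimeter\<close>


text \<open>The field is \<open>h\<close> times a translate of a function \<open>f\<close> that
  approximates the indicator of the defect set. Moving \<open>f\<close> along \<open>h\<close>
  changes its integral over \<open>E\<close> at a rate equal to the integral over \<open>E\<close>
  of a divergence, which the perimeter bounds.\<close>

lemma measure_shift_le_perimeter:
  fixes E :: "'a::euclidean_space set"
  assumes E: "E \<in> sets borel" "bounded E" and P: "perimeter E \<le> ennreal c" and c: "c \<ge> 0"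
  shows "emeasure lborel {x \<in> E. x + h \<notin> E} \<le> ennreal (norm h * c)"
\<comment> \<open>\<open>perimeter_field_le\<close> needs a positive bound, and the bound used below
  is \<open>norm h\<close>.\<close>
proof (cases "h = 0")
  case True
  then show ?thesis by simp
next
  case False
  let ?D = "{x \<in> E. x + h \<notin> E}"
  have "?D = E - (\<lambda>x. x + h) -` E" by auto
  moreover have "(\<lambda>x. x + h) -` E \<in> sets borel"
    using measurable_sets[of "\<lambda>x. x + h" borel borel E] E by simp
  ultimately have Db: "?D \<in> sets borel" using E by auto
  then have D: "?D \<in> sets lebesgue" by simp
  have bD: "bounded ?D" using E(2) by (rule bounded_subset) auto
  have Dm: "?D \<in> lmeasurable" by (rule bounded_set_imp_lmeasurable[OF bD D])
  have El: "E \<in> sets lebesgue" using E by simp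
  have key: "measure lebesgue ?D \<le> norm h * c + e" if e: "e > 0" for e
  proof -
    have "e / 2 > 0" using e by simp
    then obtain C where C: "closed C" "C \<subseteq> ?D" "?D - C \<in> lmeasurable" "emeasure lebesgue (?D - C) < ennreal (e/2)"
      by (rule sets_lebesgue_inner_closed[OF D])
    have cC: "compact C" using C bounded_subset[OF bD] by (simp add: compact_eq_bounded_closed)
    have Cs: "C \<in> sets lebesgue" using C(1) by (simp add: borel_closed)
    have Cm: "C \<in> lmeasurable" by (rule lmeasurable_compact[OF cC])
    obtain T where T: "open T" "C \<subseteq> T" "T - C \<in> lmeasurable" "emeasure lebesgue (T - C) < ennreal (e/2)"
      by (rule sets_lebesgue_outer_open[OF Cs \<open>e / 2 > 0\<close>])
    have m1: "measure lebesgue (?D - C) < e / 2"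
      using C(3,4) e by (simp add: emeasure_eq_measure2 ennreal_less_iff)
    have m2: "measure lebesgue (T - C) < e / 2"
      using T(3,4) e by (simp add: emeasure_eq_measure2 ennreal_less_iff)
    obtain f :: "'a \<Rightarrow> real" where f: "cont_diff f" "\<And>x. 0 \<le> f x" "\<And>x. f x \<le> 1"
      "\<And>x. x \<in> C \<Longrightarrow> f x = 1" "compact (closure {x. f x \<noteq> 0})" "closure {x. f x \<noteq> 0} \<subseteq> T"
      by (rule cont_diff_Urysohn[OF cC T(1,2)]) (rule that)
    have fT: "f x = 0" if "x \<notin> T" for x using f(6) that closure_subset[of "{x. f x \<noteq> 0}"] by blast
    \<comment> \<open>After a change of variables, \<open>g 0 - g 1\<close> is the integral of
      \<open>f\<close> against the difference of the indicators of \<open>E\<close> at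
      \<open>x\<close> and at \<open>x + h\<close>, which is 1 on the defect set.\<close>
    define g where "g = (\<lambda>t. LINT x|lebesgue. indicator E x * f (x + t *\<^sub>R (- h)))"
    define g' where "g' = (\<lambda>t. LINT x|lebesgue. indicator E x * frechet_derivative f (at (x + t *\<^sub>R (- h))) (- h))"
    have dg: "(g has_real_derivative g' t) (at t)" for t
      unfolding g_def g'_def by (rule DERIV_integral_translate[OF f(1,5) El])
    \<comment> \<open>The mean value theorem replaces the whole motion by one instant
      \<open>t\<close>, so a single test field is enough.\<close>
    obtain t where t: "g 1 - g 0 = (1 - 0) * g' t"
      using MVT2[of 0 1 g g'] dg by auto
    have "g 0 - g 1 \<le> norm h * c"
    proof -
      let ?k = "\<lambda>x. f (x + t *\<^sub>R (- h))"
      let ?\<phi> = "\<lambda>x. ?k x *\<^sub>R h"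
      have k: "cont_diff ?k" by (rule cont_diff_translate[OF f(1)])
      have \<phi>: "cont_diff ?\<phi>" by (rule cont_diff_scaleR[OF k cont_diff_const])
      have s: "compact (closure {x. ?\<phi> x \<noteq> 0})"
      proof (rule compact_support_bounded)
        have "bounded (closure {x. f x \<noteq> 0})" using f(5) by (rule compact_imp_bounded)
        then show "bounded ((\<lambda>x. t *\<^sub>R h + x) ` closure {x. f x \<noteq> 0})" by (rule bounded_translation)
        show "{x. ?\<phi> x \<noteq> 0} \<subseteq> (\<lambda>x. t *\<^sub>R h + x) ` closure {x. f x \<noteq> 0}"
        proof
          fix x assume "x \<in> {x. ?\<phi> x \<noteq> 0}"
          then have "x + t *\<^sub>R (- h) \<in> closure {x. f x \<noteq> 0}"
            using closure_subset[of "{x. f x \<noteq> 0}"] by auto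
          then show "x \<in> (\<lambda>x. t *\<^sub>R h + x) ` closure {x. f x \<noteq> 0}"
            by (intro image_eqI[of _ _ "x + t *\<^sub>R (- h)"]) auto
        qed
      qed
      have n: "norm (?\<phi> x) \<le> norm h" for x
        using f(2,3)[of "x + t *\<^sub>R (- h)"] by (simp add: mult_left_le_one_le)
      have d: "divergence ?\<phi> x = frechet_derivative f (at (x + t *\<^sub>R (- h))) h" for x
        unfolding divergence_scaleR_const[OF k] frechet_derivative_eqI[OF has_derivative_translate[OF f(1)]] ..
      have lin: "frechet_derivative f (at x) (- h) = - frechet_derivative f (at x) h" for x
        using linear_neg[OF has_derivative_linear[OF cont_diffD(1)[OF f(1)]]] .
      have "integral E (divergence ?\<phi>) = (LINT x|lebesgue. indicator E x * divergence ?\<phi> x)"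
        by (rule integral_eq_lebesgue[OF integrable_divergence[OF \<phi> s] El])
      also have "\<dots> = - g' t" unfolding g'_def d lin by simp
      finally have eq: "integral E (divergence ?\<phi>) = g 0 - g 1" using t by simp
      have "ennreal (g 0 - g 1) \<le> ennreal (norm h) * perimeter E"
        unfolding eq[symmetric] by (rule perimeter_field_le[OF \<phi> s n]) (use False in auto)
      also have "\<dots> \<le> ennreal (norm h) * ennreal c" by (rule mult_left_mono[OF P]) simp
      finally have "ennreal (g 0 - g 1) \<le> ennreal (norm h * c)" using c by (simp add: ennreal_mult)
      then show ?thesis using c by (simp add: ennreal_le_iff)
    qed
    moreover have "measure lebesgue C - measure lebesgue (T - C) \<le> g 0 - g 1"
    proof -
      have fb[measurable]: "f \<in> borel_measurable borel"
        using cont_diff_continuous[OF f(1)] by (rule borel_measurable_continuous_onI)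
      have Eb[measurable]: "E \<in> sets borel" by (rule E)
      have fint: "integrable lborel f"
        by (rule integrable_compact_support[OF cont_diff_continuous[OF f(1)] f(5)])
           (use closure_subset[of "{x. f x \<noteq> 0}"] in blast)
      have g1: "g 1 = (LINT x|lborel. indicator E (x + h) * f x)"
      proof -
        have "g 1 = (LINT x|lborel. indicator E x * f (x + - h))"
          unfolding g_def by (subst integral_completion) auto
        also have "\<dots> = (LINT x|lborel. indicator E (x + h) * f (x + h + - h))"
          by (rule lborel_integral_translate[symmetric, of "\<lambda>x. indicator E x * f (x + - h)"]) measurable
        finally show ?thesis by simp
      qed
      have g0: "g 0 = (LINT x|lborel. indicator E x * f x)"
        unfolding g_def by (subst integral_completion) auto
      have i1: "integrable lborel (\<lambda>x. indicator E x * f x)"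
        using integrable_mult_indicator[OF _ fint, of E] E by simp
      have i2: "integrable lborel (\<lambda>x. indicator E (x + h) * f x)"
      proof (rule Bochner_Integration.integrable_bound[OF fint])
        show "(\<lambda>x. indicator E (x + h) * f x) \<in> borel_measurable lborel" by measurable
        show "AE x in lborel. norm (indicator E (x + h) * f x) \<le> norm (f x)" by (auto simp: indicator_def)
      qed
      have TC: "T - C \<in> sets borel" using T(1) C(1) by (auto simp: borel_open borel_closed)
      have CB: "C \<in> sets borel" using C(1) by (simp add: borel_closed)
      have i3: "integrable lborel (indicat_real C)" 
        using Cm CB by (simp add: fmeasurable_def)
      have i4: "integrable lborel (indicat_real (T - C))"
        using T(3) TC by (simp add: fmeasurable_def)
      have "measure lebesgue C - measure lebesgue (T - C) = (LINT x|lborel. indicator C x - indicator (T - C) x)"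
        using i3 i4 CB TC by simp
      also have "\<dots> \<le> (LINT x|lborel. indicator E x * f x - indicator E (x + h) * f x)"
      proof (rule integral_mono)
        show "integrable lborel (\<lambda>x. indicat_real C x - indicator (T - C) x)" using i3 i4 by simp
        show "integrable lborel (\<lambda>x. indicator E x * f x - indicator E (x + h) * f x)" using i1 i2 by simp
        fix x
        \<comment> \<open>On \<open>C\<close> both sides equal 1, because \<open>x \<in> E\<close>,
          \<open>x + h \<notin> E\<close> and \<open>f x = 1\<close>. Off \<open>C\<close> the right
          side is at least -1, and it is 0 unless \<open>x \<in> T\<close>.\<close>
        show "indicat_real C x - indicator (T - C) x \<le> indicator E x * f x - indicator E (x + h) * f x"
        proof (cases "x \<in> C")
          case True
          then show ?thesis using C(2) f(4)[of x] by (auto simp: indicator_def)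
        next
          case False
          then show ?thesis using fT[of x] f(2,3)[of x] by (auto simp: indicator_def)
        qed
      qed
      also have "\<dots> = g 0 - g 1" using i1 i2 by (simp add: g0 g1)
      finally show ?thesis .
    qed
    moreover have "measure lebesgue ?D = measure lebesgue C + measure lebesgue (?D - C)"
      using measurable_measure_Diff[OF Dm Cs C(2)] by simp
    ultimately show ?thesis using m1 m2 by simp
  qed
  then have "measure lebesgue ?D \<le> norm h * c" by (rule field_le_epsilon)
  then have "emeasure lebesgue ?D \<le> ennreal (norm h * c)"
    using Dm by (simp add: emeasure_eq_measure2 ennreal_leI)
  then show ?thesis using Db by simp
qed

text \<open>Tonelli and translation invariance: for fixed \<open>x\<close>, integrating over
  \<open>h\<close> the indicator of \<open>x + h \<in> B\<close> gives the measure of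
  \<open>B\<close>. Products of measures thus become averages of translation defects.\<close>

lemma emeasure_mult_eq_nn_integral_shift:
  fixes A B :: "'a::euclidean_space set"
  assumes [measurable]: "A \<in> sets borel" "B \<in> sets borel"
  shows "emeasure lborel A * emeasure lborel B = (\<integral>\<^sup>+h. emeasure lborel {x \<in> A. x + h \<in> B} \<partial>lborel)"
proof -
  have shift: "(\<integral>\<^sup>+h. indicator B (x + h) \<partial>lborel) = emeasure lborel B" for x
  proof -
    have "emeasure lborel B = (\<integral>\<^sup>+y. indicator B y \<partial>distr lborel borel ((+) x))"
      by (simp add: lborel_distr_plus)
    also have "\<dots> = (\<integral>\<^sup>+h. indicator B (x + h) \<partial>lborel)"
      by (subst nn_integral_distr) auto
    finally show ?thesis ..
  qed
  have "(\<integral>\<^sup>+h. emeasure lborel {x \<in> A. x + h \<in> B} \<partial>lborel) =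
     (\<integral>\<^sup>+h. (\<integral>\<^sup>+x. indicator A x * indicator B (x + h) \<partial>lborel) \<partial>lborel)"
  proof (rule nn_integral_cong)
    fix h
    have "{x \<in> A. x + h \<in> B} = A \<inter> (\<lambda>x. x + h) -` B" by auto
    moreover have "(\<lambda>x. x + h) -` B \<in> sets borel"
      using measurable_sets[of "\<lambda>x. x + h" borel borel B] by simp
    ultimately have "{x \<in> A. x + h \<in> B} \<in> sets borel" by auto
    then have "emeasure lborel {x \<in> A. x + h \<in> B} = (\<integral>\<^sup>+x. indicator {x \<in> A. x + h \<in> B} x \<partial>lborel)" by simp
    also have "\<dots> = (\<integral>\<^sup>+x. indicator A x * indicator B (x + h) \<partial>lborel)"
      by (intro nn_integral_cong) (auto simp: indicator_def)
    finally show "emeasure lborel {x \<in> A. x + h \<in> B} = (\<integral>\<^sup>+x. indicator A x * indicator B (x + h) \<partial>lborel)" .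
  qed
  also have "\<dots> = (\<integral>\<^sup>+x. (\<integral>\<^sup>+h. indicator A x * indicator B (x + h) \<partial>lborel) \<partial>lborel)"
    by (rule lborel_pair.Fubini') measurable
  also have "\<dots> = (\<integral>\<^sup>+x. indicator A x * emeasure lborel B \<partial>lborel)"
    by (intro nn_integral_cong) (simp add: nn_integral_cmult shift)
  also have "\<dots> = emeasure lborel A * emeasure lborel B"
    by (simp add: nn_integral_multc)
  finally show ?thesis ..
qed

text \<open>Half-open cubes of side \<open>d\<close>, so that cells do not overlap; bounding the
  quotient by \<open>d\<close> makes \<open>z b\<close> its floor. Values of \<open>z\<close>
  outside \<open>Basis\<close> have no influence.\<close>

definition grid_cell :: "real \<Rightarrow> ('a::euclidean_space \<Rightarrow> int) \<Rightarrow> 'a set" where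
  "grid_cell d z = {x. \<forall>b\<in>Basis. of_int (z b) \<le> x \<bullet> b / d \<and> x \<bullet> b / d < of_int (z b) + 1}"

lemma grid_cell_borel: "grid_cell d z \<in> sets borel"
  unfolding grid_cell_def by measurable

lemma grid_cell_measure:
  assumes d: "d > 0"
  shows "ennreal (d ^ DIM('a)) \<le> emeasure lborel (grid_cell d z :: 'a::euclidean_space set)"
    "bounded (grid_cell d z :: 'a set)"
proof -
  define l u :: 'a where "l = (\<Sum>b\<in>Basis. (d * of_int (z b)) *\<^sub>R b)"
    and "u = (\<Sum>b\<in>Basis. (d * (of_int (z b) + 1)) *\<^sub>R b)"
  have lu: "l \<bullet> b = d * of_int (z b)" "u \<bullet> b = d * (of_int (z b) + 1)" if "b \<in> Basis" for b
    using that unfolding l_def u_def by (simp_all only: inner_sum_left_Basis)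
  have cell: "x \<in> grid_cell d z \<longleftrightarrow> (\<forall>b\<in>Basis. l \<bullet> b \<le> x \<bullet> b \<and> x \<bullet> b < u \<bullet> b)" for x
    using d by (simp add: grid_cell_def lu pos_le_divide_eq pos_divide_less_eq mult.commute cong: ball_cong)
  have "box l u \<subseteq> grid_cell d z"
    by (auto simp only: subset_iff cell mem_box intro: less_imp_le)
  moreover have "emeasure lborel (box l u) = ennreal (d ^ DIM('a))"
    using d by (subst emeasure_lborel_box) (simp_all add: lu inner_diff_left ring_distribs)
  ultimately show "ennreal (d ^ DIM('a)) \<le> emeasure lborel (grid_cell d z :: 'a set)"
    using emeasure_mono[of "box l u" "grid_cell d z" lborel] by (simp add: grid_cell_borel)
  have "grid_cell d z \<subseteq> cbox l u"
    by (auto simp only: subset_iff cell mem_box intro: less_imp_le)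
  then show "bounded (grid_cell d z :: 'a set)" using bounded_cbox bounded_subset by blast
qed

lemma grid_cell_cover:
  fixes S :: "'a::euclidean_space set"
  assumes d: "d > 0" and S: "bounded S"
  obtains Z where "finite Z" "S \<subseteq> (\<Union>z\<in>Z. grid_cell d z)"
    "\<And>z w. z \<in> Z \<Longrightarrow> w \<in> Z \<Longrightarrow> z \<noteq> w \<Longrightarrow> grid_cell d z \<inter> grid_cell d w = {}"
proof -
  \<comment> \<open>\<open>restrict\<close> fixes the values off \<open>Basis\<close>. Without this,
    different indices could describe the same cell, and neither finiteness nor disjointness would
    hold.\<close>
  define idx where "idx = (\<lambda>x::'a. restrict (\<lambda>b. \<lfloor>x \<bullet> b / d\<rfloor>) Basis)"
  obtain r where r: "\<And>x. x \<in> S \<Longrightarrow> norm x \<le> r" using S by (meson bounded_iff)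
  define m where "m = \<lceil>r / d\<rceil> + 1"
  have sub: "idx ` S \<subseteq> PiE Basis (\<lambda>_. {-m..m})"
  proof clarify
    fix x assume x: "x \<in> S"
    have "\<lfloor>x \<bullet> b / d\<rfloor> \<in> {-m..m}" if "b \<in> Basis" for b
    proof -
      have "\<bar>x \<bullet> b\<bar> \<le> r" using Basis_le_norm[OF that, of x] r[OF x] by simp
      then have "\<bar>x \<bullet> b / d\<bar> \<le> r / d" using d by (simp add: divide_right_mono abs_of_pos)
      moreover have "r / d \<le> of_int m - 1" by (simp add: m_def)
      ultimately have "- of_int m \<le> x \<bullet> b / d" "x \<bullet> b / d \<le> of_int m" by linarith+
      then show ?thesis by (auto simp: le_floor_iff floor_le_iff)
    qed
    then show "idx x \<in> PiE Basis (\<lambda>_. {-m..m})" by (auto simp: idx_def)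
  qed
  have fin: "finite (PiE (Basis::'a set) (\<lambda>_. {-m..m}))" by (intro finite_PiE) auto
  show ?thesis
  proof
    show "finite (idx ` S)" by (rule finite_subset[OF sub fin])
    show "S \<subseteq> (\<Union>z\<in>idx ` S. grid_cell d z)"
    proof
      fix x assume "x \<in> S"
      moreover have "x \<in> grid_cell d (idx x)" by (simp add: grid_cell_def idx_def)
      ultimately show "x \<in> (\<Union>z\<in>idx ` S. grid_cell d z)" by blast
    qed
    fix z w assume z: "z \<in> idx ` S" and w: "w \<in> idx ` S" and ne: "z \<noteq> w"
    show "grid_cell d z \<inter> grid_cell d w = {}"
    proof (rule ccontr)
      assume "grid_cell d z \<inter> grid_cell d w \<noteq> {}"
      then obtain x where x: "x \<in> grid_cell d z" "x \<in> grid_cell d w" by auto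
      have "z b = w b" for b
      proof (cases "b \<in> Basis")
        case True
        then have "\<lfloor>x \<bullet> b / d\<rfloor> = z b" "\<lfloor>x \<bullet> b / d\<rfloor> = w b"
          using x by (auto simp: grid_cell_def floor_eq_iff)
        then show ?thesis by simp
      next
        case False
        then show ?thesis using z w by (auto simp: idx_def)
      qed
      then show False using ne by auto
    qed
  qed
qed

text \<open>Each product is an integral over \<open>h\<close> of the part of \<open>E\<close> in a
  cell that \<open>h\<close> moves into the rest of that cell. Only vectors in the cube of side
  \<open>2 * d\<close> around 0 can stay in a cell. For such \<open>h\<close> the pieces from
  different cells are disjoint parts of the translation defect of \<open>E\<close>, whose measure is
  at most \<open>norm h * c\<close>.\<close>

lemma grid_sum_le:
  fixes E :: "'a::euclidean_space set" and d :: real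
  assumes E: "E \<in> sets borel" "bounded E" and P: "perimeter E \<le> ennreal c" and c: "c \<ge> 0" and d: "d > 0"
    and Z: "finite Z" "\<And>z w. z \<in> Z \<Longrightarrow> w \<in> Z \<Longrightarrow> z \<noteq> w \<Longrightarrow> grid_cell d z \<inter> grid_cell d w = {}"
  shows "(\<Sum>z\<in>Z. emeasure lborel (E \<inter> grid_cell d z) * emeasure lborel (grid_cell d z - E))
     \<le> ennreal ((2 * d) ^ DIM('a) * (DIM('a) * d * c))"
proof -
  have [measurable]: "E \<in> sets borel" "grid_cell d z \<in> sets borel" for z :: "'a \<Rightarrow> int"
    using E grid_cell_borel by auto
  define l u :: 'a where "l = (\<Sum>b\<in>Basis. (- d) *\<^sub>R b)" and "u = (\<Sum>b\<in>Basis. d *\<^sub>R b)"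
  have lu: "l \<bullet> b = - d" "u \<bullet> b = d" if "b \<in> Basis" for b
    using that unfolding l_def u_def by (simp_all only: inner_sum_left_Basis)
  let ?R = "cbox l u"
  have Rb: "h \<in> ?R \<longleftrightarrow> (\<forall>b\<in>Basis. \<bar>h \<bullet> b\<bar> \<le> d)" for h
    by (auto simp: mem_box lu abs_le_iff minus_le_iff)
  let ?A = "\<lambda>h z. {x \<in> E \<inter> grid_cell d z. x + h \<in> grid_cell d z - E}"
  have Am: "?A h z \<in> sets borel" for h z
  proof -
    have "(\<lambda>x. x + h) -` (grid_cell d z - E) \<in> sets borel"
      using measurable_sets[of "\<lambda>x. x + h" borel borel "grid_cell d z - E"] by simp
    moreover have "?A h z = (E \<inter> grid_cell d z) \<inter> (\<lambda>x. x + h) -` (grid_cell d z - E)" by auto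
    ultimately show ?thesis by auto
  qed
  have "(\<Sum>z\<in>Z. emeasure lborel (E \<inter> grid_cell d z) * emeasure lborel (grid_cell d z - E))
    = (\<Sum>z\<in>Z. \<integral>\<^sup>+h. emeasure lborel (?A h z) \<partial>lborel)"
    by (intro sum.cong refl emeasure_mult_eq_nn_integral_shift) auto
  also have "\<dots> = (\<integral>\<^sup>+h. (\<Sum>z\<in>Z. emeasure lborel (?A h z)) \<partial>lborel)"
  proof (rule nn_integral_sum[symmetric])
    fix z
    have "(\<lambda>h. \<integral>\<^sup>+x. indicator (E \<inter> grid_cell d z) x * indicator (grid_cell d z - E) (x + h) \<partial>lborel) \<in> borel_measurable lborel"
      by measurable
    moreover have "emeasure lborel (?A h z) = (\<integral>\<^sup>+x. indicator (E \<inter> grid_cell d z) x * indicator (grid_cell d z - E) (x + h) \<partial>lborel)" for h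
    proof -
      have "emeasure lborel (?A h z) = (\<integral>\<^sup>+x. indicator (?A h z) x \<partial>lborel)" using Am by simp
      also have "\<dots> = (\<integral>\<^sup>+x. indicator (E \<inter> grid_cell d z) x * indicator (grid_cell d z - E) (x + h) \<partial>lborel)"
        by (intro nn_integral_cong) (auto simp: indicator_def)
      finally show ?thesis .
    qed
    ultimately show "(\<lambda>h. emeasure lborel (?A h z)) \<in> borel_measurable lborel" by simp
  qed
  also have "\<dots> \<le> (\<integral>\<^sup>+h. ennreal (DIM('a) * d * c) * indicator ?R h \<partial>lborel)"
  proof (rule nn_integral_mono)
    fix h :: 'a
    show "(\<Sum>z\<in>Z. emeasure lborel (?A h z)) \<le> ennreal (DIM('a) * d * c) * indicator ?R h"
    proof (cases "h \<in> ?R")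
      case True
      then have hb: "\<bar>h \<bullet> b\<bar> \<le> d" if "b \<in> Basis" for b using that unfolding Rb by blast
      \<comment> \<open>Comparison with the l1 norm is the source of the factor
        \<open>DIM('a)\<close>.\<close>
      have "norm h \<le> (\<Sum>b\<in>Basis. \<bar>h \<bullet> b\<bar>)" by (rule norm_le_l1)
      also have "\<dots> \<le> DIM('a) * d" using sum_bounded_above[of Basis "\<lambda>b. \<bar>h \<bullet> b\<bar>" d] hb by simp
      finally have nh: "norm h \<le> DIM('a) * d" .
      have Dm: "{x \<in> E. x + h \<notin> E} \<in> sets lborel"
      proof -
        have "{x \<in> E. x + h \<notin> E} = E - (\<lambda>x. x + h) -` E" by auto
        moreover have "(\<lambda>x. x + h) -` E \<in> sets borel"
          using measurable_sets[of "\<lambda>x. x + h" borel borel E] by simp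
        ultimately show ?thesis using E by auto
      qed
      have "(\<Sum>z\<in>Z. emeasure lborel (?A h z)) = emeasure lborel (\<Union>z\<in>Z. ?A h z)"
      proof (rule sum_emeasure)
        show "?A h ` Z \<subseteq> sets lborel" using Am by auto
        show "disjoint_family_on (?A h) Z"
          using Z(2) unfolding disjoint_family_on_def by blast
      qed (rule Z)
      also have "\<dots> \<le> emeasure lborel {x \<in> E. x + h \<notin> E}"
        by (rule emeasure_mono[OF _ Dm]) auto
      also have "\<dots> \<le> ennreal (norm h * c)" by (rule measure_shift_le_perimeter[OF E P c])
      also have "\<dots> \<le> ennreal (DIM('a) * d * c)" using nh c by (intro ennreal_leI mult_right_mono)
      finally show ?thesis using True by simp
    next
      case False
      have A0: "?A h z = {}" for z
      proof (rule ccontr)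
        assume "?A h z \<noteq> {}"
        then obtain x where x: "x \<in> grid_cell d z" "x + h \<in> grid_cell d z" by auto
        have "\<bar>h \<bullet> b\<bar> \<le> d" if "b \<in> Basis" for b
        proof -
          have "of_int (z b) \<le> x \<bullet> b / d" "x \<bullet> b / d < of_int (z b) + 1"
            "of_int (z b) \<le> (x + h) \<bullet> b / d" "(x + h) \<bullet> b / d < of_int (z b) + 1"
            using x that by (auto simp: grid_cell_def)
          then have "\<bar>(h \<bullet> b) / d\<bar> \<le> 1" by (simp add: inner_add_left add_divide_distrib)
          then show ?thesis using d by (simp add: field_simps)
        qed
        then have "h \<in> ?R" unfolding Rb by blast
        then show False using False by simp
      qed
      show ?thesis unfolding A0 by simp
    qed
  qed
  also have "\<dots> = ennreal (DIM('a) * d * c) * emeasure lborel ?R"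
    by (simp add: nn_integral_cmult)
  also have "emeasure lborel ?R = ennreal ((2 * d) ^ DIM('a))"
    using d by (subst emeasure_lborel_cbox) (simp_all add: lu inner_diff_left)
  also have "ennreal (DIM('a) * d * c) * ennreal ((2 * d) ^ DIM('a)) = ennreal ((2 * d) ^ DIM('a) * (DIM('a) * d * c))"
    using d c by (simp add: ennreal_mult[symmetric] mult.commute)
  finally show ?thesis .
qed

section \<open>Compactness\<close>


text \<open>With \<open>a = |E \<inter> Q|\<close> and \<open>b = |Q - E|\<close> on a cell \<open>Q\<close>, \<open>min (a, b) \<le> 2 a b / (a + b)\<close>; so replacing
  \<open>E\<close> by the cells that it fills by more than half costs at most a multiple of \<open>\<Sum> a b\<close>.\<close>
lemma grid_approximation:
  fixes E :: "'a::euclidean_space set" and d :: real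
  assumes E: "E \<in> sets borel" "bounded E" and P: "perimeter E \<le> ennreal c" and c: "c \<ge> 0" and d: "d > 0"
    and Z: "finite Z" "\<And>z w. z \<in> Z \<Longrightarrow> w \<in> Z \<Longrightarrow> z \<noteq> w \<Longrightarrow> grid_cell d z \<inter> grid_cell d w = {}"
    and EZ: "E \<subseteq> (\<Union>z\<in>Z. grid_cell d z)"
  obtains W where "W \<subseteq> Z"
    "emeasure lborel (sym_diff E (\<Union>z\<in>W. grid_cell d z)) \<le> ennreal (2 * 2 ^ DIM('a) * (DIM('a) * d * c))"
proof -
  let ?Q = "grid_cell d :: ('a \<Rightarrow> int) \<Rightarrow> 'a set"
  define a where "a = (\<lambda>z. measure lborel (E \<inter> ?Q z))"
  define b where "b = (\<lambda>z. measure lborel (?Q z - E))"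
  define W where "W = {z \<in> Z. a z > b z}"
  define U where "U = (\<Union>z\<in>W. ?Q z)"
  have Qb: "?Q z \<in> sets borel" for z by (rule grid_cell_borel)
  have Qf: "emeasure lborel (?Q z) < \<infinity>" for z
    by (rule emeasure_bounded_finite[OF grid_cell_measure(2)[OF d]])
  have fin: "emeasure lborel X < \<infinity>" if "X \<subseteq> ?Q z" for X z
    using emeasure_mono[OF that, of lborel] Qb Qf[of z] by (auto simp: le_less_trans)
  have ea: "emeasure lborel (E \<inter> ?Q z) = ennreal (a z)" for z
    unfolding a_def using fin[of "E \<inter> ?Q z" z] by (intro emeasure_eq_ennreal_measure) auto
  have eb: "emeasure lborel (?Q z - E) = ennreal (b z)" for z
    unfolding b_def using fin[of "?Q z - E" z] by (intro emeasure_eq_ennreal_measure) auto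
  have ab0: "a z \<ge> 0" "b z \<ge> 0" for z by (auto simp: a_def b_def)
  have abd: "a z + b z \<ge> d ^ DIM('a)" for z
  proof -
    have "emeasure lborel (?Q z) = emeasure lborel (E \<inter> ?Q z) + emeasure lborel (?Q z - E)"
      using E(1) Qb[of z] by (subst plus_emeasure) (auto intro!: arg_cong[where f="emeasure lborel"])
    then have "ennreal (d ^ DIM('a)) \<le> ennreal (a z + b z)"
      using grid_cell_measure(1)[OF d, of z] ab0[of z] by (simp add: ea eb ennreal_plus)
    then show ?thesis using ab0[of z] by (simp add: ennreal_le_iff del: ennreal_plus)
  qed
  have Ub: "U \<in> sets borel" unfolding U_def using Z(1) Qb by (intro sets.finite_UN) (auto simp: W_def)
  have cellw: "sym_diff E U \<inter> ?Q z = (if z \<in> W then ?Q z - E else E \<inter> ?Q z)" if "z \<in> Z" for z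
  proof (cases "z \<in> W")
    case True
    then have "?Q z \<subseteq> U" by (auto simp: U_def)
    then show ?thesis using True by auto
  next
    case False
    have "?Q z \<inter> U = {}" using Z(2) that False by (auto simp: U_def W_def)
    then show ?thesis using False by auto
  qed
  have "sym_diff E U \<subseteq> (\<Union>z\<in>Z. ?Q z)" using EZ by (auto simp: U_def W_def)
  then have "sym_diff E U = (\<Union>z\<in>Z. sym_diff E U \<inter> ?Q z)" by auto
  then have "emeasure lborel (sym_diff E U) = emeasure lborel (\<Union>z\<in>Z. sym_diff E U \<inter> ?Q z)" by simp
  also have "\<dots> \<le> (\<Sum>z\<in>Z. emeasure lborel (sym_diff E U \<inter> ?Q z))"
    using E(1) Ub Qb by (intro emeasure_subadditive_finite Z(1)) auto
  also have "\<dots> \<le> (\<Sum>z\<in>Z. ennreal (2 / d ^ DIM('a)) * (emeasure lborel (E \<inter> ?Q z) * emeasure lborel (?Q z - E)))"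
  proof (rule sum_mono)
    fix z assume z: "z \<in> Z"
    define q where "q = d ^ DIM('a)"
    have q: "q > 0" "a z + b z \<ge> q" using d abd[of z] by (auto simp: q_def)
    have "emeasure lborel (sym_diff E U \<inter> ?Q z) \<le> ennreal (2 / q * (a z * b z))"
    proof (cases "z \<in> W")
      case True
      then have "a z > b z" by (simp add: W_def)
      \<comment> \<open>\<open>a z\<close> is more than half of \<open>a z + b z\<close>, which is
        at least \<open>q\<close>; hence \<open>q \<le> 2 * a z\<close>. The other case is
        symmetric.\<close>
      then have "b z * q \<le> b z * (2 * a z)" using q ab0[of z] by (intro mult_left_mono) auto
      then have "b z \<le> 2 / q * (a z * b z)" using q by (simp add: field_simps)
      then show ?thesis using True z by (simp add: cellw eb ennreal_leI)
    next
      case False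
      then have "a z \<le> b z" using z by (simp add: W_def)
      then have "a z * q \<le> a z * (2 * b z)" using q ab0[of z] by (intro mult_left_mono) auto
      then have "a z \<le> 2 / q * (a z * b z)" using q by (simp add: field_simps)
      then show ?thesis using False z by (simp add: cellw ea ennreal_leI)
    qed
    also have "\<dots> = ennreal (2 / q) * (ennreal (a z) * ennreal (b z))"
      using q ab0[of z] by (simp add: ennreal_mult[symmetric])
    finally show "emeasure lborel (sym_diff E U \<inter> ?Q z) \<le>
      ennreal (2 / d ^ DIM('a)) * (emeasure lborel (E \<inter> ?Q z) * emeasure lborel (?Q z - E))"
      by (simp add: ea eb q_def)
  qed
  also have "\<dots> = ennreal (2 / d ^ DIM('a)) * (\<Sum>z\<in>Z. emeasure lborel (E \<inter> ?Q z) * emeasure lborel (?Q z - E))"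
    by (simp add: sum_distrib_left)
  also have "\<dots> \<le> ennreal (2 / d ^ DIM('a)) * ennreal ((2 * d) ^ DIM('a) * (DIM('a) * d * c))"
    by (intro mult_left_mono grid_sum_le[OF E P c d Z]) auto
  \<comment> \<open>The powers of \<open>d\<close> cancel and one factor \<open>d\<close> remains,
    so the error vanishes with the mesh size.\<close>
  also have "\<dots> = ennreal (2 * 2 ^ DIM('a) * (DIM('a) * d * c))"
    using d c by (simp add: ennreal_mult[symmetric] power_mult_distrib)
  finally have "emeasure lborel (sym_diff E U) \<le> ennreal (2 * 2 ^ DIM('a) * (DIM('a) * d * c))" .
  then show ?thesis using that[of W] by (auto simp: U_def W_def)
qed

text \<open>The net consists of all unions of the finitely many cells that cover \<open>S\<close>;
  the mesh is chosen so small that the grid error is at most \<open>e\<close>.\<close>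

lemma finite_perimeter_totally_bounded:
  fixes S :: "'a::euclidean_space set"
  assumes S: "bounded S" and c: "c \<ge> 0" and e: "e > 0"
  obtains \<U> :: "'a set set" where "finite \<U>" "\<U> \<subseteq> sets borel"
    "\<And>E. E \<in> sets borel \<Longrightarrow> E \<subseteq> S \<Longrightarrow> perimeter E \<le> ennreal c \<Longrightarrow>
       \<exists>U\<in>\<U>. emeasure lborel (sym_diff E U) \<le> ennreal e"
proof -
  \<comment> \<open>\<open>c + 1\<close> in place of \<open>c\<close> keeps \<open>M\<close>
    positive when \<open>c = 0\<close>, so that \<open>d = e / M\<close> makes sense.\<close>
  define M where "M = 2 * 2 ^ DIM('a) * (DIM('a) * (c + 1))"
  have M: "M > 0" using c by (simp add: M_def)
  define d where "d = e / M"
  have d: "d > 0" using e M by (simp add: d_def)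
  obtain Z :: "('a \<Rightarrow> int) set" where Z: "finite Z" "S \<subseteq> (\<Union>z\<in>Z. grid_cell d z)"
    "\<And>z w. z \<in> Z \<Longrightarrow> w \<in> Z \<Longrightarrow> z \<noteq> w \<Longrightarrow> grid_cell d z \<inter> grid_cell d w = {}"
    by (rule grid_cell_cover[OF d S]) (rule that)
  let ?\<U> = "(\<lambda>W. \<Union>z\<in>W. grid_cell d z) ` Pow Z"
  show ?thesis
  proof (rule that[of ?\<U>])
    show "finite ?\<U>" using Z(1) by simp
    show "?\<U> \<subseteq> sets borel"
      using Z(1) grid_cell_borel by (auto intro!: sets.finite_UN dest: finite_subset)
    fix E assume E: "E \<in> sets borel" "E \<subseteq> S" "perimeter E \<le> ennreal c"
    have bE: "bounded E" using S E(2) by (rule bounded_subset)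
    have ES: "E \<subseteq> (\<Union>z\<in>Z. grid_cell d z)" using E(2) Z(2) by auto
    obtain W where W: "W \<subseteq> Z"
      "emeasure lborel (sym_diff E (\<Union>z\<in>W. grid_cell d z)) \<le> ennreal (2 * 2 ^ DIM('a) * (DIM('a) * d * c))"
      by (rule grid_approximation[OF E(1) bE E(3) c d Z(1,3) ES])
    have "2 * 2 ^ DIM('a) * (DIM('a) * d * c) \<le> M * d"
      using c d by (simp add: M_def algebra_simps)
    also have "\<dots> = e" using M by (simp add: d_def)
    finally show "\<exists>U\<in>?\<U>. emeasure lborel (sym_diff E U) \<le> ennreal e"
      using W by (intro bexI[of _ "\<Union>z\<in>W. grid_cell d z"]) (auto intro: order_trans[OF _ ennreal_leI])
  qed
qed

text \<open>Some element of a finite net is close to infinitely many members of the sequence, so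
  these are close to each other. Repeating this with halved tolerance gives nested infinite index
  sets, from which one index each is drawn.\<close>

lemma finite_perimeter_Cauchy_subsequence:
  fixes E :: "nat \<Rightarrow> 'a::euclidean_space set"
  assumes E: "\<And>k. E k \<in> sets borel" "\<And>k. E k \<subseteq> S" and S: "bounded S"
    and P: "\<And>k. perimeter (E k) \<le> ennreal c" and c: "c \<ge> 0"
  obtains r :: "nat \<Rightarrow> nat" where "strict_mono r"
    "\<And>m. emeasure lborel (sym_diff (E (r m)) (E (r (Suc m)))) \<le> ennreal ((1/2) ^ m)"
proof -
  have step: "\<exists>J. J \<subseteq> I \<and> infinite J \<and>
      (\<forall>i\<in>J. \<forall>j\<in>J. emeasure lborel (sym_diff (E i) (E j)) \<le> ennreal e)"
    if I: "infinite I" and e: "e > 0" for I :: "nat set" and e :: real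
  proof -
    have e2: "e / 2 > 0" using e by simp
    obtain \<U> where U: "finite \<U>" "\<U> \<subseteq> sets borel"
      "\<And>E. E \<in> sets borel \<Longrightarrow> E \<subseteq> S \<Longrightarrow> perimeter E \<le> ennreal c \<Longrightarrow>
         \<exists>U\<in>\<U>. emeasure lborel (sym_diff E U) \<le> ennreal (e / 2)"
      by (rule finite_perimeter_totally_bounded[OF S c e2]) (rule that)
    have "\<exists>U\<in>\<U>. infinite {k \<in> I. emeasure lborel (sym_diff (E k) U) \<le> ennreal (e / 2)}"
      by (rule pigeonhole_infinite_rel[OF I U(1)]) (use U(3) E P in blast)
    then obtain V where V: "V \<in> \<U>" "infinite {k \<in> I. emeasure lborel (sym_diff (E k) V) \<le> ennreal (e / 2)}"
      by blast
    have Vb: "V \<in> sets borel" using V(1) U(2) by auto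
    let ?J = "{k \<in> I. emeasure lborel (sym_diff (E k) V) \<le> ennreal (e / 2)}"
    have "emeasure lborel (sym_diff (E i) (E j)) \<le> ennreal e" if "i \<in> ?J" "j \<in> ?J" for i j
    proof -
      have "emeasure lborel (sym_diff (E i) (E j)) \<le> emeasure lborel (sym_diff (E i) V \<union> sym_diff (E j) V)"
        using E(1) Vb by (intro emeasure_mono) auto
      also have "\<dots> \<le> emeasure lborel (sym_diff (E i) V) + emeasure lborel (sym_diff (E j) V)"
        using E(1) Vb by (intro emeasure_subadditive) auto
      also have "\<dots> \<le> ennreal (e / 2) + ennreal (e / 2)" using that by (intro add_mono) auto
      also have "\<dots> = ennreal e" using e by (simp add: ennreal_plus[symmetric] del: ennreal_plus)
      finally show ?thesis .
    qed
    then show ?thesis using V(2) by (intro exI[of _ ?J]) auto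
  qed
  \<comment> \<open>The state is an infinite index set together with an index chosen from it. Since
    the sets are nested, the choices at stages \<open>m\<close> and \<open>Suc m\<close> both lie in
    the set of stage \<open>m\<close>.\<close>
  let ?P = "\<lambda>m (J, k). infinite J \<and> k \<in> J \<and>
      (\<forall>i\<in>J. \<forall>j\<in>J. emeasure lborel (sym_diff (E i) (E j)) \<le> ennreal ((1/2) ^ m))"
  let ?R = "\<lambda>(m::nat) (J, k) (J', k'). J' \<subseteq> J \<and> (k::nat) < k'"
  have "\<exists>f. \<forall>m. ?P m (f m) \<and> ?R m (f m) (f (Suc m))"
  proof (rule dependent_nat_choice)
    obtain J :: "nat set" where J: "infinite J" "\<forall>i\<in>J. \<forall>j\<in>J. emeasure lborel (sym_diff (E i) (E j)) \<le> ennreal ((1/2) ^ 0)"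
      using step[of UNIV "(1/2)^0"] by auto
    then obtain k where "k \<in> J" using infinite_imp_nonempty by blast
    then show "\<exists>x. ?P 0 x" using J by (intro exI[of _ "(J, k)"]) simp
    fix x m assume "?P m x"
    then obtain J k where x: "x = (J, k)" "infinite J" by (cases x) auto
    \<comment> \<open>Dropping the indices up to \<open>k\<close> forces the next choice to be
      larger.\<close>
    have "infinite (J - {..k})" using x(2) by simp
    from step[OF this, of "(1/2) ^ Suc m"] obtain J' where J': "J' \<subseteq> J - {..k}" "infinite J'"
      "\<forall>i\<in>J'. \<forall>j\<in>J'. emeasure lborel (sym_diff (E i) (E j)) \<le> ennreal ((1/2) ^ Suc m)" by auto
    then obtain k' where "k' \<in> J'" using infinite_imp_nonempty by blast
    then show "\<exists>y. ?P (Suc m) y \<and> ?R m x y"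
      using J' x by (intro exI[of _ "(J', k')"]) auto
  qed
  then obtain f where f': "\<forall>m. ?P m (f m) \<and> ?R m (f m) (f (Suc m))" by (rule exE)
  note f = f'[rule_format, THEN conjunct1] f'[rule_format, THEN conjunct2]
  define r where "r = (\<lambda>m. snd (f m))"
  have "strict_mono r"
    using f(2) by (auto simp: strict_mono_Suc_iff r_def case_prod_beta)
  moreover have "emeasure lborel (sym_diff (E (r m)) (E (r (Suc m)))) \<le> ennreal ((1/2) ^ m)" for m
  proof -
    have "r m \<in> fst (f m)" "r (Suc m) \<in> fst (f m)"
      using f(1)[of m] f(1)[of "Suc m"] f(2)[of m] by (auto simp: r_def case_prod_beta)
    then show ?thesis using f(1)[of m] by (auto simp: case_prod_beta)
  qed
  ultimately show ?thesis by (rule that)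
qed

text \<open>The consecutive symmetric differences have summable measure, so by Borel-Cantelli almost
  every point lies in only finitely many of them and its membership stabilises.\<close>

lemma finite_perimeter_compact_borel:
  fixes E :: "nat \<Rightarrow> 'a::euclidean_space set"
  assumes E: "\<And>k. E k \<in> sets borel" "\<And>k. E k \<subseteq> S" and S: "bounded S"
    and P: "\<And>k. perimeter (E k) \<le> ennreal c" and c: "c \<ge> 0"
  obtains r G where "strict_mono r" "G \<in> sets borel" "G \<subseteq> S" "ae_tendsto (\<lambda>k. E (r k)) G"
proof -
  obtain r :: "nat \<Rightarrow> nat" where r: "strict_mono r"
    "\<And>m. emeasure lborel (sym_diff (E (r m)) (E (r (Suc m)))) \<le> ennreal ((1/2) ^ m)"
    by (rule finite_perimeter_Cauchy_subsequence[of E, OF E S P c]) (rule that)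
  let ?D = "\<lambda>m. sym_diff (E (r m)) (E (r (Suc m)))"
  \<comment> \<open>The set-theoretic lower limit is Borel and lies in \<open>S\<close> outright,
    not just up to a null set.\<close>
  define G where "G = (\<Union>n. \<Inter>m\<in>{n..}. E (r m))"
  have "AE x in lborel. \<forall>\<^sub>F n in sequentially. x \<in> space lborel - ?D n"
  proof (rule borel_cantelli_AE1)
    show "?D n \<in> sets lborel" for n using E(1) by auto
    show fin: "emeasure lborel (?D n) < \<infinity>" for n
      using r(2)[of n] by (simp add: le_less_trans)
    have "measure lborel (?D n) \<le> (1/2) ^ n" for n
      using r(2)[of n] by (simp add: measure_def enn2real_leI)
    then show "summable (\<lambda>n. measure lborel (?D n))"
      by (intro summable_comparison_test'[OF summable_geometric[of "1/2"], of 0]) auto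
  qed
  then have "AE x in lebesgue. \<forall>\<^sub>F n in sequentially. x \<in> space lborel - ?D n"
    by (rule AE_completion)
  then have "ae_tendsto (\<lambda>k. E (r k)) G"
  proof eventually_elim
    case (elim x)
    then obtain N where N: "\<And>n. n \<ge> N \<Longrightarrow> x \<notin> ?D n" by (auto simp: eventually_sequentially)
    have const: "x \<in> E (r n) \<longleftrightarrow> x \<in> E (r N)" if "n \<ge> N" for n
      using that
    proof (induction n rule: dec_induct)
      case base then show ?case by simp
    next
      case (step n)
      have "x \<notin> ?D n" using N[OF step.hyps(1)] .
      then show ?case using step.IH by auto
    qed
    have "x \<in> G \<longleftrightarrow> x \<in> E (r N)"
    proof
      assume "x \<in> G"
      then obtain n where "\<And>m. m \<ge> n \<Longrightarrow> x \<in> E (r m)" by (auto simp: G_def)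
      then have "x \<in> E (r (max n N))" by simp
      then show "x \<in> E (r N)" using const[of "max n N"] by simp
    next
      assume "x \<in> E (r N)"
      then have "x \<in> E (r n)" if "n \<ge> N" for n using const[OF that] by blast
      then show "x \<in> G" unfolding G_def by blast
    qed
    then have "x \<in> E (r n) \<longleftrightarrow> x \<in> G" if "n \<ge> N" for n using const[OF that] by blast
    then show ?case unfolding eventually_sequentially by blast
  qed
  moreover have "G \<in> sets borel" unfolding G_def using E(1) by auto
  moreover have "G \<subseteq> S"
  proof
    fix x assume "x \<in> G"
    then obtain n where "x \<in> E (r n)" by (auto simp: G_def)
    then show "x \<in> S" using E(2) by auto
  qed
  ultimately show ?thesis using that[OF r(1)] by simp
qed

text \<open>The Borel set is taken inside \<open>E\<close>, so inclusions in a bounded set are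
  inherited. It reduces compactness to Borel sets, for which the translation estimate is
  stated.\<close>

lemma lebesgue_set_ae_eq_borel:
  fixes E :: "'a::euclidean_space set"
  assumes "E \<in> sets lebesgue"
  obtains E' where "E' \<in> sets borel" "E' \<subseteq> E" "ae_eq E' E"
proof -
  obtain S N N' where N: "E = S \<union> N" "N \<subseteq> N'" "N' \<in> null_sets lborel" "S \<in> sets lborel"
    using assms by (rule sets_completionE)
  have "negligible N'" using N(3) by (simp add: negligible_iff_null_sets null_sets_completionI)
  then have "ae_eq S E" unfolding AE_lebesgue_iff_negligible by (rule negligible_subset) (use N in auto)
  then show ?thesis using that[of S] N by auto
qed

lemma finite_perimeter_compact:
  fixes E :: "nat \<Rightarrow> 'a::euclidean_space set"
  assumes E: "\<And>k. E k \<in> sets lebesgue" "\<And>k. E k \<subseteq> S" and S: "bounded S"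
    and P: "\<And>k. perimeter (E k) \<le> ennreal c" and c: "c \<ge> 0"
  obtains r G where "strict_mono r" "G \<in> sets lebesgue" "G \<subseteq> S" "ae_tendsto (\<lambda>k. E (r k)) G"
proof -
  have "\<exists>E'. E' \<in> sets borel \<and> E' \<subseteq> E k \<and> ae_eq E' (E k)" for k
    by (rule lebesgue_set_ae_eq_borel[OF E(1)[of k]]) blast
  then obtain E' where E': "\<And>k. E' k \<in> sets borel" "\<And>k. E' k \<subseteq> E k" "\<And>k. ae_eq (E' k) (E k)" by metis
  have E'': "E' k \<subseteq> S" "perimeter (E' k) \<le> ennreal c" for k
    using E'(2)[of k] E(2)[of k] P[of k] ae_eq_perimeter[OF E'(3)[of k]] by auto
  obtain r G where G: "strict_mono r" "G \<in> sets borel" "G \<subseteq> S" "ae_tendsto (\<lambda>k. E' (r k)) G"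
    by (rule finite_perimeter_compact_borel[of E', OF E'(1) E''(1) S E''(2) c])
  have "AE x in lebesgue. \<forall>k. x \<in> E' k \<longleftrightarrow> x \<in> E k" using E'(3) by (simp add: AE_all_countable)
  with G(4) have "ae_tendsto (\<lambda>k. E (r k)) G" by eventually_elim simp
  then show ?thesis using that[OF G(1) _ G(3)] G(2) by simp
qed

text \<open>Subsequences are extracted one index at a time; limits found earlier persist along later
  subsequences.\<close>

lemma finite_perimeter_compact_family:
  fixes E :: "nat \<Rightarrow> 'i \<Rightarrow> 'a::euclidean_space set"
  assumes I: "finite I" and E: "\<And>k i. i \<in> I \<Longrightarrow> E k i \<in> sets lebesgue" "\<And>k i. i \<in> I \<Longrightarrow> E k i \<subseteq> S"
    and S: "bounded S"
    and P: "\<And>k i. i \<in> I \<Longrightarrow> perimeter (E k i) \<le> ennreal c" and c: "c \<ge> 0"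
  shows "\<exists>r G. strict_mono r \<and> (\<forall>i\<in>I. G i \<in> sets lebesgue \<and> G i \<subseteq> S \<and> ae_tendsto (\<lambda>k. E (r k) i) (G i))"
  using I E P
proof (induction I rule: finite_induct)
  case empty
  then show ?case by (intro exI[of _ "\<lambda>k. k"]) (auto simp: strict_mono_def)
next
  case (insert j I)
  have "\<exists>r G. strict_mono r \<and> (\<forall>i\<in>I. G i \<in> sets lebesgue \<and> G i \<subseteq> S \<and> ae_tendsto (\<lambda>k. E (r k) i) (G i))"
    by (rule insert.IH) (use insert.prems in auto)
  then obtain r G where r: "strict_mono r"
    and rG: "\<forall>i\<in>I. G i \<in> sets lebesgue \<and> G i \<subseteq> S \<and> ae_tendsto (\<lambda>k. E (r k) i) (G i)"
    by (elim exE conjE) (rule that)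
  have jE: "E (r k) j \<in> sets lebesgue" "E (r k) j \<subseteq> S" "perimeter (E (r k) j) \<le> ennreal c" for k
    using insert.prems by simp_all
  obtain s H where s: "strict_mono s" "H \<in> sets lebesgue" "H \<subseteq> S" "ae_tendsto (\<lambda>k. E (r (s k)) j) H"
    by (rule finite_perimeter_compact[of "\<lambda>k. E (r k) j", OF jE(1,2) S jE(3) c])
  have sub: "ae_tendsto (\<lambda>k. E (r (s k)) i) (G i)" if "i \<in> I" for i
  proof -
    have "ae_tendsto (\<lambda>k. E (r k) i) (G i)" using rG that by blast
    then show ?thesis
      by eventually_elim (rule eventually_subseq[OF s(1)])
  qed
  have "strict_mono (r \<circ> s)" using r s(1) by (rule strict_mono_o)
  moreover have "\<forall>i\<in>insert j I. (G(j := H)) i \<in> sets lebesgue \<and> (G(j := H)) i \<subseteq> S \<and>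
      ae_tendsto (\<lambda>k. E ((r \<circ> s) k) i) ((G(j := H)) i)"
    using rG s sub insert.hyps(2) by (simp add: o_def)
  ultimately show ?case by (intro exI conjI)
qed

section \<open>The Lebesgue density theorem\<close>


text \<open>Small balls inside \<open>W\<close> on which \<open>E\<close> has relative measure below
  \<open>\<alpha>\<close> form a fine cover of \<open>Z\<close>. Vitali selects disjoint ones that
  cover \<open>Z\<close> up to a null set; the portions of \<open>E\<close> in them add up to at
  most \<open>\<alpha>\<close> times the measure of \<open>W\<close>.\<close>

lemma Vitali_density_cover:
  fixes E Z W :: "'a::euclidean_space set"
  assumes E: "E \<in> sets lebesgue" and ZE: "Z \<subseteq> E" and W: "open W" "Z \<subseteq> W" and \<alpha>: "\<alpha> \<ge> 0"
    and dens: "\<And>x d. x \<in> Z \<Longrightarrow> d > 0 \<Longrightarrow>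
      \<exists>r. 0 < r \<and> r < d \<and> measure lebesgue (E \<inter> ball x r) < \<alpha> * measure lebesgue (ball x r)"
  obtains C where "C \<in> sets lebesgue" "Z \<subseteq> C" "emeasure lebesgue C \<le> ennreal \<alpha> * emeasure lebesgue W"
proof -
  define K where "K = {(x, r). 0 < r \<and> ball x r \<subseteq> W \<and> measure lebesgue (E \<inter> ball x r) < \<alpha> * measure lebesgue (ball x r)}"
  have fine: "\<exists>i. i \<in> K \<and> x \<in> ball (fst i) (snd i) \<and> snd i < d" if x: "x \<in> Z" and d: "0 < d" for x d
  proof -
    obtain s where s: "s > 0" "ball x s \<subseteq> W" using W x by (meson openE subsetD)
    obtain r where r: "0 < r" "r < min d s" "measure lebesgue (E \<inter> ball x r) < \<alpha> * measure lebesgue (ball x r)"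
      using dens[OF x, of "min d s"] d s by auto
    have "ball x r \<subseteq> ball x s" using r by (intro subset_ball) auto
    then have "(x, r) \<in> K" using r s by (auto simp: K_def)
    then show ?thesis using r by (intro exI[of _ "(x, r)"]) auto
  qed
  obtain C where C: "countable C" "C \<subseteq> K"
     "pairwise (\<lambda>i j. disjnt (ball (fst i) (snd i)) (ball (fst j) (snd j))) C"
     "negligible (Z - (\<Union>i\<in>C. ball (fst i) (snd i)))"
    by (rule Vitali_covering_theorem_balls[of Z K fst snd, OF fine])
  let ?B = "\<lambda>i. ball (fst i) (snd i) :: 'a set"
  let ?N = "Z - (\<Union>i\<in>C. ?B i)"
  have N: "?N \<in> null_sets lebesgue" using C(4) by (simp add: negligible_iff_null_sets)
  have disj: "disjoint_family_on ?B C"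
    using C(3) by (auto simp: disjoint_family_on_def pairwise_def disjnt_def)
  then have disj': "disjoint_family_on (\<lambda>i. E \<inter> ?B i) C"
    unfolding disjoint_family_on_def by blast
  have le: "emeasure lebesgue (E \<inter> ?B i) \<le> ennreal \<alpha> * emeasure lebesgue (?B i)" if "i \<in> C" for i
  proof -
    have "E \<inter> ?B i \<in> lmeasurable" using fmeasurable_Int_fmeasurable[OF lmeasurable_ball E] by (simp add: inf_commute)
    then have "emeasure lebesgue (E \<inter> ?B i) = ennreal (measure lebesgue (E \<inter> ?B i))"
      by (rule emeasure_eq_measure2)
    also have "\<dots> \<le> ennreal (\<alpha> * measure lebesgue (?B i))"
      using that C(2) by (intro ennreal_leI) (auto simp: K_def)
    also have "\<dots> = ennreal \<alpha> * emeasure lebesgue (?B i)"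
      using \<alpha> emeasure_eq_measure2[OF lmeasurable_ball[of "fst i" "snd i"]] by (simp add: ennreal_mult)
    finally show ?thesis .
  qed
  have "emeasure lebesgue (\<Union>i\<in>C. E \<inter> ?B i) = (\<integral>\<^sup>+i. emeasure lebesgue (E \<inter> ?B i) \<partial>count_space C)"
    by (rule emeasure_UN_countable[OF _ C(1) disj']) (use E in auto)
  also have "\<dots> \<le> (\<integral>\<^sup>+i. ennreal \<alpha> * emeasure lebesgue (?B i) \<partial>count_space C)"
    by (rule nn_integral_mono) (use le in auto)
  also have "\<dots> = ennreal \<alpha> * (\<integral>\<^sup>+i. emeasure lebesgue (?B i) \<partial>count_space C)"
    by (rule nn_integral_cmult) simp
  also have "(\<integral>\<^sup>+i. emeasure lebesgue (?B i) \<partial>count_space C) = emeasure lebesgue (\<Union>i\<in>C. ?B i)"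
    by (rule emeasure_UN_countable[symmetric, OF _ C(1) disj]) auto
  also have "ennreal \<alpha> * emeasure lebesgue (\<Union>i\<in>C. ?B i) \<le> ennreal \<alpha> * emeasure lebesgue W"
  proof (rule mult_left_mono)
    have "(\<Union>i\<in>C. ?B i) \<subseteq> W" using C(2) by (auto simp: K_def subset_iff)
    then show "emeasure lebesgue (\<Union>i\<in>C. ?B i) \<le> emeasure lebesgue W"
      by (rule emeasure_mono) (use W in \<open>simp add: borel_open\<close>)
  qed simp
  finally have m: "emeasure lebesgue (\<Union>i\<in>C. E \<inter> ?B i) \<le> ennreal \<alpha> * emeasure lebesgue W" .
  have U: "(\<Union>i\<in>C. E \<inter> ?B i) \<in> sets lebesgue" using C(1) E by (intro sets.countable_UN'') auto
  show ?thesis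
  proof
    show "(\<Union>i\<in>C. E \<inter> ?B i) \<union> ?N \<in> sets lebesgue" using U N by auto
    show "Z \<subseteq> (\<Union>i\<in>C. E \<inter> ?B i) \<union> ?N" using ZE by auto
    show "emeasure lebesgue ((\<Union>i\<in>C. E \<inter> ?B i) \<union> ?N) \<le> ennreal \<alpha> * emeasure lebesgue W"
      using m emeasure_Un_null_set[OF U N] by simp
  qed
qed

text \<open>Measurability of \<open>Z\<close> is not assumed, so a measurable hull \<open>A\<close>
  of the same outer measure replaces it. An open \<open>W\<close> barely larger than
  \<open>A\<close> and the cover give \<open>|A| \<le> \<alpha> * (|A| + e)\<close> for every
  \<open>e\<close>; finiteness of \<open>|A|\<close> and \<open>\<alpha> < 1\<close> leave only
  \<open>|A| = 0\<close>.\<close>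

lemma low_density_negligible:
  fixes E Z :: "'a::euclidean_space set"
  assumes E: "E \<in> sets lebesgue" and ZE: "Z \<subseteq> E" "bounded Z" and \<alpha>: "\<alpha> \<ge> 0" "\<alpha> < 1"
    and dens: "\<And>x d. x \<in> Z \<Longrightarrow> d > 0 \<Longrightarrow>
      \<exists>r. 0 < r \<and> r < d \<and> measure lebesgue (E \<inter> ball x r) < \<alpha> * measure lebesgue (ball x r)"
  shows "negligible Z"
proof -
  obtain A where A: "A \<in> sets lebesgue" "Z \<subseteq> A" "outer_measure_of lebesgue Z = emeasure lebesgue A"
    using outer_measure_of_attain[of Z lebesgue] by auto
  have min: "emeasure lebesgue A \<le> emeasure lebesgue C" if "C \<in> sets lebesgue" "Z \<subseteq> C" for C
    using outer_measure_of_mono[OF that(2), of lebesgue] that(1) A(3) by simp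
  obtain R where R: "Z \<subseteq> ball 0 R" using bounded_subset_ballD[OF ZE(2)] by blast
  have "emeasure lebesgue A \<le> emeasure lebesgue (ball (0::'a) R)" by (rule min) (use R in auto)
  also have "\<dots> < \<infinity>" using lmeasurable_ball[of "0::'a" R] by (simp add: fmeasurable_def)
  finally have Am: "A \<in> lmeasurable" using A(1) by (simp add: fmeasurable_def)
  define m where "m = measure lebesgue A"
  have em: "emeasure lebesgue A = ennreal m" unfolding m_def by (rule emeasure_eq_measure2[OF Am])
  have m0: "m \<ge> 0" by (simp add: m_def)
  have "m \<le> \<alpha> * m + e" if e: "e > 0" for e
  proof -
    obtain W where W: "open W" "A \<subseteq> W" "W - A \<in> lmeasurable" "emeasure lebesgue (W - A) < ennreal e"
      by (rule sets_lebesgue_outer_open[OF A(1) e])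
    obtain C where C: "C \<in> sets lebesgue" "Z \<subseteq> C" "emeasure lebesgue C \<le> ennreal \<alpha> * emeasure lebesgue W"
      by (rule Vitali_density_cover[OF E ZE(1) W(1) order_trans[OF A(2) W(2)] \<alpha>(1) dens])
    have "emeasure lebesgue W = emeasure lebesgue A + emeasure lebesgue (W - A)"
      using A(1) W(1,2) by (subst plus_emeasure) (auto simp: borel_open Un_absorb1 intro!: arg_cong[where f="emeasure lebesgue"])
    also have "\<dots> \<le> ennreal (m + e)" using W(4) e m0 by (simp add: em less_imp_le)
    finally have "emeasure lebesgue W \<le> ennreal (m + e)" .
    then have "ennreal \<alpha> * emeasure lebesgue W \<le> ennreal \<alpha> * ennreal (m + e)"
      by (rule mult_left_mono) simp
    then have "ennreal m \<le> ennreal (\<alpha> * (m + e))"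
      using min[OF C(1,2)] C(3) \<alpha> m0 e by (simp add: em ennreal_mult del: ennreal_plus)
    then have "m \<le> \<alpha> * (m + e)" using \<alpha> m0 e by (simp add: ennreal_le_iff)
    also have "\<dots> \<le> \<alpha> * m + e"
      using \<alpha> e mult_right_mono[of \<alpha> 1 e] by (simp add: distrib_left)
    finally show ?thesis .
  qed
  then have "m \<le> \<alpha> * m" by (rule field_le_epsilon)
  then have "(1 - \<alpha>) * m \<le> 0" by (simp add: algebra_simps)
  then have "m = 0" using \<alpha> m0 by (simp add: mult_le_0_iff)
  then have "A \<in> null_sets lebesgue" using A(1) em by (auto intro!: null_setsI)
  then show ?thesis using A(2) negligible_iff_null_sets negligible_subset by blast
qed

lemma measure_ball_pos: "r > 0 \<Longrightarrow> measure lebesgue (ball (x::'a::euclidean_space) r) > 0"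
  by (simp add: content_ball_pos)

text \<open>The density ratio never exceeds 1, so if it fails to tend to 1 it drops below some
  \<open>1 - 1 / (k + 1)\<close> at arbitrarily small radii. The index \<open>k\<close> makes the
  union of exceptional sets countable, and \<open>n\<close> makes each of them bounded.\<close>

lemma AE_density_one:
  fixes E :: "'a::euclidean_space set"
  assumes E: "E \<in> sets lebesgue"
  shows "AE x in lebesgue. x \<in> E \<longrightarrow> x \<in> density_one_points E"
proof -
  define Z where "Z = (\<lambda>(k::nat) (n::nat). {x \<in> E \<inter> ball 0 (real n). \<forall>d>0. \<exists>r. 0 < r \<and> r < d \<and>
     measure lebesgue (E \<inter> ball x r) < (1 - 1 / (real k + 1)) * measure lebesgue (ball x r)})"
  have "negligible (Z k n)" for k n
    by (rule low_density_negligible[OF E, of _ "1 - 1 / (real k + 1)"])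
       (auto simp: Z_def intro!: bounded_subset[OF bounded_ball[of 0 "real n"]])
  then have neg: "negligible (\<Union>k. \<Union>n. Z k n)" by (intro negligible_countable_Union) (auto intro!: negligible_Union_nat)
  have sub: "{x. \<not> (x \<in> E \<longrightarrow> x \<in> density_one_points E)} \<subseteq> (\<Union>k. \<Union>n. Z k n)"
  proof
    fix x assume "x \<in> {x. \<not> (x \<in> E \<longrightarrow> x \<in> density_one_points E)}"
    then have x: "x \<in> E" and nd: "x \<notin> density_one_points E" by auto
    let ?\<rho> = "\<lambda>r. measure lebesgue (E \<inter> ball x r) / measure lebesgue (ball x r)"
    have le1: "?\<rho> r \<le> 1" for r
    proof -
      have "measure lebesgue (E \<inter> ball x r) \<le> measure lebesgue (ball x r)"
        using E by (intro measure_mono_fmeasurable) auto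
      then show ?thesis by (simp add: divide_le_eq_1 less_le)
    qed
    obtain e where e: "e > 0" "\<not> (\<forall>\<^sub>F r in at_right 0. dist (?\<rho> r) 1 < e)"
      using nd by (auto simp: density_one_points_def tendsto_iff)
    obtain k :: nat where k: "1 / (real k + 1) < e"
      using reals_Archimedean[OF e(1)] by (auto simp: inverse_eq_divide add.commute)
    obtain n :: nat where n: "norm x < real n" using reals_Archimedean2 by blast
    have "\<exists>r. 0 < r \<and> r < d \<and> measure lebesgue (E \<inter> ball x r) < (1 - 1 / (real k + 1)) * measure lebesgue (ball x r)"
      if d: "d > 0" for d
    proof (rule ccontr)
      assume neg: "\<not> ?thesis"
      have "dist (?\<rho> r) 1 < e" if r: "0 < r" "r < d" for r
      proof -
        have "measure lebesgue (E \<inter> ball x r) \<ge> (1 - 1 / (real k + 1)) * measure lebesgue (ball x r)"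
          using neg r by (meson not_less)
        then have "?\<rho> r \<ge> 1 - 1 / (real k + 1)"
          using measure_ball_pos[OF r(1), of x] by (simp add: pos_le_divide_eq)
        then show ?thesis using le1[of r] k by (simp add: dist_real_def)
      qed
      then have "\<forall>\<^sub>F r in at_right 0. dist (?\<rho> r) 1 < e"
        unfolding eventually_at_right_field using d by (intro exI[of _ d]) auto
      then show False using e(2) by simp
    qed
    then have "x \<in> Z k n" using x n by (simp add: Z_def)
    then show "x \<in> (\<Union>k. \<Union>n. Z k n)" by blast
  qed
  show ?thesis unfolding AE_lebesgue_iff_negligible by (rule negligible_subset[OF neg sub])
qed

text \<open>The one-sided statement is applied to \<open>E\<close> and to its complement: the two
  density ratios add up to 1, so no point has density one for both.\<close>

theorem Lebesgue_density:
  fixes E :: "'a::euclidean_space set"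
  assumes E: "E \<in> sets lebesgue"
  shows "ae_eq (density_one_points E) E"
proof -
  have Ec: "- E \<in> sets lebesgue" using E by (simp add: Compl_in_sets_lebesgue)
  have excl: "\<not> (x \<in> density_one_points E \<and> x \<in> density_one_points (- E))" for x
  proof
    let ?\<rho> = "\<lambda>E r. measure lebesgue (E \<inter> ball x r) / measure lebesgue (ball x r)"
    assume "x \<in> density_one_points E \<and> x \<in> density_one_points (- E)"
    then have "((\<lambda>r. ?\<rho> E r + ?\<rho> (- E) r) \<longlongrightarrow> 1 + 1) (at_right 0)"
      unfolding density_one_points_def by (intro tendsto_add) auto
    moreover have "\<forall>\<^sub>F r in at_right 0. ?\<rho> E r + ?\<rho> (- E) r = 1"
    proof -
      have "?\<rho> E r + ?\<rho> (- E) r = 1" if "r > 0" for r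
      proof -
        have "measure lebesgue (ball x r) = measure lebesgue ((E \<inter> ball x r) \<union> (- E \<inter> ball x r))"
          by (intro arg_cong[where f = "measure lebesgue"]) auto
        also have "\<dots> = measure lebesgue (E \<inter> ball x r) + measure lebesgue (- E \<inter> ball x r)"
        proof (rule measure_Un_AE)
          show "E \<inter> ball x r \<in> lmeasurable" "- E \<inter> ball x r \<in> lmeasurable"
            using fmeasurable_Int_fmeasurable[OF lmeasurable_ball E] fmeasurable_Int_fmeasurable[OF lmeasurable_ball Ec]
            by (simp_all add: inf_commute)
        qed simp
        finally show ?thesis using measure_ball_pos[OF that, of x] by (simp add: add_divide_distrib[symmetric])
      qed
      then show ?thesis unfolding eventually_at_right_field by (intro exI[of _ 1]) auto
    qed
    ultimately have "((\<lambda>r. 1) \<longlongrightarrow> (1 + 1 :: real)) (at_right (0::real))"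
      by (rule Lim_transform_eventually)
    then show False using tendsto_unique[OF trivial_limit_at_right_real tendsto_const] by fastforce
  qed
  from AE_density_one[OF E] AE_density_one[OF Ec] show ?thesis
    by eventually_elim (use excl in blast)
qed

section \<open>Density-one representatives\<close>

lemma density_one_points_cong:
  assumes "ae_eq E G" "E \<in> sets lebesgue"
  shows "density_one_points E = density_one_points G"
proof -
  have G: "G \<in> sets lebesgue" by (rule ae_eq_sets_lebesgue[OF assms])
  have "measure lebesgue (E \<inter> ball x r) = measure lebesgue (G \<inter> ball x r)" for x r
  proof (rule measure_eq_AE)
    show "AE y in lebesgue. y \<in> E \<inter> ball x r \<longleftrightarrow> y \<in> G \<inter> ball x r"
      using assms(1) by eventually_elim auto
  qed (use assms(2) G in auto)
  then show ?thesis by (simp add: density_one_points_def)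
qed

lemma density_one_points_sets: "E \<in> sets lebesgue \<Longrightarrow> density_one_points E \<in> sets lebesgue"
  by (rule ae_eq_sets_lebesgue[OF AE_mp[OF Lebesgue_density]]) auto

lemma density_one_points_idem:
  "E \<in> sets lebesgue \<Longrightarrow> density_one_points (density_one_points E) = density_one_points E"
  by (rule density_one_points_cong[OF Lebesgue_density density_one_points_sets])

text \<open>A point off \<open>K\<close> has a ball that misses \<open>K\<close>; there
  \<open>E\<close> is null and its density is 0. This upgrades an almost everywhere inclusion to a
  pointwise one.\<close>

lemma density_one_points_subset_closed:
  assumes K: "closed K" and sub: "AE x in lebesgue. x \<in> E \<longrightarrow> x \<in> K"
  shows "density_one_points E \<subseteq> K"
proof
  fix x assume x: "x \<in> density_one_points E"
  show "x \<in> K"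
  proof (rule ccontr)
    assume "x \<notin> K"
    then obtain d where d: "d > 0" "ball x d \<subseteq> - K" using K by (metis ComplI open_Compl openE)
    have "measure lebesgue (E \<inter> ball x r) / measure lebesgue (ball x r) = 0" if "r < d" for r
    proof -
      have "negligible {x. \<not> (x \<in> E \<longrightarrow> x \<in> K)}" using sub by (simp only: AE_lebesgue_iff_negligible)
      then have "negligible (E \<inter> ball x r)"
        by (rule negligible_subset) (use d that in \<open>auto simp: subset_iff\<close>)
      then show ?thesis by (simp add: negligible_imp_measure0)
    qed
    then have "\<forall>\<^sub>F r in at_right 0. measure lebesgue (E \<inter> ball x r) / measure lebesgue (ball x r) = 0"
      unfolding eventually_at_right_field using d(1) by blast
    then have "((\<lambda>r. 0) \<longlongrightarrow> (1 :: real)) (at_right (0::real))"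
      using x unfolding density_one_points_def by (auto elim: Lim_transform_eventually)
    then show False using tendsto_unique[OF trivial_limit_at_right_real tendsto_const] by fastforce
  qed
qed

section \<open>The distance term and almost-everywhere partitions\<close>


lemma measurable_infdist_ennreal: "(\<lambda>x. ennreal (infdist x F)) \<in> borel_measurable lebesgue"
proof -
  have "continuous_on UNIV (\<lambda>x. infdist x F)" by (intro continuous_intros)
  then have "(\<lambda>x. infdist x F) \<in> borel_measurable borel" by (rule borel_measurable_continuous_onI)
  then have "(\<lambda>x. ennreal (infdist x F)) \<in> borel_measurable borel" by measurable
  then show ?thesis by (simp add: measurable_completion)
qed

lemma measurable_indicator_infdist:
  "S \<in> sets lebesgue \<Longrightarrow> (\<lambda>x. indicator S x * ennreal (infdist x F)) \<in> borel_measurable lebesgue"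
  by (intro borel_measurable_times_ennreal measurable_infdist_ennreal borel_measurable_indicator)

lemma emeasure_eq_0_iff_AE:
  "S \<in> sets lebesgue \<Longrightarrow> emeasure lebesgue S = 0 \<longleftrightarrow> (AE x in lebesgue. x \<notin> S)"
  by (simp add: AE_lebesgue_iff_negligible negligible_iff_emeasure0)

text \<open>With a nonempty frontier the special value 0 in the definition is what the integral
  gives anyway.\<close>

lemma sigma_bar_eq_integral:
  assumes "E \<in> sets lebesgue" "G \<in> sets lebesgue" "frontier G \<noteq> {}"
  shows "sigma_bar E G = (\<integral>\<^sup>+ x. indicator (sym_diff E G) x * ennreal (infdist x (frontier G)) \<partial>lebesgue)"
proof (cases "emeasure lebesgue (sym_diff E G) = 0")
  case True
  then have "AE x in lebesgue. x \<notin> sym_diff E G" using assms by (subst emeasure_eq_0_iff_AE[symmetric]) auto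
  then have "AE x in lebesgue. indicator (sym_diff E G) x * ennreal (infdist x (frontier G)) = 0"
    by eventually_elim (simp add: indicator_def)
  then have "(\<integral>\<^sup>+ x. indicator (sym_diff E G) x * ennreal (infdist x (frontier G)) \<partial>lebesgue) = 0"
    by (subst nn_integral_0_iff_AE, intro measurable_indicator_infdist) (use assms in auto)
  then show ?thesis using True by (simp add: sigma_bar_def)
next
  case False
  then show ?thesis using assms(3) by (simp add: sigma_bar_def)
qed

lemma indicator_times_mono: "(x \<in> S \<longrightarrow> x \<in> T) \<Longrightarrow> indicator S x * c \<le> indicator T x * (c :: ennreal)"
  by (auto simp: indicator_def)

lemma sigma_bar_mono:
  assumes m: "E \<in> sets lebesgue" "E' \<in> sets lebesgue" "G \<in> sets lebesgue"
    and sub: "AE x in lebesgue. x \<in> sym_diff E' G \<longrightarrow> x \<in> sym_diff E G"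
  shows "sigma_bar E' G \<le> sigma_bar E G"
proof (cases "frontier G = {}")
  case False
  have "(\<integral>\<^sup>+ x. indicator (sym_diff E' G) x * ennreal (infdist x (frontier G)) \<partial>lebesgue)
    \<le> (\<integral>\<^sup>+ x. indicator (sym_diff E G) x * ennreal (infdist x (frontier G)) \<partial>lebesgue)"
  proof (rule nn_integral_mono_AE)
    from sub show "AE x in lebesgue. indicator (sym_diff E' G) x * ennreal (infdist x (frontier G))
        \<le> indicator (sym_diff E G) x * ennreal (infdist x (frontier G))"
      by eventually_elim (rule indicator_times_mono)
  qed
  then show ?thesis using False m by (simp add: sigma_bar_eq_integral)
next
  case True
  have "emeasure lebesgue (sym_diff E' G) = 0" if "emeasure lebesgue (sym_diff E G) = 0"
  proof -
    have "AE x in lebesgue. x \<notin> sym_diff E G" using that m by (subst emeasure_eq_0_iff_AE[symmetric]) auto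
    with sub have "AE x in lebesgue. x \<notin> sym_diff E' G" by eventually_elim blast
    then show ?thesis using m by (subst emeasure_eq_0_iff_AE) auto
  qed
  then show ?thesis using True by (auto simp: sigma_bar_def)
qed

text \<open>Only the first argument may be altered on a null set: the second enters through its
  topological frontier.\<close>

lemma sigma_bar_cong:
  assumes m: "E \<in> sets lebesgue" "G \<in> sets lebesgue" and eq: "ae_eq E' E"
  shows "sigma_bar E' G = sigma_bar E G"
proof (rule antisym)
  have "ae_eq E E'" using eq by eventually_elim simp
  then have m': "E' \<in> sets lebesgue" using m(1) by (rule ae_eq_sets_lebesgue)
  from eq have "AE x in lebesgue. x \<in> sym_diff E' G \<longleftrightarrow> x \<in> sym_diff E G"
    by eventually_elim simp
  then have "AE x in lebesgue. x \<in> sym_diff E' G \<longrightarrow> x \<in> sym_diff E G"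
    "AE x in lebesgue. x \<in> sym_diff E G \<longrightarrow> x \<in> sym_diff E' G" by (auto elim: eventually_mono)
  then show "sigma_bar E' G \<le> sigma_bar E G" "sigma_bar E G \<le> sigma_bar E' G"
    using m m' by (auto intro!: sigma_bar_mono)
qed

text \<open>With a nonempty frontier this is Fatou's lemma. With an empty one the values are 0 or
  infinity: if infinitely many \<open>E k\<close> agreed with \<open>A\<close> almost everywhere, so
  would the limit, hence a nonzero limit value forces infinity from some \<open>k\<close>
  on.\<close>

lemma sigma_bar_lsc:
  assumes m: "\<And>k. E k \<in> sets lebesgue" "G \<in> sets lebesgue" "A \<in> sets lebesgue" and lim: "ae_tendsto E G"
  shows "sigma_bar G A \<le> liminf (\<lambda>k. sigma_bar (E k) A)"
proof (cases "frontier A = {}")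
  case False
  let ?d = "\<lambda>x. ennreal (infdist x (frontier A))"
  have "sigma_bar G A = (\<integral>\<^sup>+ x. indicator (sym_diff G A) x * ?d x \<partial>lebesgue)"
    by (rule sigma_bar_eq_integral[OF m(2,3) False])
  also have "\<dots> \<le> (\<integral>\<^sup>+ x. liminf (\<lambda>k. indicator (sym_diff (E k) A) x * ?d x) \<partial>lebesgue)"
  proof (rule nn_integral_mono_AE)
    from lim show "AE x in lebesgue. indicator (sym_diff G A) x * ?d x \<le> liminf (\<lambda>k. indicator (sym_diff (E k) A) x * ?d x)"
    proof eventually_elim
      case (elim x)
      then have "\<forall>\<^sub>F k in sequentially. indicator (sym_diff G A) x * ?d x \<le> indicator (sym_diff (E k) A) x * ?d x"
        by eventually_elim (rule indicator_times_mono, simp)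
      then show ?case by (rule Liminf_bounded)
    qed
  qed
  also have "\<dots> \<le> liminf (\<lambda>k. \<integral>\<^sup>+ x. indicator (sym_diff (E k) A) x * ?d x \<partial>lebesgue)"
    by (rule nn_integral_liminf, rule measurable_indicator_infdist) (use m in auto)
  also have "\<dots> = liminf (\<lambda>k. sigma_bar (E k) A)"
    using m False by (simp add: sigma_bar_eq_integral)
  finally show ?thesis .
next
  case True
  show ?thesis
  proof (cases "emeasure lebesgue (sym_diff G A) = 0")
    case True
    then show ?thesis by (simp add: sigma_bar_def)
  next
    case nz: False
    have "\<forall>\<^sub>F k in sequentially. emeasure lebesgue (sym_diff (E k) A) \<noteq> 0"
    proof (rule ccontr)
      assume "\<not> ?thesis"
      then have freq: "\<exists>\<^sub>F k in sequentially. emeasure lebesgue (sym_diff (E k) A) = 0"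
        by (simp add: frequently_def)
      have "AE x in lebesgue. emeasure lebesgue (sym_diff (E k) A) = 0 \<longrightarrow> x \<notin> sym_diff (E k) A" for k
      proof (cases "emeasure lebesgue (sym_diff (E k) A) = 0")
        case True
        then have "AE x in lebesgue. x \<notin> sym_diff (E k) A"
          using m by (subst emeasure_eq_0_iff_AE[symmetric]) auto
        then show ?thesis by eventually_elim simp
      qed simp
      then have "AE x in lebesgue. \<forall>k. emeasure lebesgue (sym_diff (E k) A) = 0 \<longrightarrow> x \<notin> sym_diff (E k) A"
        by (simp add: AE_all_countable)
      with lim have "AE x in lebesgue. x \<notin> sym_diff G A"
      proof eventually_elim
        case (elim x)
        from frequently_eventually_conj[OF freq elim(1)]
        obtain k where "emeasure lebesgue (sym_diff (E k) A) = 0" "x \<in> E k \<longleftrightarrow> x \<in> G"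
          by (auto dest: frequently_ex)
        then show ?case using elim(2) by blast
      qed
      then have "emeasure lebesgue (sym_diff G A) = 0" using m by (subst emeasure_eq_0_iff_AE) auto
      then show False using nz by simp
    qed
    then have "\<forall>\<^sub>F k in sequentially. \<infinity> \<le> sigma_bar (E k) A"
      by eventually_elim (use True in \<open>simp add: sigma_bar_def\<close>)
    then have "\<infinity> \<le> liminf (\<lambda>k. sigma_bar (E k) A)" by (rule Liminf_bounded)
    then show ?thesis by (simp add: top_unique)
  qed
qed

text \<open>Because \<open>G \<subseteq> K\<close>, the set \<open>E - K\<close> lies in the
  difference of \<open>E\<close> and \<open>G\<close> and is disjoint from that of
  \<open>E \<inter> K\<close> and \<open>G\<close>. The integral measures what truncation
  gains.\<close>

lemma sigma_bar_Int_gap: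
  assumes m: "E \<in> sets lebesgue" "G \<in> sets lebesgue" "K \<in> sets lebesgue" and GK: "G \<subseteq> K" and f: "frontier G \<noteq> {}"
  shows "sigma_bar (E \<inter> K) G + (\<integral>\<^sup>+ x. indicator (E - K) x * ennreal (infdist x (frontier G)) \<partial>lebesgue)
    \<le> sigma_bar E G"
proof -
  let ?d = "\<lambda>x. ennreal (infdist x (frontier G))"
  have "sigma_bar (E \<inter> K) G + (\<integral>\<^sup>+ x. indicator (E - K) x * ?d x \<partial>lebesgue)
    = (\<integral>\<^sup>+ x. indicator (sym_diff (E \<inter> K) G) x * ?d x + indicator (E - K) x * ?d x \<partial>lebesgue)"
    unfolding sigma_bar_eq_integral[OF sets.Int[OF m(1,3)] m(2) f]
    by (rule nn_integral_add[symmetric]; rule measurable_indicator_infdist) (use m in auto)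
  also have "\<dots> \<le> (\<integral>\<^sup>+ x. indicator (sym_diff E G) x * ?d x \<partial>lebesgue)"
    by (rule nn_integral_mono) (use GK in \<open>auto simp: indicator_def\<close>)
  also have "\<dots> = sigma_bar E G" by (rule sigma_bar_eq_integral[OF m(1,2) f, symmetric])
  finally show ?thesis .
qed

text \<open>Multiplying any global field by a cutoff that is 1 on \<open>E\<close> gives a field
  supported in \<open>U\<close> with the same divergence on \<open>E\<close>. So local finiteness
  implies finite perimeter for bounded sets.\<close>

lemma perimeter_le_rel_perimeter:
  fixes E :: "'a::euclidean_space set"
  assumes E: "bounded E"
  obtains U where "open U" "bounded U" "perimeter E \<le> rel_perimeter U E"
proof -
  obtain \<eta> :: "'a \<Rightarrow> real" and U where \<eta>: "cont_diff \<eta>" "\<And>x. 0 \<le> \<eta> x" "\<And>x. \<eta> x \<le> 1" "open U" "bounded U"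
    "compact (closure {x. \<eta> x \<noteq> 0})" "closure {x. \<eta> x \<noteq> 0} \<subseteq> U"
    "\<And>x. x \<in> E \<Longrightarrow> \<eta> x = 1" "\<And>x. x \<in> E \<Longrightarrow> frechet_derivative \<eta> (at x) = (\<lambda>v. 0)"
    by (rule bounded_cutoff[OF E]) (rule that)
  have "perimeter E \<le> rel_perimeter U E"
    unfolding perimeter_def rel_perimeter_def[of UNIV]
  proof (rule SUP_least)
    fix \<phi> :: "'a \<Rightarrow> 'a" assume "\<phi> \<in> test_fields UNIV"
    then have \<phi>: "cont_diff \<phi>" "\<And>x. norm (\<phi> x) \<le> 1" by (auto simp: test_fields_iff)
    let ?\<psi> = "\<lambda>x. \<eta> x *\<^sub>R \<phi> x"
    have sub: "{x. ?\<psi> x \<noteq> 0} \<subseteq> {x. \<eta> x \<noteq> 0}" by auto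
    have "?\<psi> \<in> test_fields U"
      unfolding test_fields_iff
    proof (intro conjI allI)
      show "cont_diff ?\<psi>" by (rule cont_diff_scaleR[OF \<eta>(1) \<phi>(1)])
      show "compact (closure {x. ?\<psi> x \<noteq> 0})"
        by (rule compact_support_bounded[OF compact_imp_bounded[OF \<eta>(6)]])
           (use sub closure_subset[of "{x. \<eta> x \<noteq> 0}"] in blast)
      show "closure {x. ?\<psi> x \<noteq> 0} \<subseteq> U" using closure_mono[OF sub] \<eta>(7) by blast
      show "norm (?\<psi> x) \<le> 1" for x
        using \<eta>(2,3)[of x] \<phi>(2)[of x] by (simp add: mult_le_one)
    qed
    then have "ennreal (integral E (divergence ?\<psi>)) \<le> rel_perimeter U E"
      unfolding rel_perimeter_def by (rule SUP_upper)
    moreover have "integral E (divergence ?\<psi>) = integral E (divergence \<phi>)"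
      by (rule integral_cong) (simp add: divergence_scaleR[OF \<eta>(1) \<phi>(1)] \<eta>(8,9))
    ultimately show "ennreal (integral E (divergence \<phi>)) \<le> rel_perimeter U E" by simp
  qed
  then show ?thesis using that \<eta>(4,5) by blast
qed

lemma rel_perimeter_le_perimeter: "rel_perimeter U E \<le> perimeter E"
  unfolding perimeter_def rel_perimeter_def
  by (rule SUP_subset_mono) (auto simp: test_fields_def)

lemma locally_finite_perimeter_bounded:
  assumes "locally_finite_perimeter E" "bounded E"
  shows "perimeter E < \<infinity>"
proof -
  obtain U where "open U" "bounded U" "perimeter E \<le> rel_perimeter U E"
    by (rule perimeter_le_rel_perimeter[OF assms(2)])
  then show ?thesis using assms(1) by (auto simp: locally_finite_perimeter_def intro: le_less_trans)
qed

text \<open>The partition condition is tested on compact sets only; this supplies one inside any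
  non-null overlap or gap.\<close>

lemma compact_subset_positive_measure:
  fixes Y :: "'a::euclidean_space set"
  assumes Y: "Y \<in> sets lebesgue" "\<not> negligible Y"
  obtains T where "compact T" "T \<subseteq> Y" "measure lebesgue T > 0"
proof -
  have "\<exists>n::nat. \<not> negligible (Y \<inter> cball 0 (real n))"
  proof (rule ccontr)
    assume "\<not> ?thesis"
    then have "negligible (\<Union>n::nat. Y \<inter> cball 0 (real n))" by (intro negligible_Union_nat) auto
    moreover have "Y \<subseteq> (\<Union>n::nat. Y \<inter> cball 0 (real n))"
      using real_arch_simple by fastforce
    ultimately show False using Y(2) negligible_subset by blast
  qed
  then obtain n :: nat where n: "\<not> negligible (Y \<inter> cball 0 (real n))" by blast
  let ?Y = "Y \<inter> cball 0 (real n)"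
  have bY: "bounded ?Y" by (rule bounded_subset[OF bounded_cball]) auto
  have Ys: "?Y \<in> sets lebesgue" using Y by auto
  have Ym: "?Y \<in> lmeasurable" by (rule bounded_set_imp_lmeasurable[OF bY Ys])
  have pos: "measure lebesgue ?Y > 0" unfolding zero_less_measure_iff using n Ym negligible_iff_measure[of ?Y] by blast
  obtain T where T: "closed T" "T \<subseteq> ?Y" "?Y - T \<in> lmeasurable" "emeasure lebesgue (?Y - T) < ennreal (measure lebesgue ?Y)"
    by (rule sets_lebesgue_inner_closed[OF Ys pos])
  have cT: "compact T" using T(1,2) bounded_subset[OF bY] by (simp add: compact_eq_bounded_closed)
  have "measure lebesgue (?Y - T) < measure lebesgue ?Y"
    using T(3,4) by (simp add: emeasure_eq_measure2 ennreal_less_iff)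
  moreover have "measure lebesgue (?Y - T) = measure lebesgue ?Y - measure lebesgue T"
    by (rule measurable_measure_Diff[OF Ym _ T(2)]) (use T(1) in \<open>simp add: borel_closed\<close>)
  ultimately show ?thesis using that[OF cT] T(2) by auto
qed

text \<open>The working class: partitions without the conditions on density and perimeter, stable
  under truncation and under almost everywhere limits that stay in a bounded region.\<close>

definition ae_partition :: "nat \<Rightarrow> (nat \<Rightarrow> 'a::euclidean_space set) \<Rightarrow> bool" where
  "ae_partition N X \<longleftrightarrow> (\<forall>i\<in>{1..N+1}. X i \<in> sets lebesgue) \<and> (\<forall>i\<in>{1..N}. bounded (X i)) \<and>
     (AE x in lebesgue. \<exists>!i. i \<in> {1..N+1} \<and> x \<in> X i)"

text \<open>On a compact set inside an overlap the sum of measures would count twice, and on one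
  inside a gap it would be 0.\<close>

lemma partition_b_imp_ae_partition:
  assumes "partition_b N A"
  shows "ae_partition N A"
proof -
  let ?I = "{1..N+1}"
  have m: "A i \<in> sets lebesgue" if "i \<in> ?I" for i
    using assms that by (auto simp: partition_b_def partition_Np1_def locally_finite_perimeter_def)
  have s: "(\<Sum>i\<in>?I. measure lebesgue (A i \<inter> Q)) = measure lebesgue Q" if "compact Q" for Q
    using assms that by (auto simp: partition_b_def partition_Np1_def)
  have disj: "negligible (A i \<inter> A j)" if ij: "i \<in> ?I" "j \<in> ?I" "i \<noteq> j" for i j
  proof (rule ccontr)
    assume nn: "\<not> negligible (A i \<inter> A j)"
    obtain T where T: "compact T" "T \<subseteq> A i \<inter> A j" "measure lebesgue T > 0"
      by (rule compact_subset_positive_measure[OF sets.Int[OF m[OF ij(1)] m[OF ij(2)]] nn])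
    have "(\<Sum>l\<in>{i, j}. measure lebesgue (A l \<inter> T)) \<le> (\<Sum>l\<in>?I. measure lebesgue (A l \<inter> T))"
      using ij by (intro sum_mono2) auto
    moreover have "A i \<inter> T = T" "A j \<inter> T = T" using T(2) by auto
    ultimately show False using s[OF T(1)] T(3) ij(3) by simp
  qed
  have cov: "negligible (- (\<Union>i\<in>?I. A i))"
  proof (rule ccontr)
    have "(\<Union>i\<in>?I. A i) \<in> sets lebesgue" using m by (intro sets.finite_UN) auto
    then have Um: "- (\<Union>i\<in>?I. A i) \<in> sets lebesgue" by (simp only: Compl_in_sets_lebesgue)
    assume nn: "\<not> negligible (- (\<Union>i\<in>?I. A i))"
    obtain T where T: "compact T" "T \<subseteq> - (\<Union>i\<in>?I. A i)" "measure lebesgue T > 0"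
      by (rule compact_subset_positive_measure[OF Um nn])
    have "A i \<inter> T = {}" if "i \<in> ?I" for i using T(2) that by auto
    then have "(\<Sum>l\<in>?I. measure lebesgue (A l \<inter> T)) = 0" by (intro sum.neutral) simp
    then show False using s[OF T(1)] T(3) by simp
  qed
  have "AE x in lebesgue. i \<noteq> j \<longrightarrow> \<not> (x \<in> A i \<and> x \<in> A j)" if "i \<in> ?I" "j \<in> ?I" for i j
  proof (cases "i = j")
    case False
    have "{x. \<not> (i \<noteq> j \<longrightarrow> \<not> (x \<in> A i \<and> x \<in> A j))} \<subseteq> A i \<inter> A j" by blast
    then show ?thesis unfolding AE_lebesgue_iff_negligible by (rule negligible_subset[OF disj[OF that False]])
  qed simp
  then have d: "AE x in lebesgue. \<forall>i\<in>?I. \<forall>j\<in>?I. i \<noteq> j \<longrightarrow> \<not> (x \<in> A i \<and> x \<in> A j)"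
    by (intro AE_finite_allI) auto
  have "{x. \<not> (\<exists>i\<in>?I. x \<in> A i)} \<subseteq> - (\<Union>i\<in>?I. A i)" by blast
  then have "AE x in lebesgue. \<exists>i\<in>?I. x \<in> A i"
    unfolding AE_lebesgue_iff_negligible by (rule negligible_subset[OF cov])
  with d have "AE x in lebesgue. \<exists>!i. i \<in> ?I \<and> x \<in> A i"
  proof eventually_elim
    case (elim x)
    then obtain i where "i \<in> ?I" "x \<in> A i" by blast
    then show ?case using elim(1) by (intro ex1I[of _ i]) blast+
  qed
  then show ?thesis using assms m by (auto simp: ae_partition_def partition_b_def)
qed

text \<open>By the density theorem the representatives change only on null sets, so perimeters
  persist, and integrating the indicators, which add up to 1 almost everywhere, gives the identity
  on compact sets. Boundedness persists because density-one points lie in the closure.\<close>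

lemma ae_partition_imp_partition_b:
  assumes X: "ae_partition N X" and P: "\<And>i. i \<in> {1..N+1} \<Longrightarrow> perimeter (X i) < \<infinity>"
  shows "partition_b N (\<lambda>i. density_one_points (X i))"
proof -
  let ?I = "{1..N+1}" let ?B = "\<lambda>i. density_one_points (X i)"
  have m: "X i \<in> sets lebesgue" if "i \<in> ?I" for i using X that by (simp add: ae_partition_def)
  have lf: "locally_finite_perimeter (?B i)" if "i \<in> ?I" for i
    unfolding locally_finite_perimeter_def
  proof (intro conjI allI impI)
    show "?B i \<in> sets lebesgue" by (rule density_one_points_sets[OF m[OF that]])
    fix U :: "'a set"
    have "rel_perimeter U (?B i) \<le> perimeter (?B i)" by (rule rel_perimeter_le_perimeter)
    also have "\<dots> = perimeter (X i)" by (rule ae_eq_perimeter[OF Lebesgue_density[OF m[OF that]]])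
    finally show "rel_perimeter U (?B i) < \<infinity>" using P[OF that] by (rule le_less_trans)
  qed
  have sum: "(\<Sum>i\<in>?I. measure lebesgue (?B i \<inter> Q)) = measure lebesgue Q" if Q: "compact Q" for Q
  proof -
    have Qm: "Q \<in> lmeasurable" by (rule lmeasurable_compact[OF Q])
    have XQ: "X i \<inter> Q \<in> lmeasurable" if "i \<in> ?I" for i
      using fmeasurable_Int_fmeasurable[OF Qm m[OF that]] by (simp add: inf_commute)
    have "measure lebesgue (?B i \<inter> Q) = measure lebesgue (X i \<inter> Q)" if "i \<in> ?I" for i
    proof (rule measure_eq_AE)
      show "AE x in lebesgue. x \<in> ?B i \<inter> Q \<longleftrightarrow> x \<in> X i \<inter> Q"
        using Lebesgue_density[OF m[OF that]] by eventually_elim auto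
      show "?B i \<inter> Q \<in> sets lebesgue" "X i \<inter> Q \<in> sets lebesgue"
        using density_one_points_sets[OF m[OF that]] m[OF that] Qm by (auto simp: fmeasurable_def)
    qed
    then have "(\<Sum>i\<in>?I. measure lebesgue (?B i \<inter> Q)) = (\<Sum>i\<in>?I. LINT x|lebesgue. indicator (X i \<inter> Q) x)"
      by (intro sum.cong refl) simp
    also have "\<dots> = (LINT x|lebesgue. (\<Sum>i\<in>?I. indicator (X i \<inter> Q) x))"
      using XQ by (intro Bochner_Integration.integral_sum[symmetric]) (simp add: lmeasurable_iff_integrable[symmetric])
    also have "\<dots> = (LINT x|lebesgue. indicator Q x)"
    proof (rule integral_cong_AE)
      show "(\<lambda>x. \<Sum>i\<in>?I. indicat_real (X i \<inter> Q) x) \<in> borel_measurable lebesgue"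
        using XQ by (intro borel_measurable_sum borel_measurable_indicator) (auto simp: fmeasurable_def)
      show "indicat_real Q \<in> borel_measurable lebesgue"
        using Qm by (intro borel_measurable_indicator) (auto simp: fmeasurable_def)
      have "AE x in lebesgue. \<exists>!i. i \<in> ?I \<and> x \<in> X i" using X by (simp add: ae_partition_def)
      then show "AE x in lebesgue. (\<Sum>i\<in>?I. indicat_real (X i \<inter> Q) x) = indicator Q x"
      proof eventually_elim
        case (elim x)
        then obtain i where i: "i \<in> ?I" "x \<in> X i" "\<And>j. j \<in> ?I \<Longrightarrow> x \<in> X j \<Longrightarrow> j = i" by blast
        have "indicat_real (X j \<inter> Q) x = (if j = i then indicator Q x else 0)" if "j \<in> ?I" for j
        proof (cases "j = i")
          case True
          then show ?thesis using i(2) by (simp add: indicator_def)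
        next
          case False
          then have "x \<notin> X j" using i(3)[OF that] by blast
          then show ?thesis using False by simp
        qed
        then have "(\<Sum>j\<in>?I. indicat_real (X j \<inter> Q) x) = (\<Sum>j\<in>?I. if j = i then indicator Q x else 0)"
          by (rule sum.cong[OF refl])
        also have "\<dots> = indicator Q x" using i(1) by (subst sum.delta) auto
        finally show ?case .
      qed
    qed
    also have "\<dots> = measure lebesgue Q" by simp
    finally show ?thesis .
  qed
  have bd: "bounded (?B i)" if "i \<in> {1..N}" for i
  proof -
    have "bounded (X i)" using X that unfolding ae_partition_def by blast
    then have "bounded (closure (X i))" by (rule bounded_closure)
    moreover have "?B i \<subseteq> closure (X i)"
      by (rule density_one_points_subset_closed) (use closure_subset in auto)
    ultimately show ?thesis by (rule bounded_subset)
  qed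
  show ?thesis unfolding partition_b_def partition_Np1_def
    using lf sum bd density_one_points_idem[OF m] by auto
qed

section \<open>Truncation to the hull\<close>


lemma liminf_add_le_ennreal:
  fixes f g :: "nat \<Rightarrow> ennreal"
  shows "liminf f + liminf g \<le> liminf (\<lambda>n. f n + g n)"
proof -
  let ?F = "\<lambda>f n. INF m\<in>{n..}. (f m :: ennreal)"
  have inc: "incseq (?F f)" for f by (intro incseq_SucI INF_superset_mono) auto
  have "liminf f + liminf g = (SUP n. ?F f n + ?F g n)"
    unfolding liminf_SUP_INF by (rule ennreal_SUP_add[OF inc inc, symmetric])
  also have "\<dots> \<le> (SUP n. ?F (\<lambda>n. f n + g n) n)"
    by (intro SUP_mono' INF_greatest add_mono INF_lower)
  also have "\<dots> = liminf (\<lambda>n. f n + g n)" by (simp add: liminf_SUP_INF)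
  finally show ?thesis .
qed

lemma sum_liminf_le_ennreal:
  fixes f :: "'i \<Rightarrow> nat \<Rightarrow> ennreal"
  assumes "finite I"
  shows "(\<Sum>i\<in>I. liminf (f i)) \<le> liminf (\<lambda>n. \<Sum>i\<in>I. f i n)"
  using assms
proof (induction I rule: finite_induct)
  case (insert j I)
  have "(\<Sum>i\<in>insert j I. liminf (f i)) = liminf (f j) + (\<Sum>i\<in>I. liminf (f i))"
    using insert.hyps by simp
  also have "\<dots> \<le> liminf (f j) + liminf (\<lambda>n. \<Sum>i\<in>I. f i n)" by (rule add_left_mono[OF insert.IH])
  also have "\<dots> \<le> liminf (\<lambda>n. f j n + (\<Sum>i\<in>I. f i n))" by (rule liminf_add_le_ennreal)
  finally show ?case using insert.hyps by simp
qed simp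

lemma liminf_cmult_le_ennreal:
  fixes f :: "nat \<Rightarrow> ennreal"
  shows "c * liminf f \<le> liminf (\<lambda>n. c * f n)"
proof -
  have "c * liminf f = (SUP n. c * (INF m\<in>{n..}. f m))"
    unfolding liminf_SUP_INF by (rule SUP_mult_left_ennreal)
  also have "\<dots> \<le> (SUP n. INF m\<in>{n..}. c * f m)"
    by (intro SUP_mono' INF_greatest mult_left_mono INF_lower) auto
  finally show ?thesis by (simp add: liminf_SUP_INF)
qed

lemma F_energy_cong:
  assumes "\<And>i. i \<in> {1..N+1} \<Longrightarrow> ae_eq (Y i) (X i)" "\<And>i. i \<in> {1..N+1} \<Longrightarrow> X i \<in> sets lebesgue"
    "\<And>i. i \<in> {1..N+1} \<Longrightarrow> A i \<in> sets lebesgue"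
  shows "F_energy N Y A lam = F_energy N X A lam"
proof -
  have "(\<Sum>j=1..N+1. perimeter (Y j)) = (\<Sum>j=1..N+1. perimeter (X j))"
    by (rule sum.cong[OF refl]) (rule ae_eq_perimeter[OF assms(1)])
  moreover have "(\<Sum>j=1..N+1. sigma_bar (Y j) (A j)) = (\<Sum>j=1..N+1. sigma_bar (X j) (A j))"
    by (rule sum.cong[OF refl]) (rule sigma_bar_cong[OF assms(2,3,1)])
  ultimately show ?thesis by (simp only: F_energy_def)
qed

lemma F_energy_lsc:
  assumes X: "\<And>k i. i \<in> {1..N+1} \<Longrightarrow> X k i \<in> sets lebesgue" "\<And>i. i \<in> {1..N+1} \<Longrightarrow> G i \<in> sets lebesgue"
    "\<And>i. i \<in> {1..N+1} \<Longrightarrow> A i \<in> sets lebesgue"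
    and lim: "\<And>i. i \<in> {1..N+1} \<Longrightarrow> ae_tendsto (\<lambda>k. X k i) (G i)"
  shows "F_energy N G A lam \<le> liminf (\<lambda>k. F_energy N (X k) A lam)"
proof -
  let ?I = "{1..N+1}"
  have "(\<Sum>j\<in>?I. perimeter (G j)) \<le> (\<Sum>j\<in>?I. liminf (\<lambda>k. perimeter (X k j)))"
    by (rule sum_mono) (rule perimeter_lsc[OF X(1,2) lim])
  also have "\<dots> \<le> liminf (\<lambda>k. \<Sum>j\<in>?I. perimeter (X k j))" by (rule sum_liminf_le_ennreal) simp
  finally have P: "(\<Sum>j\<in>?I. perimeter (G j)) \<le> liminf (\<lambda>k. \<Sum>j\<in>?I. perimeter (X k j))" .
  have "(\<Sum>j\<in>?I. sigma_bar (G j) (A j)) \<le> (\<Sum>j\<in>?I. liminf (\<lambda>k. sigma_bar (X k j) (A j)))"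
    by (rule sum_mono) (rule sigma_bar_lsc[OF X lim])
  also have "\<dots> \<le> liminf (\<lambda>k. \<Sum>j\<in>?I. sigma_bar (X k j) (A j))" by (rule sum_liminf_le_ennreal) simp
  finally have S: "(\<Sum>j\<in>?I. sigma_bar (G j) (A j)) \<le> liminf (\<lambda>k. \<Sum>j\<in>?I. sigma_bar (X k j) (A j))" .
  have "F_energy N G A lam \<le> ennreal (1/2) * liminf (\<lambda>k. \<Sum>j\<in>?I. perimeter (X k j))
      + ennreal (lam/2) * liminf (\<lambda>k. \<Sum>j\<in>?I. sigma_bar (X k j) (A j))"
    unfolding F_energy_def by (intro add_mono mult_left_mono P S) auto
  also have "\<dots> \<le> liminf (\<lambda>k. ennreal (1/2) * (\<Sum>j\<in>?I. perimeter (X k j)))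
      + liminf (\<lambda>k. ennreal (lam/2) * (\<Sum>j\<in>?I. sigma_bar (X k j) (A j)))"
    by (intro add_mono liminf_cmult_le_ennreal)
  also have "\<dots> \<le> liminf (\<lambda>k. F_energy N (X k) A lam)"
    unfolding F_energy_def by (rule liminf_add_le_ennreal)
  finally show ?thesis .
qed

section \<open>The outer phase and finiteness of the energy\<close>

lemma ae_partition_sets: "ae_partition N X \<Longrightarrow> i \<in> {1..N+1} \<Longrightarrow> X i \<in> sets lebesgue"
  unfolding ae_partition_def by blast

lemma ae_partition_sets_union: "ae_partition N X \<Longrightarrow> (\<Union>i\<in>{1..N}. X i) \<in> sets lebesgue"
  by (intro sets.finite_UN) (auto intro: ae_partition_sets)

lemma ae_partition_last:
  assumes "ae_partition N X"
  shows "ae_eq (X (N+1)) (- (\<Union>i\<in>{1..N}. X i))"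
proof -
  have "AE x in lebesgue. \<exists>!i. i \<in> {1..N+1} \<and> x \<in> X i" using assms unfolding ae_partition_def by blast
  then show ?thesis
  proof eventually_elim
    case (elim x)
    then obtain i where i: "i \<in> {1..N+1}" "x \<in> X i" "\<And>j. j \<in> {1..N+1} \<Longrightarrow> x \<in> X j \<Longrightarrow> j = i" by blast
    show ?case
    proof
      assume "x \<in> X (N+1)"
      then have "N + 1 = i" using i(3)[of "N+1"] by simp
      then have "x \<notin> X j" if "j \<in> {1..N}" for j using i(3)[of j] that by fastforce
      then show "x \<in> - (\<Union>i\<in>{1..N}. X i)" by blast
    next
      assume "x \<in> - (\<Union>i\<in>{1..N}. X i)"
      then have "i \<notin> {1..N}" using i(2) by blast
      then have "i = N + 1" using i(1) by auto
      then show "x \<in> X (N+1)" using i(2) by blast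
    qed
  qed
qed

text \<open>This exchanges the unbounded phase for a bounded set, to which truncation by half-spaces
  applies.\<close>

lemma perimeter_last:
  assumes "ae_partition N X"
  shows "perimeter (X (N+1)) = perimeter (\<Union>i\<in>{1..N}. X i)"
  using ae_eq_perimeter[OF ae_partition_last[OF assms]] perimeter_Compl[OF ae_partition_sets_union[OF assms]]
  by simp

text \<open>Local finiteness does not bound the perimeter of an unbounded set. But the bounded
  phases are disjoint up to null sets, so for each field the integral over their union splits, and
  the perimeter is at most the sum of theirs.\<close>

lemma perimeter_last_finite:
  fixes X :: "nat \<Rightarrow> 'a::euclidean_space set"
  assumes X: "ae_partition N X" and P: "\<And>i. i \<in> {1..N} \<Longrightarrow> perimeter (X i) < \<infinity>"
  shows "perimeter (X (N+1)) < \<infinity>"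
proof -
  let ?U = "\<Union>i\<in>{1..N}. X i"
  have Um: "?U \<in> sets lebesgue" by (rule ae_partition_sets_union[OF X])
  have Xm: "X i \<in> sets lebesgue" if "i \<in> {1..N}" for i using ae_partition_sets[OF X] that by simp
  have uniq: "AE x in lebesgue. \<exists>!i. i \<in> {1..N+1} \<and> x \<in> X i" using X unfolding ae_partition_def by blast
  have "perimeter ?U \<le> ennreal (\<Sum>i\<in>{1..N}. enn2real (perimeter (X i)))"
    unfolding perimeter_def[of ?U] rel_perimeter_def
  proof (rule SUP_least)
    fix \<phi> :: "'a \<Rightarrow> 'a" assume \<phi>: "\<phi> \<in> test_fields UNIV"
    let ?g = "divergence \<phi>"
    have g: "integrable lebesgue ?g" using \<phi> by (auto simp: test_fields_iff intro!: integrable_divergence)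
    have "integral ?U ?g = (LINT x|lebesgue. indicator ?U x * ?g x)" by (rule integral_eq_lebesgue[OF g Um])
    also have "\<dots> = (LINT x|lebesgue. (\<Sum>i\<in>{1..N}. indicator (X i) x * ?g x))"
    proof (rule integral_cong_AE)
      show "(\<lambda>x. indicator ?U x * ?g x) \<in> borel_measurable lebesgue"
        by (rule borel_measurable_integrable[OF integrable_indicator_times[OF g Um]])
      show "(\<lambda>x. \<Sum>i\<in>{1..N}. indicator (X i) x * ?g x) \<in> borel_measurable lebesgue"
        by (intro borel_measurable_sum borel_measurable_integrable integrable_indicator_times[OF g] Xm)
      from uniq show "AE x in lebesgue. indicator ?U x * ?g x = (\<Sum>i\<in>{1..N}. indicator (X i) x * ?g x)"
      proof eventually_elim
        case (elim x)
        then obtain i where i: "i \<in> {1..N+1}" "x \<in> X i" "\<And>j. j \<in> {1..N+1} \<Longrightarrow> x \<in> X j \<Longrightarrow> j = i" by blast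
        have "indicat_real (X j) x * ?g x = (if j = i then ?g x else 0)" if "j \<in> {1..N}" for j
        proof (cases "j = i")
          case True
          then show ?thesis using i(2) by simp
        next
          case False
          then have "x \<notin> X j" using i(3)[of j] that by fastforce
          then show ?thesis using False by simp
        qed
        then have "(\<Sum>j\<in>{1..N}. indicat_real (X j) x * ?g x) = (\<Sum>j\<in>{1..N}. if j = i then ?g x else 0)"
          by (rule sum.cong[OF refl])
        also have "\<dots> = (if i \<in> {1..N} then ?g x else 0)" by (subst sum.delta) auto
        also have "\<dots> = indicator ?U x * ?g x"
        proof (cases "i \<in> {1..N}")
          case True
          then have "x \<in> ?U" using i(2) by blast
          then show ?thesis using True by simp
        next
          case False
          have xU: "x \<notin> ?U"
          proof
            assume "x \<in> ?U"
            then obtain j where j: "j \<in> {1..N}" "x \<in> X j" by blast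
            then have "j = i" by (intro i(3)) auto
            then show False using False j(1) by blast
          qed
          show ?thesis unfolding indicator_simps(2)[OF xU] if_not_P[OF False] by simp
        qed
        finally show ?case by (rule sym)
      qed
    qed
    also have "\<dots> = (\<Sum>i\<in>{1..N}. LINT x|lebesgue. indicator (X i) x * ?g x)"
      by (intro Bochner_Integration.integral_sum integrable_indicator_times[OF g] Xm)
    also have "\<dots> = (\<Sum>i\<in>{1..N}. integral (X i) ?g)"
      by (intro sum.cong refl integral_eq_lebesgue[OF g, symmetric] Xm)
    also have "\<dots> \<le> (\<Sum>i\<in>{1..N}. enn2real (perimeter (X i)))"
    proof (rule sum_mono)
      fix i assume i: "i \<in> {1..N}"
      have "ennreal (integral (X i) ?g) \<le> perimeter (X i)"
        unfolding perimeter_def rel_perimeter_def by (rule SUP_upper[OF \<phi>])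
      also have "\<dots> = ennreal (enn2real (perimeter (X i)))" using P[OF i] by simp
      finally show "integral (X i) ?g \<le> enn2real (perimeter (X i))" by (simp add: ennreal_le_iff)
    qed
    finally show "ennreal (integral ?U ?g) \<le> ennreal (\<Sum>i\<in>{1..N}. enn2real (perimeter (X i)))"
      by (rule ennreal_leI)
  qed
  then have "perimeter ?U < \<infinity>" by (rule le_less_trans) simp
  then show ?thesis by (simp only: perimeter_last[OF X])
qed

text \<open>\<open>A\<close> competes against itself with vanishing distance terms; this makes the
  infimum finite.\<close>

lemma F_energy_self_finite:
  assumes "partition_b N A"
  shows "F_energy N A A lam < \<infinity>"
proof -
  have X: "ae_partition N A" by (rule partition_b_imp_ae_partition[OF assms])
  have P: "perimeter (A i) < \<infinity>" if "i \<in> {1..N}" for i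
  proof (rule locally_finite_perimeter_bounded)
    show "bounded (A i)" using X that unfolding ae_partition_def by blast
    show "locally_finite_perimeter (A i)"
      using assms that unfolding partition_b_def partition_Np1_def by simp
  qed
  have "perimeter (A i) < \<infinity>" if "i \<in> {1..N+1}" for i
  proof (cases "i = N + 1")
    case True
    then show ?thesis using perimeter_last_finite[OF X P] by simp
  next
    case False
    then show ?thesis using P that by simp
  qed
  then have fin: "(\<Sum>j=1..N+1. perimeter (A j)) < \<infinity>" by (simp only: ennreal_sum_less_top infinity_ennreal_def finite_atLeastAtMost) blast
  have "sigma_bar (A j) (A j) = 0" for j by (simp add: sigma_bar_def)
  then have "F_energy N A A lam = ennreal (1/2) * (\<Sum>j=1..N+1. perimeter (A j))" unfolding F_energy_def by simp
  also have "\<dots> < \<infinity>" using fin ennreal_less_top[of "1/2"] unfolding infinity_ennreal_def ennreal_mult_less_top by blast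
  finally show ?thesis .
qed

lemma F_energy_finite_perimeter:
  assumes "F_energy N X A lam \<le> ennreal c" "i \<in> {1..N+1}" "c \<ge> 0"
  shows "perimeter (X i) \<le> ennreal (2 * c)"
proof -
  have "perimeter (X i) \<le> (\<Sum>j=1..N+1. perimeter (X j))"
    using assms(2) by (intro member_le_sum) auto
  also have "\<dots> = ennreal 2 * (ennreal (1/2) * (\<Sum>j=1..N+1. perimeter (X j)))"
  proof -
    have "ennreal 2 * ennreal (1/2) = 1" by (subst ennreal_mult[symmetric]) simp_all
    then show ?thesis by (simp only: mult.assoc[symmetric] mult_1)
  qed
  also have "\<dots> \<le> ennreal 2 * F_energy N X A lam"
    unfolding F_energy_def by (intro mult_left_mono) auto
  also have "\<dots> \<le> ennreal 2 * ennreal c" by (intro mult_left_mono assms(1)) simp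
  also have "\<dots> = ennreal (2 * c)" using assms(3) by (simp only: ennreal_mult zero_le_numeral)
  finally show ?thesis .
qed

lemma F_energy_finite_sigma_bar:
  assumes "F_energy N X A lam < \<infinity>" "i \<in> {1..N+1}" "lam > 0"
  shows "sigma_bar (X i) (A i) < \<infinity>"
proof -
  have "ennreal (lam/2) * (\<Sum>j=1..N+1. sigma_bar (X j) (A j)) \<le> F_energy N X A lam"
    unfolding F_energy_def by simp
  then have "ennreal (lam/2) * (\<Sum>j=1..N+1. sigma_bar (X j) (A j)) < \<infinity>"
    using assms(1) by (rule le_less_trans)
  moreover have "ennreal (lam/2) \<noteq> 0" using assms(3) by simp
  ultimately have "(\<Sum>j=1..N+1. sigma_bar (X j) (A j)) < \<infinity>"
    by (simp only: ennreal_mult_less_top infinity_ennreal_def) auto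
  moreover have "sigma_bar (X i) (A i) \<le> (\<Sum>j=1..N+1. sigma_bar (X j) (A j))"
    using assms(2) by (intro member_le_sum) auto
  ultimately show ?thesis by (rule le_less_trans[rotated])
qed

text \<open>Whatever the bounded phases lose outside \<open>K\<close> is handed to the outer phase,
  so the covering property is kept.\<close>

definition truncate_partition :: "nat \<Rightarrow> 'a set \<Rightarrow> (nat \<Rightarrow> 'a::euclidean_space set) \<Rightarrow> nat \<Rightarrow> 'a set" where
  "truncate_partition N K X i = (if i \<le> N then X i \<inter> K else X i \<union> - K)"

lemma ae_partition_truncate:
  assumes X: "ae_partition N X" and K: "closed K"
  shows "ae_partition N (truncate_partition N K X)"
  unfolding ae_partition_def
proof (intro conjI ballI)
  have Km: "K \<in> sets lebesgue" "- K \<in> sets lebesgue" using K by (auto simp: borel_closed Compl_in_sets_lebesgue)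
  show "truncate_partition N K X i \<in> sets lebesgue" if "i \<in> {1..N+1}" for i
    using ae_partition_sets[OF X that] Km by (simp add: truncate_partition_def)
  show "bounded (truncate_partition N K X i)" if "i \<in> {1..N}" for i
  proof -
    have "bounded (X i)" using X that unfolding ae_partition_def by blast
    then show ?thesis using that by (simp add: truncate_partition_def bounded_Int)
  qed
  have "AE x in lebesgue. \<exists>!i. i \<in> {1..N+1} \<and> x \<in> X i" using X unfolding ae_partition_def by blast
  then show "AE x in lebesgue. \<exists>!i. i \<in> {1..N+1} \<and> x \<in> truncate_partition N K X i"
  proof eventually_elim
    case (elim x)
    show ?case
    proof (cases "x \<in> K")
      case True
      then have "x \<in> truncate_partition N K X i \<longleftrightarrow> x \<in> X i" for i by (simp add: truncate_partition_def)
      then show ?thesis using elim by simp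
    next
      case False
      then have "x \<in> truncate_partition N K X i \<longleftrightarrow> \<not> i \<le> N" for i by (simp add: truncate_partition_def)
      then show ?thesis by (intro ex1I[of _ "N+1"]) auto
    qed
  qed
qed

text \<open>Bounded phases are cut by a convex set. The truncated outer phase has the perimeter of
  the union of the truncated phases, which is the old union cut by \<open>K\<close>.\<close>

lemma perimeter_truncate:
  assumes X: "ae_partition N X" and K: "closed K" "convex K" and i: "i \<in> {1..N+1}"
  shows "perimeter (truncate_partition N K X i) \<le> perimeter (X i)"
proof (cases "i \<le> N")
  case True
  then have "bounded (X i)" using X i unfolding ae_partition_def by simp
  then show ?thesis
    using True perimeter_Int_closed_convex[OF ae_partition_sets[OF X i] _ K] by (simp add: truncate_partition_def)
next
  case False
  then have i: "i = N + 1" using i by simp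
  let ?U = "\<Union>i\<in>{1..N}. X i"
  have T: "ae_partition N (truncate_partition N K X)" by (rule ae_partition_truncate[OF X K(1)])
  have "perimeter (truncate_partition N K X (N+1)) = perimeter (\<Union>i\<in>{1..N}. truncate_partition N K X i)"
    by (rule perimeter_last[OF T])
  also have "(\<Union>i\<in>{1..N}. truncate_partition N K X i) = ?U \<inter> K"
    by (auto simp: truncate_partition_def)
  also have "perimeter (?U \<inter> K) \<le> perimeter ?U"
  proof (rule perimeter_Int_closed_convex[OF ae_partition_sets_union[OF X] _ K])
    show "bounded ?U" using X unfolding ae_partition_def by (intro bounded_UN) auto
  qed
  also have "perimeter ?U = perimeter (X (N+1))" by (rule perimeter_last[OF X, symmetric])
  finally show ?thesis using i by simp
qed

text \<open>A lower bound for what truncation gains in the distance term of phase \<open>i\<close>.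
  It is set to 0 where no quantified gain is claimed: for the outer phase and for phases with empty
  frontier.\<close>

definition outer_excess :: "nat \<Rightarrow> 'a set \<Rightarrow> (nat \<Rightarrow> 'a::euclidean_space set) \<Rightarrow> (nat \<Rightarrow> 'a set) \<Rightarrow> nat \<Rightarrow> ennreal" where
  "outer_excess N K X A i = (if i \<le> N \<and> frontier (A i) \<noteq> {}
     then (\<integral>\<^sup>+ x. indicator (X i - K) x * ennreal (infdist x (frontier (A i))) \<partial>lebesgue) else 0)"

text \<open>The gap estimate handles bounded phases with a frontier, and monotonicity the rest. For
  the outer phase, almost every point outside \<open>K\<close> belongs to \<open>A (N+1)\<close>, so
  adding these points only shrinks the symmetric difference.\<close>

lemma sigma_bar_truncate:
  assumes X: "ae_partition N X" and A: "ae_partition N A" and K: "closed K"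
    and AK: "\<And>i. i \<in> {1..N} \<Longrightarrow> A i \<subseteq> K" and i: "i \<in> {1..N+1}"
  shows "sigma_bar (truncate_partition N K X i) (A i) + outer_excess N K X A i \<le> sigma_bar (X i) (A i)"
proof (cases "i \<le> N \<and> frontier (A i) \<noteq> {}")
  case True
  have Km: "K \<in> sets lebesgue" using K by (simp add: borel_closed)
  have "A i \<subseteq> K" using AK True i by simp
  then show ?thesis
    using sigma_bar_Int_gap[OF ae_partition_sets[OF X i] ae_partition_sets[OF A i] Km] True
    by (simp add: truncate_partition_def outer_excess_def)
next
  case False
  have T: "ae_partition N (truncate_partition N K X)" by (rule ae_partition_truncate[OF X K])
  have "AE x in lebesgue. x \<in> sym_diff (truncate_partition N K X i) (A i) \<longrightarrow> x \<in> sym_diff (X i) (A i)"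
  proof (cases "i \<le> N")
    case True
    then have "A i \<subseteq> K" using AK i by simp
    then have "sym_diff (truncate_partition N K X i) (A i) \<subseteq> sym_diff (X i) (A i)"
      using True by (auto simp: truncate_partition_def)
    then show ?thesis by (intro AE_I2) blast
  next
    case False
    then have iN: "i = N + 1" using i by simp
    have "ae_eq (A i) (- (\<Union>i\<in>{1..N}. A i))" unfolding iN by (rule ae_partition_last[OF A])
    then show ?thesis
    proof eventually_elim
      case (elim x)
      have "x \<in> A i" if "x \<notin> K" using elim AK that by blast
      then show ?case using False by (auto simp: truncate_partition_def)
    qed
  qed
  then have "sigma_bar (truncate_partition N K X i) (A i) \<le> sigma_bar (X i) (A i)"
    by (rule sigma_bar_mono[OF ae_partition_sets[OF X i] ae_partition_sets[OF T i] ae_partition_sets[OF A i]])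
  moreover have "outer_excess N K X A i = 0" using False unfolding outer_excess_def by (simp only: if_False)
  ultimately show ?thesis by simp
qed

text \<open>Used twice: existence discards the excess, and the hull inclusion shows that it vanishes
  for a minimizer.\<close>

lemma F_energy_truncate:
  assumes X: "ae_partition N X" and A: "ae_partition N A" and K: "closed K" "convex K"
    and AK: "\<And>i. i \<in> {1..N} \<Longrightarrow> A i \<subseteq> K"
  shows "F_energy N (truncate_partition N K X) A lam + ennreal (lam/2) * (\<Sum>j=1..N+1. outer_excess N K X A j)
    \<le> F_energy N X A lam"
proof -
  let ?T = "truncate_partition N K X"
  have "F_energy N ?T A lam + ennreal (lam/2) * (\<Sum>j=1..N+1. outer_excess N K X A j)
    = ennreal (1/2) * (\<Sum>j=1..N+1. perimeter (?T j))
      + ennreal (lam/2) * (\<Sum>j=1..N+1. sigma_bar (?T j) (A j) + outer_excess N K X A j)"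
    unfolding F_energy_def by (simp only: sum.distrib distrib_left add.assoc)
  also have "\<dots> \<le> F_energy N X A lam"
    unfolding F_energy_def
    by (intro add_mono mult_left_mono sum_mono perimeter_truncate[OF X K] sigma_bar_truncate[OF X A K(1) AK]) auto
  finally show ?thesis .
qed

section \<open>Minimizers\<close>


lemma partition_hull_props:
  assumes "partition_b N A"
  shows "closed (partition_hull N A)" "convex (partition_hull N A)" "bounded (partition_hull N A)"
    "\<And>i. i \<in> {1..N} \<Longrightarrow> A i \<subseteq> partition_hull N A"
proof -
  have "bounded (\<Union>j\<in>{1..N}. A j)" using assms unfolding partition_b_def by (intro bounded_UN) auto
  then show "bounded (partition_hull N A)"
    unfolding partition_hull_def by (intro bounded_closure bounded_convex_hull)
  show "closed (partition_hull N A)" "convex (partition_hull N A)"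
    unfolding partition_hull_def by (simp_all add: convex_closure)
  show "A i \<subseteq> partition_hull N A" if "i \<in> {1..N}" for i
  proof -
    have "A i \<subseteq> (\<Union>j\<in>{1..N}. A j)" using that by blast
    also have "\<dots> \<subseteq> convex hull (\<Union>j\<in>{1..N}. A j)" by (rule hull_subset)
    also have "\<dots> \<subseteq> partition_hull N A" unfolding partition_hull_def by (rule closure_subset)
    finally show ?thesis .
  qed
qed

text \<open>Finite energy bounds all perimeters, which is what the density-one representatives need
  to be admissible.\<close>

lemma ae_partition_energy_realised:
  assumes X: "ae_partition N X" and A: "ae_partition N A" and fin: "F_energy N X A lam < \<infinity>"
  obtains B where "partition_b N B" "F_energy N B A lam = F_energy N X A lam"
proof -
  define c where "c = enn2real (F_energy N X A lam)"
  have c: "F_energy N X A lam \<le> ennreal c" "c \<ge> 0" using fin by (simp_all add: c_def)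
  have P: "perimeter (X i) < \<infinity>" if "i \<in> {1..N+1}" for i
    using F_energy_finite_perimeter[OF c(1) that c(2)] by (rule le_less_trans) simp
  have "F_energy N (\<lambda>i. density_one_points (X i)) A lam = F_energy N X A lam"
    by (rule F_energy_cong) (auto intro!: Lebesgue_density ae_partition_sets[OF X] ae_partition_sets[OF A])
  then show ?thesis using that[OF ae_partition_imp_partition_b[OF X P]] by blast
qed

text \<open>Compactness covers only the bounded phases; the outer limit is forced as their
  complement. At almost every point all finitely many memberships agree with those of one
  \<open>X k\<close>, so uniqueness of the index carries over.\<close>

lemma ae_partition_limit:
  assumes X: "\<And>k. ae_partition N (X k)" and S: "bounded S"
    and G: "\<And>i. i \<in> {1..N} \<Longrightarrow> G i \<in> sets lebesgue" "\<And>i. i \<in> {1..N} \<Longrightarrow> G i \<subseteq> S"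
      "\<And>i. i \<in> {1..N} \<Longrightarrow> ae_tendsto (\<lambda>k. X k i) (G i)"
    and last: "G (N+1) = - (\<Union>i\<in>{1..N}. G i)"
  shows "ae_partition N G" "\<And>i. i \<in> {1..N+1} \<Longrightarrow> ae_tendsto (\<lambda>k. X k i) (G i)"
proof -
  have all: "AE x in lebesgue. \<forall>i\<in>{1..N}. \<forall>\<^sub>F k in sequentially. x \<in> X k i \<longleftrightarrow> x \<in> G i"
    by (rule AE_finite_allI[OF finite_atLeastAtMost]) (rule G(3))
  have "AE x in lebesgue. \<forall>k. x \<in> X k (N+1) \<longleftrightarrow> x \<in> - (\<Union>i\<in>{1..N}. X k i)"
    unfolding AE_all_countable using ae_partition_last[OF X] by blast
  with all have lastlim: "ae_tendsto (\<lambda>k. X k (N+1)) (G (N+1))"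
  proof eventually_elim
    case (elim x)
    have "\<forall>\<^sub>F k in sequentially. \<forall>i\<in>{1..N}. x \<in> X k i \<longleftrightarrow> x \<in> G i"
      using elim(1) by (intro eventually_ball_finite) auto
    then show ?case
    proof eventually_elim
      case (elim k)
      have "x \<in> X k (N+1) \<longleftrightarrow> x \<notin> (\<Union>i\<in>{1..N}. X k i)"
        using \<open>\<forall>k. x \<in> X k (N+1) \<longleftrightarrow> x \<in> - (\<Union>i\<in>{1..N}. X k i)\<close> by blast
      also have "\<dots> \<longleftrightarrow> x \<notin> (\<Union>i\<in>{1..N}. G i)" using elim by blast
      finally show ?case unfolding last by blast
    qed
  qed
  show lim: "ae_tendsto (\<lambda>k. X k i) (G i)" if "i \<in> {1..N+1}" for i
  proof (cases "i = N + 1")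
    case True then show ?thesis using lastlim by simp
  next
    case False then show ?thesis using that by (intro G(3)) auto
  qed
  show "ae_partition N G"
    unfolding ae_partition_def
  proof (intro conjI ballI)
    have U: "(\<Union>i\<in>{1..N}. G i) \<in> sets lebesgue" by (intro sets.finite_UN G(1)) auto
    show "G i \<in> sets lebesgue" if "i \<in> {1..N+1}" for i
    proof (cases "i = N + 1")
      case True then show ?thesis using U last by (simp only: Compl_in_sets_lebesgue)
    next
      case False then show ?thesis using that by (intro G(1)) auto
    qed
    show "bounded (G i)" if "i \<in> {1..N}" for i by (rule bounded_subset[OF S G(2)[OF that]])
    have u: "AE x in lebesgue. \<forall>k. \<exists>!i. i \<in> {1..N+1} \<and> x \<in> X k i"
      unfolding AE_all_countable using X unfolding ae_partition_def by blast
    have "AE x in lebesgue. \<forall>i\<in>{1..N+1}. \<forall>\<^sub>F k in sequentially. x \<in> X k i \<longleftrightarrow> x \<in> G i"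
      by (rule AE_finite_allI[OF finite_atLeastAtMost]) (rule lim)
    with u show "AE x in lebesgue. \<exists>!i. i \<in> {1..N+1} \<and> x \<in> G i"
    proof eventually_elim
      case (elim x)
      have "\<forall>\<^sub>F k in sequentially. \<forall>i\<in>{1..N+1}. x \<in> X k i \<longleftrightarrow> x \<in> G i"
        using elim(2) by (intro eventually_ball_finite) auto
      then obtain k where k: "\<forall>i\<in>{1..N+1}. x \<in> X k i \<longleftrightarrow> x \<in> G i"
        using eventually_happens'[OF sequentially_bot] by blast
      have "\<exists>!i. i \<in> {1..N+1} \<and> x \<in> X k i" using elim(1) by blast
      moreover have "i \<in> {1..N+1} \<and> x \<in> X k i \<longleftrightarrow> i \<in> {1..N+1} \<and> x \<in> G i" for i using k by blast
      ultimately show ?case by simp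
    qed
  qed
qed

lemma F_energy_minimizer_exists:
  fixes A :: "nat \<Rightarrow> 'a::euclidean_space set"
  assumes A: "partition_b N A"
  shows "\<exists>B. partition_b N B \<and> (\<forall>B'. partition_b N B' \<longrightarrow> F_energy N B A lam \<le> F_energy N B' A lam)"
proof -
  let ?F = "\<lambda>X. F_energy N X A lam"
  let ?K = "partition_hull N A"
  note K = partition_hull_props[OF A]
  have Aae: "ae_partition N A" by (rule partition_b_imp_ae_partition[OF A])
  define m where "m = (INF B\<in>Collect (partition_b N). ?F B)"
  have mle: "m \<le> ?F B" if "partition_b N B" for B unfolding m_def using that by (intro INF_lower) simp
  have mfin: "m < \<infinity>" using mle[OF A] F_energy_self_finite[OF A, of lam] by (rule le_less_trans)
  have "\<exists>B. partition_b N B \<and> ?F B < m + ennreal (1 / real (Suc k))" for k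
  proof -
    have "m + 0 < m + ennreal (1 / real (Suc k))"
      unfolding ennreal_add_left_cancel_less using mfin by simp
    then have "m < m + ennreal (1 / real (Suc k))" by simp
    then show ?thesis unfolding m_def INF_less_iff by auto
  qed
  then obtain B where B: "\<And>k. partition_b N (B k)" "\<And>k. ?F (B k) < m + ennreal (1 / real (Suc k))" by metis
  define X where "X = (\<lambda>k. truncate_partition N ?K (B k))"
  have Xp: "ae_partition N (X k)" for k
    unfolding X_def by (rule ae_partition_truncate[OF partition_b_imp_ae_partition[OF B(1)] K(1)])
  have XF: "?F (X k) \<le> m + ennreal (1 / real (Suc k))" for k
  proof -
    have "?F (X k) \<le> ?F (X k) + ennreal (lam/2) * (\<Sum>j=1..N+1. outer_excess N ?K (B k) A j)" by simp
    also have "\<dots> \<le> ?F (B k)"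
      unfolding X_def by (rule F_energy_truncate[OF partition_b_imp_ae_partition[OF B(1)] Aae K(1,2,4)])
    finally show ?thesis using B(2)[of k] by (meson less_imp_le order_trans)
  qed
  \<comment> \<open>The slack \<open>1 / Suc k\<close> is at most 1, so one constant bounds the
    energies, and hence the perimeters, along the whole sequence.\<close>
  define c where "c = enn2real m + 1"
  have c: "c \<ge> 0" by (simp add: c_def)
  have XFc: "?F (X k) \<le> ennreal c" for k
  proof -
    have "m + ennreal (1 / real (Suc k)) \<le> ennreal (enn2real m) + ennreal 1"
      using mfin by (intro add_mono ennreal_leI) simp_all
    also have "\<dots> = ennreal c" unfolding c_def by (rule ennreal_plus[symmetric]) auto
    finally show ?thesis using XF[of k] by (rule order_trans[rotated])
  qed
  have E: "X k i \<in> sets lebesgue" "X k i \<subseteq> ?K" "perimeter (X k i) \<le> ennreal (2 * c)" if "i \<in> {1..N}" for k i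
  proof -
    have i: "i \<in> {1..N+1}" using that by simp
    show "X k i \<in> sets lebesgue" by (rule ae_partition_sets[OF Xp i])
    show "X k i \<subseteq> ?K" using that by (simp add: X_def truncate_partition_def)
    show "perimeter (X k i) \<le> ennreal (2 * c)" by (rule F_energy_finite_perimeter[OF XFc i c])
  qed
  have "\<exists>r G. strict_mono r \<and> (\<forall>i\<in>{1..N}. G i \<in> sets lebesgue \<and> G i \<subseteq> ?K \<and> ae_tendsto (\<lambda>k. X (r k) i) (G i))"
    by (rule finite_perimeter_compact_family[OF finite_atLeastAtMost E(1,2) K(3) E(3)]) (use c in auto)
  then obtain r G where r: "strict_mono (r :: nat \<Rightarrow> nat)"
    and G: "\<forall>i\<in>{1..N}. G i \<in> sets lebesgue \<and> G i \<subseteq> ?K \<and> ae_tendsto (\<lambda>k. X (r k) i) (G i)"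
    by (elim exE conjE) (rule that)
  \<comment> \<open>The compactness lemma says nothing about index \<open>N + 1\<close>; the value
    there is overwritten by the complement.\<close>
  define H where "H = G(N + 1 := - (\<Union>i\<in>{1..N}. G i))"
  have HG: "H i = G i" if "i \<in> {1..N}" for i using that by (simp add: H_def)
  have H: "H i \<in> sets lebesgue" "H i \<subseteq> ?K" "ae_tendsto (\<lambda>k. X (r k) i) (H i)" if "i \<in> {1..N}" for i
    unfolding HG[OF that] using G that by blast+
  have last: "H (N+1) = - (\<Union>i\<in>{1..N}. H i)" using HG by (simp add: H_def)
  note lim = ae_partition_limit[of N "\<lambda>k. X (r k)", OF Xp K(3) H last]
  have "?F H \<le> liminf (\<lambda>k. ?F (X (r k)))"
    by (rule F_energy_lsc[OF ae_partition_sets[OF Xp] ae_partition_sets[OF lim(1)] ae_partition_sets[OF Aae] lim(2)])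
  also have "\<dots> \<le> liminf (\<lambda>k. m + ennreal (1 / real (Suc (r k))))"
    by (intro Liminf_mono always_eventually allI XF)
  also have "\<dots> = m"
  proof (rule lim_imp_Liminf[OF sequentially_bot])
    have "(\<lambda>k. 1 / real (Suc (r k))) \<longlonglongrightarrow> 0"
      using LIMSEQ_subseq_LIMSEQ[OF LIMSEQ_inverse_real_of_nat r] by (simp add: o_def inverse_eq_divide)
    then have "(\<lambda>k. m + ennreal (1 / real (Suc (r k)))) \<longlonglongrightarrow> m + ennreal 0"
      by (intro tendsto_add tendsto_const tendsto_ennrealI)
    then show "(\<lambda>k. m + ennreal (1 / real (Suc (r k)))) \<longlonglongrightarrow> m" by simp
  qed
  finally have Hm: "?F H \<le> m" .
  then have Hfin: "?F H < \<infinity>" using mfin by (rule le_less_trans)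
  obtain B where "partition_b N B" "?F B = ?F H"
    by (rule ae_partition_energy_realised[OF lim(1) Aae Hfin])
  then show ?thesis using Hm mle by (metis order_trans)
qed

lemma minimizer_subset_hull:
  fixes A :: "nat \<Rightarrow> 'a::euclidean_space set"
  assumes A: "partition_b N A" and lam: "lam > 0" and B: "partition_b N B"
    and min: "\<And>B'. partition_b N B' \<Longrightarrow> F_energy N B A lam \<le> F_energy N B' A lam"
    and i: "i \<in> {1..N}"
  shows "B i \<subseteq> partition_hull N A"
proof -
  let ?F = "\<lambda>X. F_energy N X A lam"
  let ?K = "partition_hull N A"
  let ?T = "truncate_partition N ?K B"
  define D where "D = (\<Sum>j=1..N+1. outer_excess N ?K B A j)"
  note K = partition_hull_props[OF A]
  have Aae: "ae_partition N A" by (rule partition_b_imp_ae_partition[OF A])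
  have Bae: "ae_partition N B" by (rule partition_b_imp_ae_partition[OF B])
  have i1: "i \<in> {1..N+1}" using i by simp
  have Km: "?K \<in> sets lebesgue" using K(1) by (simp add: borel_closed)
  \<comment> \<open>Finiteness matters twice: it permits cancellation in \<open>ennreal\<close>
    below, and it excludes the value infinity of \<open>sigma_bar\<close>.\<close>
  have BF: "?F B < \<infinity>" using min[OF A] F_energy_self_finite[OF A] by (rule le_less_trans)
  have cut: "?F ?T + ennreal (lam/2) * D \<le> ?F B" unfolding D_def by (rule F_energy_truncate[OF Bae Aae K(1,2,4)])
  have "?F ?T \<le> ?F ?T + ennreal (lam/2) * D" by simp
  then have TF: "?F ?T < \<infinity>" using cut BF by (meson le_less_trans order_trans)
  obtain B' where B': "partition_b N B'" "?F B' = ?F ?T"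
    by (rule ae_partition_energy_realised[OF ae_partition_truncate[OF Bae K(1)] Aae TF])
  have "?F ?T + ennreal (lam/2) * D \<le> ?F ?T + 0"
    using order_trans[OF cut min[OF B'(1)]] unfolding B'(2) add_0_right .
  then have "ennreal (lam/2) * D \<le> 0" unfolding ennreal_add_left_cancel_le using TF by auto
  moreover have "ennreal (lam/2) > 0" using lam by simp
  ultimately have "D = 0" by simp
  then have ex: "outer_excess N ?K B A i = 0" using i1 unfolding D_def by (subst (asm) sum_eq_0_iff) auto
  have "AE x in lebesgue. x \<in> B i \<longrightarrow> x \<in> ?K"
  proof (cases "frontier (A i) = {}")
    case True
    \<comment> \<open>With an empty frontier a finite value is possible only if \<open>B i\<close>
      and \<open>A i\<close> differ by a null set, and \<open>A i\<close> lies in the hull.\<close>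
    have "sigma_bar (B i) (A i) < \<infinity>" by (rule F_energy_finite_sigma_bar[OF BF i1 lam])
    then have "emeasure lebesgue (sym_diff (B i) (A i)) = 0"
      using True unfolding sigma_bar_def by (auto split: if_splits)
    then have "AE x in lebesgue. x \<notin> sym_diff (B i) (A i)"
      using ae_partition_sets[OF Aae i1] ae_partition_sets[OF Bae i1] by (subst emeasure_eq_0_iff_AE[symmetric]) auto
    then show ?thesis by eventually_elim (use K(4)[OF i] in blast)
  next
    case False
    have "(\<integral>\<^sup>+ x. indicator (B i - ?K) x * ennreal (infdist x (frontier (A i))) \<partial>lebesgue) = 0"
      using ex i False unfolding outer_excess_def by simp
    moreover have "(\<lambda>x. indicator (B i - ?K) x * ennreal (infdist x (frontier (A i)))) \<in> borel_measurable lebesgue"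
      by (rule measurable_indicator_infdist) (use ae_partition_sets[OF Bae i1] Km in auto)
    ultimately have "AE x in lebesgue. indicator (B i - ?K) x * ennreal (infdist x (frontier (A i))) = 0"
      by (subst (asm) nn_integral_0_iff_AE)
    then show ?thesis
    proof eventually_elim
      case (elim x)
      show ?case
      proof (rule impI, rule ccontr)
        assume x: "x \<in> B i" "x \<notin> ?K"
        \<comment> \<open>The frontier lies in the closed hull, so the distance to it is positive at
          every point outside; a vanishing integral then leaves only a null set there.\<close>
        have "frontier (A i) \<subseteq> closure (A i)" by (auto simp: frontier_def)
        also have "\<dots> \<subseteq> ?K" by (rule closure_minimal[OF K(4)[OF i] K(1)])
        finally have "x \<notin> frontier (A i)" using x(2) by blast
        then have "infdist x (frontier (A i)) > 0"
          using infdist_pos_not_in_closed[OF frontier_closed False] by blast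
        moreover have "x \<in> B i - ?K" using x by blast
        ultimately show False using elim by simp
      qed
    qed
  qed
  \<comment> \<open>The normalisation of \<open>B i\<close> turns inclusion almost everywhere into
    inclusion at every point.\<close>
  then have "density_one_points (B i) \<subseteq> ?K" by (rule density_one_points_subset_closed[OF K(1)])
  moreover have "B i = density_one_points (B i)"
    using B i1 unfolding partition_b_def partition_Np1_def by blast
  ultimately show ?thesis by simp
qed

theorem theorem4p2:
  fixes N :: nat and A :: "nat \<Rightarrow> 'a::euclidean_space set" and lam :: real
  assumes "N \<ge> 1" and "partition_b N A" and "lam \<ge> 1"
  shows "(\<exists>B. partition_b N B \<and> (\<forall>B'. partition_b N B' \<longrightarrow> F_energy N B A lam \<le> F_energy N B' A lam))
       \<and> (\<forall>B. partition_b N B \<and> (\<forall>B'. partition_b N B' \<longrightarrow> F_energy N B A lam \<le> F_energy N B' A lam)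
              \<longrightarrow> (\<Union>i\<in>{1..N}. B i) \<subseteq> partition_hull N A)"
proof (intro conjI allI impI)
  show "\<exists>B. partition_b N B \<and> (\<forall>B'. partition_b N B' \<longrightarrow> F_energy N B A lam \<le> F_energy N B' A lam)"
    by (rule F_energy_minimizer_exists[OF assms(2)])
next
  fix B assume B: "partition_b N B \<and> (\<forall>B'. partition_b N B' \<longrightarrow> F_energy N B A lam \<le> F_energy N B' A lam)"
  have "lam > 0" using assms(3) by simp
  then have "B i \<subseteq> partition_hull N A" if "i \<in> {1..N}" for i
    using minimizer_subset_hull[OF assms(2)] B that by blast
  then show "(\<Union>i\<in>{1..N}. B i) \<subseteq> partition_hull N A" by blast
qed

end
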